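(* Let $\mathfrak g$ be a non-simply-laced simple Lie algebra, $k\ge1$, $\lambda=\sum_\alpha l_\alpha\omega_\alpha$ a dominant integral weight and $\mathbf n=\{n_{\alpha,j}\}_{\alpha\in I_r,1\le j\le t_\alpha k}$ non-negative integers. Let $K=(1,\dots,1)$. Then $$\mathrm{PS}_{u_1,\dots,u_r}\ \varphi_{k+1,0}\big(Z^{(k)}_{\lambda;\mathbf n}(\mathbf u)\big)=\mathrm{PS}_{u_1,\dots,u_r}\ \varphi_{k+1,0}\big(Z^{(k)}_{\lambda;\mathbf n}(\mathbf u)^{[K]}\big).$$
   Context: $\mathfrak g$ is $B_r$, $C_r$, $F_4$ or $G_2$; $I_r=\{1,\dots,r\}$; $C_{\alpha,\beta}=2(\alpha_\alpha,\alpha_\beta)/(\alpha_\alpha,\alpha_\alpha)$. $t_\alpha=1$ for long simple roots, $t_\alpha=2$ for short simple roots of $B_r,C_r,F_4$, $t_\alpha=3$ for the short simple root of $G_2$. $\gamma$ (long) and $\gamma'$ (short) are the two adjacent simple roots of different lengths: $\gamma=r-1,r,2,1$ and $\gamma'=r,r-1,3,2$ for $B_r,C_r,F_4,G_2$ respectively. Formal variables $\mathbf u=\{u_\alpha,u_{\alpha,j},a_j\mid\alpha\in I_r,j\ge1\}$. Let $J^{(k)}_{\mathfrak g}=\{(\alpha,j):\alpha\in I_r,1\le j\le t_\alpha k\}$. For $\mathbf m=\{m_{\alpha,i}\ge0\}_{(\alpha,i)\in J^{(k)}_{\mathfrak g}}$ set $$q_\alpha=l_\alpha+\sum_{(\beta,j)\in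 J^{(k)}_{\mathfrak g}}jC_{\alpha,\beta}m_{\beta,j}-\sum_{j=1}^{t_\alpha k}jn_{\alpha,j},$$ $$q_{\alpha,i}=l_\alpha+\sum_{\substack{(\beta,j)\in J^{(k)}_{\mathfrak g}\\ |C_{\alpha,\beta}|j>|C_{\beta,\alpha}|i}}\operatorname{sgn}(C_{\alpha,\beta})\,(|C_{\alpha,\beta}|j-|C_{\beta,\alpha}|i)\,m_{\beta,j}-\sum_{j=i+1}^{t_\alpha k}(j-i)n_{\alpha,j},$$ and $\Delta_{\alpha,i}=\delta_{\alpha,\gamma'}\,((-i)\bmod t_{\gamma'})\,m_{\alpha,i}$, the residue taken in $\{0,\dots,t_{\gamma'}-1\}$. The generating function is $$Z^{(k)}_{\lambda;\mathbf n}(\mathbf u)=\sum_{\mathbf m}\prod_{\alpha=1}^r u_\alpha^{q_\alpha}\prod_{i=1}^{t_\alpha k}u_{\alpha,i}^{q_{\alpha,i}}a_i^{\Delta_{\alpha,i}}\binom{m_{\alpha,i}+q_{\alpha,i}}{m_{\alpha,i}},$$ with $\binom{m+p}{m}=\frac{(p+m)\cdots(p+1)}{m!}$ for all $p\in\mathbb Z$. For given values of all $q_\alpha$ only finitely many $\mathbf m$ contribute. For $K=(k_1,\dots,k_r)\in\mathbb N^r$, $Z^{(k)}_{\lambda;\mathbf n}(\mathbf u)^{[K]}$ is the same sum restricted to those $\mathbf m$ with $q_{\alpha,j}\ge0$ for all $\alpha\in I_r$ and $k_\alpha\le j\le t_\alpha k$. The map $\varphi_{k+1,0}$ evaluates all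 variables $u_{\alpha,i}$ and $a_i$ occurring in $Z^{(k)}$ at $1$. $\mathrm{PS}_{u_1,\dots,u_r}$ denotes the part of a Laurent series in $u_1,\dots,u_r$ consisting of the monomials in which every $u_\alpha$ has non-negative exponent. *)

theory Defs
  imports Complex_Main "HOL-Library.Poly_Mapping"
begin

section \<open>Non-simply-laced Lie types\<close>

datatype lie_type = TypeB nat | TypeC nat | TypeF4 | TypeG2

text \<open>\<open>TypeB 2\<close> and \<open>TypeC 2\<close> are the same algebra with the two simple roots interchanged;
  both labellings are admitted.\<close>

fun admissible :: "lie_type \<Rightarrow> bool" where
  "admissible (TypeB r) \<longleftrightarrow> 2 \<le> r"
| "admissible (TypeC r) \<longleftrightarrow> 2 \<le> r"
| "admissible TypeF4 \<longleftrightarrow> True"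
| "admissible TypeG2 \<longleftrightarrow> True"

fun rank :: "lie_type \<Rightarrow> nat" where
  "rank (TypeB r) = r"
| "rank (TypeC r) = r"
| "rank TypeF4 = 4"
| "rank TypeG2 = 2"

fun short_root :: "lie_type \<Rightarrow> nat \<Rightarrow> bool" where
  "short_root (TypeB r) \<alpha> \<longleftrightarrow> \<alpha> = r"
| "short_root (TypeC r) \<alpha> \<longleftrightarrow> \<alpha> < r"
| "short_root TypeF4 \<alpha> \<longleftrightarrow> 3 \<le> \<alpha>"
| "short_root TypeG2 \<alpha> \<longleftrightarrow> \<alpha> = 2"

text \<open>The short one of the two adjacent simple roots of different lengths.\<close>

fun gamma' :: "lie_type \<Rightarrow> nat" where
  "gamma' (TypeB r) = r"
| "gamma' (TypeC r) = r - 1"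
| "gamma' TypeF4 = 3"
| "gamma' TypeG2 = 2"

definition t :: "lie_type \<Rightarrow> nat \<Rightarrow> nat" where
  "t g \<alpha> = (if short_root g \<alpha> then (if g = TypeG2 then 3 else 2) else 1)"

text \<open>The Gram matrix \<open>(\<alpha>\<^sub>\<alpha>, \<alpha>\<^sub>\<beta>)\<close> of the simple roots, scaled so that short roots
  have squared length 2. In all four types the Dynkin diagram is the chain
  \<open>1 \<midarrow> 2 \<midarrow> \<dots> \<midarrow> r\<close>, and adjacent simple roots have scalar product minus half of the larger
  of their squared lengths.\<close>

definition sq_length :: "lie_type \<Rightarrow> nat \<Rightarrow> int" where
  "sq_length g \<alpha> = (if short_root g \<alpha> then 2 else 2 * int (t g (gamma' g)))"

definition root_ip :: "lie_type \<Rightarrow> nat \<Rightarrow> nat \<Rightarrow> int" where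
  "root_ip g \<alpha> \<beta> =
     (if \<alpha> = \<beta> then sq_length g \<alpha>
      else if \<alpha> = Suc \<beta> \<or> \<beta> = Suc \<alpha> then - (max (sq_length g \<alpha>) (sq_length g \<beta>) div 2)
      else 0)"

text \<open>The integer divisions here and in \<^const>\<open>root_ip\<close> are exact.\<close>

definition cartan :: "lie_type \<Rightarrow> nat \<Rightarrow> nat \<Rightarrow> int" where
  "cartan g \<alpha> \<beta> = 2 * root_ip g \<alpha> \<beta> div root_ip g \<alpha> \<alpha>"


section \<open>Summation data\<close>

definition J :: "lie_type \<Rightarrow> nat \<Rightarrow> (nat \<times> nat) set" where
  "J g k = {(\<alpha>, j). 1 \<le> \<alpha> \<and> \<alpha> \<le> rank g \<and> 1 \<le> j \<and> j \<le> t g \<alpha> * k}"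

text \<open>Families \<open>m\<close> indexed by \<open>J g k\<close> are functions that vanish outside \<open>J g k\<close>. The weight
  \<open>\<lambda> = \<Sum> l\<^sub>\<alpha> \<omega>\<^sub>\<alpha>\<close> is given by its coefficients \<open>l\<close>.\<close>

definition families :: "lie_type \<Rightarrow> nat \<Rightarrow> (nat \<times> nat \<Rightarrow> nat) set" where
  "families g k = {m. \<forall>x. x \<notin> J g k \<longrightarrow> m x = 0}"

definition q0 :: "lie_type \<Rightarrow> nat \<Rightarrow> (nat \<Rightarrow> nat) \<Rightarrow> (nat \<Rightarrow> nat \<Rightarrow> nat)
    \<Rightarrow> (nat \<times> nat \<Rightarrow> nat) \<Rightarrow> nat \<Rightarrow> int" where
  "q0 g k l n m \<alpha> =
     int (l \<alpha>) + (\<Sum>(\<beta>, j)\<in>J g k. int j * cartan g \<alpha> \<beta> * int (m (\<beta>, j)))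
       - (\<Sum>j = 1..t g \<alpha> * k. int j * int (n \<alpha> j))"

definition q :: "lie_type \<Rightarrow> nat \<Rightarrow> (nat \<Rightarrow> nat) \<Rightarrow> (nat \<Rightarrow> nat \<Rightarrow> nat)
    \<Rightarrow> (nat \<times> nat \<Rightarrow> nat) \<Rightarrow> nat \<Rightarrow> nat \<Rightarrow> int" where
  "q g k l n m \<alpha> i =
     int (l \<alpha>)
     + (\<Sum>(\<beta>, j)\<in>{(\<beta>, j)\<in>J g k. \<bar>cartan g \<alpha> \<beta>\<bar> * int j > \<bar>cartan g \<beta> \<alpha>\<bar> * int i}.
          sgn (cartan g \<alpha> \<beta>)
            * (\<bar>cartan g \<alpha> \<beta>\<bar> * int j - \<bar>cartan g \<beta> \<alpha>\<bar> * int i) * int (m (\<beta>, j)))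
     - (\<Sum>j = i + 1..t g \<alpha> * k. (int j - int i) * int (n \<alpha> j))"

definition Delta :: "lie_type \<Rightarrow> (nat \<times> nat \<Rightarrow> nat) \<Rightarrow> nat \<Rightarrow> nat \<Rightarrow> int" where
  "Delta g m \<alpha> i =
     (if \<alpha> = gamma' g then ((- int i) mod int (t g (gamma' g))) * int (m (\<alpha>, i)) else 0)"

text \<open>The coefficient \<open>binom(m+p, m) = (p+m)\<cdots>(p+1)/m!\<close> for arbitrary integers \<open>p\<close>.\<close>

definition binom :: "nat \<Rightarrow> int \<Rightarrow> rat" where
  "binom m p = of_int (int m + p) gchoose m"


section \<open>Formal series\<close>

text \<open>A Laurent monomial is its finitely supported exponent vector, so Laurent polynomials are
  the monoid algebra of the exponent vectors. A Laurent series in the \<open>u\<^sub>\<alpha>\<close> maps an exponent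
  vector in the \<open>u\<^sub>\<alpha>\<close> to the coefficient of that monomial. The coefficients of the generating
  function are Laurent polynomials in the remaining variables \<open>u\<^sub>\<alpha>\<^sub>,\<^sub>i\<close> and \<open>a\<^sub>i\<close>.\<close>

datatype var = U nat nat | A nat

type_synonym laurent_poly = "(var \<Rightarrow>\<^sub>0 int) \<Rightarrow>\<^sub>0 rat"
type_synonym 'c u_series = "(nat \<Rightarrow>\<^sub>0 int) \<Rightarrow> 'c"

definition var_power :: "var \<Rightarrow> int \<Rightarrow> laurent_poly" where
  "var_power v e = Poly_Mapping.single (Poly_Mapping.single v e) 1"

definition const :: "rat \<Rightarrow> laurent_poly" where
  "const c = Poly_Mapping.single 0 c"

text \<open>The exponent vector of \<open>\<Prod>\<^sub>\<alpha> u\<^sub>\<alpha>\<^bsup>q\<^sub>\<alpha>\<^esup>\<close>.\<close>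

definition u_exponent :: "lie_type \<Rightarrow> nat \<Rightarrow> (nat \<Rightarrow> nat) \<Rightarrow> (nat \<Rightarrow> nat \<Rightarrow> nat)
    \<Rightarrow> (nat \<times> nat \<Rightarrow> nat) \<Rightarrow> (nat \<Rightarrow>\<^sub>0 int)" where
  "u_exponent g k l n m = (\<Sum>\<alpha> = 1..rank g. Poly_Mapping.single \<alpha> (q0 g k l n m \<alpha>))"

definition summand :: "lie_type \<Rightarrow> nat \<Rightarrow> (nat \<Rightarrow> nat) \<Rightarrow> (nat \<Rightarrow> nat \<Rightarrow> nat)
    \<Rightarrow> (nat \<times> nat \<Rightarrow> nat) \<Rightarrow> laurent_poly" where
  "summand g k l n m =
     (\<Prod>\<alpha> = 1..rank g. \<Prod>i = 1..t g \<alpha> * k.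
        var_power (U \<alpha> i) (q g k l n m \<alpha> i) * var_power (A i) (Delta g m \<alpha> i)
          * const (binom (m (\<alpha>, i)) (q g k l n m \<alpha> i)))"

text \<open>The sums over \<open>m\<close> below are finite, see \<open>finite_u_exponent\<close>.\<close>

definition Z :: "lie_type \<Rightarrow> nat \<Rightarrow> (nat \<Rightarrow> nat) \<Rightarrow> (nat \<Rightarrow> nat \<Rightarrow> nat) \<Rightarrow> laurent_poly u_series" where
  "Z g k l n = (\<lambda>e. \<Sum>m\<in>{m\<in>families g k. u_exponent g k l n m = e}. summand g k l n m)"

definition Z_restricted :: "lie_type \<Rightarrow> nat \<Rightarrow> (nat \<Rightarrow> nat) \<Rightarrow> (nat \<Rightarrow> nat \<Rightarrow> nat) \<Rightarrow> (nat \<Rightarrow> nat)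
    \<Rightarrow> laurent_poly u_series" where
  "Z_restricted g k l n K =
     (\<lambda>e. \<Sum>m\<in>{m\<in>families g k. u_exponent g k l n m = e \<and>
                 (\<forall>\<alpha>\<in>{1..rank g}. \<forall>j\<in>{K \<alpha>..t g \<alpha> * k}. 0 \<le> q g k l n m \<alpha> j)}.
        summand g k l n m)"

definition eval_laurent :: "(var \<Rightarrow> rat) \<Rightarrow> laurent_poly \<Rightarrow> rat" where
  "eval_laurent x p =
     (\<Sum>e\<in>Poly_Mapping.keys p. Poly_Mapping.lookup p e *
        (\<Prod>v\<in>Poly_Mapping.keys e. x v powi Poly_Mapping.lookup e v))"

text \<open>The map \<open>\<phi>\<^sub>k\<^sub>+\<^sub>1\<^sub>,\<^sub>0\<close>; the variables \<open>u\<^sub>\<alpha>\<close> are not evaluated.\<close>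

definition phi :: "laurent_poly u_series \<Rightarrow> rat u_series" where
  "phi F = (\<lambda>e. eval_laurent (\<lambda>_. 1) (F e))"

definition PS :: "lie_type \<Rightarrow> 'c::zero u_series \<Rightarrow> 'c u_series" where
  "PS g F = (\<lambda>e. if \<forall>\<alpha>\<in>{1..rank g}. 0 \<le> Poly_Mapping.lookup e \<alpha> then F e else 0)"


section \<open>Finiteness of the sums\<close>

lemma lookup_u_exponent:
  assumes "\<alpha> \<in> {1..rank g}"
  shows "Poly_Mapping.lookup (u_exponent g k l n m) \<alpha> = q0 g k l n m \<alpha>"
  using assms
  by (simp add: u_exponent_def lookup_sum lookup_single when_def if_distrib cong: if_cong)

lemma finite_J: "finite (J g k)"
proof -
  have "J g k \<subseteq> {1..rank g} \<times> {1..3 * k}"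
    by (auto simp: J_def t_def split: if_splits)
  then show ?thesis by (rule finite_subset) simp
qed

text \<open>A positive row vector whose product with the Cartan matrix is positive.\<close>

fun weight :: "lie_type \<Rightarrow> nat \<Rightarrow> int" where
  "weight (TypeB r) \<alpha> = (if \<alpha> = r then int r * int r else 2 * int \<alpha> * (2 * int r - int \<alpha>))"
| "weight (TypeC r) \<alpha> = int \<alpha> * (2 * int r - int \<alpha>)"
| "weight TypeF4 \<alpha> = (if \<alpha> = 1 then 22 else if \<alpha> = 2 then 42 else if \<alpha> = 3 then 30 else 16)"
| "weight TypeG2 \<alpha> = (if \<alpha> = 1 then 10 else 6)"

lemma sum_tridiagonal:
  fixes f :: "nat \<Rightarrow> int"
  assumes "1 \<le> b" "b \<le> r" "\<And>a. a \<noteq> b \<Longrightarrow> a \<noteq> Suc b \<Longrightarrow> b \<noteq> Suc a \<Longrightarrow> f a = 0"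
  shows "(\<Sum>a = 1..r. f a) = (if b > 1 then f (b - 1) else 0) + f b + (if b < r then f (Suc b) else 0)"
proof -
  let ?L = "if b > 1 then {b - 1} else {}" and ?R = "if b < r then {Suc b} else {}"
  have sub: "?L \<union> {b} \<union> ?R \<subseteq> {1..r}"
    using assms(1,2) by auto
  have "(\<Sum>a = 1..r. f a) = (\<Sum>a\<in>?L \<union> {b} \<union> ?R. f a)"
  proof (rule sum.mono_neutral_right[OF _ sub])
    show "\<forall>a\<in>{1..r} - (?L \<union> {b} \<union> ?R). f a = 0"
    proof
      fix a assume "a \<in> {1..r} - (?L \<union> {b} \<union> ?R)"
      then have "a \<noteq> b" "a \<noteq> Suc b" "b \<noteq> Suc a"
        by (auto split: if_splits)
      then show "f a = 0" by (rule assms(3))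
    qed
  qed simp
  also have "\<dots> = (\<Sum>a\<in>?L. f a) + f b + (\<Sum>a\<in>?R. f a)"
    by (cases "b > 1"; cases "b < r") simp_all
  also have "\<dots> = (if b > 1 then f (b - 1) else 0) + f b + (if b < r then f (Suc b) else 0)"
    by simp
  finally show ?thesis .
qed

lemma cartan_zero: "a \<noteq> b \<Longrightarrow> a \<noteq> Suc b \<Longrightarrow> b \<noteq> Suc a \<Longrightarrow> cartan g a b = 0"
  by (auto simp: cartan_def root_ip_def)

lemma cartan_B: "cartan (TypeB r) a b =
    (if a = b then 2 else if a = Suc b \<or> b = Suc a then (if a = r then - 2 else - 1) else 0)"
  by (simp add: cartan_def root_ip_def sq_length_def t_def)

lemma cartan_C: "2 \<le> r \<Longrightarrow> a \<le> r \<Longrightarrow> b \<le> r \<Longrightarrow> cartan (TypeC r) a b =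
    (if a = b then 2 else if a = Suc b \<or> b = Suc a then (if b = r then - 2 else - 1) else 0)"
  by (simp add: cartan_def root_ip_def sq_length_def t_def)

lemma weight_cartan:
  assumes "admissible g" "b \<in> {1..rank g}"
  shows "1 \<le> (\<Sum>a = 1..rank g. weight g a * cartan g a b)"
proof -
  have *: "(\<Sum>a = 1..rank g. weight g a * cartan g a b) =
      (if b > 1 then weight g (b - 1) * cartan g (b - 1) b else 0) + weight g b * cartan g b b
      + (if b < rank g then weight g (Suc b) * cartan g (Suc b) b else 0)"
    using assms(2) by (intro sum_tridiagonal) (auto simp: cartan_zero)
  show ?thesis
  proof (cases g)
    case (TypeB r)
    obtain d where d: "b = Suc d" using assms(2) by (cases b) auto
    consider "r = b" | "r = Suc b" | "r > Suc b" using assms(2) TypeB by force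
    then show ?thesis
      unfolding * unfolding TypeB by cases (use assms(1) TypeB in \<open>simp_all add: cartan_B d algebra_simps\<close>)
  next
    case (TypeC r)
    obtain d where d: "b = Suc d" using assms(2) by (cases b) auto
    consider "r = b" | "r = Suc b" | "r > Suc b" using assms(2) TypeC by force
    then show ?thesis
      unfolding * unfolding TypeC by cases (use assms(1) TypeC in \<open>simp_all add: cartan_C d algebra_simps\<close>)
  next
    case TypeF4
    then consider "b = 1" | "b = 2" | "b = 3" | "b = 4" using assms(2) by fastforce
    then show ?thesis
      unfolding * unfolding TypeF4 by cases (simp_all add: cartan_def root_ip_def sq_length_def t_def)
  next
    case TypeG2
    then consider "b = 1" | "b = 2" using assms(2) by fastforce
    then show ?thesis
      unfolding * unfolding TypeG2 by cases (simp_all add: cartan_def root_ip_def sq_length_def t_def)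
  qed
qed

lemma finite_u_exponent:
  assumes "admissible g"
  shows "finite {m\<in>families g k. u_exponent g k l n m = e}"
proof -
  define c where "c \<alpha> = Poly_Mapping.lookup e \<alpha> - int (l \<alpha>) + (\<Sum>j = 1..t g \<alpha> * k. int j * int (n \<alpha> j))" for \<alpha>
  define N where "N = nat (\<Sum>\<alpha> = 1..rank g. weight g \<alpha> * c \<alpha>)"
  have bound: "m x \<le> N" if m: "m \<in> families g k" "u_exponent g k l n m = e" and x: "x \<in> J g k" for m x
  proof -
    have c: "c \<alpha> = (\<Sum>(\<beta>, j)\<in>J g k. int j * cartan g \<alpha> \<beta> * int (m (\<beta>, j)))"
      if "\<alpha> \<in> {1..rank g}" for \<alpha>
      using lookup_u_exponent[OF that, of k l n m] m(2) by (simp add: c_def q0_def)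
    have "int (m x) \<le> (\<Sum>x\<in>J g k. int (m x))"
      by (rule member_le_sum[OF x _ finite_J]) simp
    also have "\<dots> \<le> (\<Sum>(\<beta>, j)\<in>J g k. int j * int (m (\<beta>, j)) * (\<Sum>\<alpha> = 1..rank g. weight g \<alpha> * cartan g \<alpha> \<beta>))"
    proof (intro sum_mono, clarify)
      fix \<beta> j assume bj: "(\<beta>, j) \<in> J g k"
      then have 1: "1 \<le> (\<Sum>\<alpha> = 1..rank g. weight g \<alpha> * cartan g \<alpha> \<beta>)"
        by (intro weight_cartan assms) (auto simp: J_def)
      have "int (m (\<beta>, j)) = 1 * int (m (\<beta>, j)) * 1" by simp
      also have "\<dots> \<le> int j * int (m (\<beta>, j)) * (\<Sum>\<alpha> = 1..rank g. weight g \<alpha> * cartan g \<alpha> \<beta>)"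
        using bj 1 by (intro mult_mono) (auto simp: J_def)
      finally show "int (m (\<beta>, j)) \<le> int j * int (m (\<beta>, j)) * (\<Sum>\<alpha> = 1..rank g. weight g \<alpha> * cartan g \<alpha> \<beta>)" .
    qed
    also have "\<dots> = (\<Sum>x\<in>J g k. \<Sum>\<alpha> = 1..rank g. weight g \<alpha> * (int (snd x) * cartan g \<alpha> (fst x) * int (m x)))"
      by (intro sum.cong) (auto simp: sum_distrib_left mult_ac)
    also have "\<dots> = (\<Sum>\<alpha> = 1..rank g. weight g \<alpha> * c \<alpha>)"
      by (subst sum.swap) (auto intro!: sum.cong simp: c sum_distrib_left case_prod_unfold)
    finally show ?thesis by (simp add: N_def)
  qed
  have "finite {m. \<forall>x. (x \<in> J g k \<longrightarrow> m x \<in> {..N}) \<and> (x \<notin> J g k \<longrightarrow> m x = 0)}"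
    by (rule finite_set_of_finite_funs) (simp_all add: finite_J)
  then show ?thesis
    by (rule finite_subset[rotated]) (use bound in \<open>auto simp: families_def\<close>)
qed

end

theory Submission
  imports Defs "HOL-Computational_Algebra.Formal_Laurent_Series" "HOL-Computational_Algebra.Polynomial_Factorial"
begin

text \<open>
  Let \<open>Q\<^sub>a\<^sub>,\<^sub>j\<close> solve the Q-system with \<open>Q\<^sub>a\<^sub>,\<^sub>0 = 1\<close>, \<open>Q\<^sub>a\<^sub>,\<^sub>1 = 1 / u\<^sub>a\<close>. Order the variables \<open>m\<^sub>a\<^sub>,\<^sub>i\<close> by
  the time \<open>d\<^sub>a i\<close>, where \<open>d\<^sub>a = t\<^sub>\<gamma>\<^sub>' / t\<^sub>a\<close>: then \<open>q\<^sub>a\<^sub>,\<^sub>i\<close> involves only strictly later variables, and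
  summing out all \<open>m\<close> up to a time \<open>T\<close> by the binomial series leaves a product of integer powers
  of the ratios \<open>Q\<^sub>a\<^sub>,\<^sub>j\<^sub>+\<^sub>1 Q\<^sub>a\<^sub>,\<^sub>j\<^sub>-\<^sub>1 / Q\<^sub>a\<^sub>,\<^sub>j\<^sup>2\<close>. Group the families with a negative \<open>q\<close> by the last time
  \<open>T\<close> at which one occurs, say \<open>q\<^sub>a\<^sub>,\<^sub>p < 0\<close>, and by the values of the later variables. In the sum
  of a class all \<open>Q\<^sub>a\<^sub>,\<^sub>j\<close> occur with non-negative exponents, so if they are polynomials in the
  \<open>1 / u\<^sub>b\<close>, only negative powers of \<open>u\<^sub>a\<close> survive and the power series part vanishes.

  Polynomiality follows from a Laurent phenomenon. Put a free coefficient \<open>g\<^sub>a\<close> in front of the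
  product in the Q-system. An induction on the number of steps shows that the solution is a
  Laurent polynomial in every seed: seen from the next seed, only the exchange polynomials can
  occur as denominators; these are linear in \<open>g\<^sub>a\<close>, hence prime, and a few steps later all variables
  are units along their zero loci. Finally, with \<open>Q\<^sub>a\<^sub>,\<^sub>0 = 1\<close> the seed before has entries
  \<open>(1 - g\<^sub>a) / x\<^sub>a\<close>, so negative powers of \<open>x\<^sub>a\<close> carry factors \<open>1 - g\<^sub>a\<close> and disappear at \<open>g = 1\<close>.
\<close>

section \<open>Laurent polynomials\<close>

text \<open>The obstacle is integrality: the Q-system divides by \<open>Q a (j - 1)\<close> at every
  step. The free coefficients serve twice. They make the exchange polynomials prime, and they
  provide, on the zero locus of one of them, a point where all other coefficients are infinitesimal;
  there every other node keeps residue 1, and five consecutive values at a single node decide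
  everything. The bound on the powers of \<open>u_a\<close> rests on an off-by-one. Summing
  \<open>binom m q * W ^ m\<close> over \<open>m\<close> gives
  \<open>(1 - W) powi (- q - 1)\<close>, so \<open>q < 0\<close> means a non-negative exponent. In a
  class with last negative value at \<open>(a, p)\<close> the exponents \<open>- q - 1\<close> at
  \<open>a\<close> are a non-negative combination of functions \<open>max 0 (i - j)\<close>, and
  these turn the ratios back into the \<open>Q\<close>. The product has degree at most
  \<open>- q_a - 1\<close> in \<open>u_a\<close>, with \<open>q_a\<close> computed from the later
  variables only, and multiplication by \<open>u_a\<close> to the power \<open>q_a\<close> leaves
  degree at most -1. Convergence is formal: each \<open>u_a\<close> gets a degree in an extra
  variable \<open>X\<close>, from a row vector that is positive after multiplication by the Cartan
  matrix.\<close>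

type_synonym lau = "(nat \<Rightarrow>\<^sub>0 int) \<Rightarrow>\<^sub>0 int"

definition mono_at :: "(nat \<Rightarrow> 'f::field) \<Rightarrow> (nat \<Rightarrow>\<^sub>0 int) \<Rightarrow> 'f" where
  "mono_at x e = (\<Prod>v\<in>Poly_Mapping.keys e. x v powi Poly_Mapping.lookup e v)"

text \<open>Variables are numbered by \<open>nat\<close> and may be inverted, so this is a ring
  homomorphism only at points without zero coordinates; the lemmas on products assume this.\<close>

definition ev :: "(nat \<Rightarrow> 'f::field) \<Rightarrow> lau \<Rightarrow> 'f" where
  "ev x p = (\<Sum>e\<in>Poly_Mapping.keys p. of_int (Poly_Mapping.lookup p e) * mono_at x e)"

definition var :: "nat \<Rightarrow> lau" where
  "var v = Poly_Mapping.single (Poly_Mapping.single v 1) 1"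

lemma mono_at_superset:
  assumes "finite S" "Poly_Mapping.keys e \<subseteq> S"
  shows "mono_at x e = (\<Prod>v\<in>S. x v powi Poly_Mapping.lookup e v)"
  unfolding mono_at_def
  by (rule prod.mono_neutral_left) (use assms in \<open>auto simp: in_keys_iff\<close>)

lemma mono_at_0 [simp]: "mono_at x 0 = 1"
  by (simp add: mono_at_def)

lemma mono_at_single [simp]: "mono_at x (Poly_Mapping.single v k) = x v powi k"
  by (simp add: mono_at_def)

lemma mono_at_add:
  assumes "\<And>v. x v \<noteq> 0"
  shows "mono_at x (e + f) = mono_at x e * mono_at x f"
proof -
  let ?S = "Poly_Mapping.keys e \<union> Poly_Mapping.keys f"
  have "mono_at x (e + f) = (\<Prod>v\<in>?S. x v powi Poly_Mapping.lookup (e + f) v)"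
    by (rule mono_at_superset) (use Poly_Mapping.keys_add[of e f] in auto)
  also have "\<dots> = (\<Prod>v\<in>?S. x v powi Poly_Mapping.lookup e v) * (\<Prod>v\<in>?S. x v powi Poly_Mapping.lookup f v)"
    by (simp add: lookup_add power_int_add assms prod.distrib)
  also have "\<dots> = mono_at x e * mono_at x f"
    by (simp add: mono_at_superset[of ?S])
  finally show ?thesis .
qed

lemma ev_superset:
  assumes "finite S" "Poly_Mapping.keys p \<subseteq> S"
  shows "ev x p = (\<Sum>e\<in>S. of_int (Poly_Mapping.lookup p e) * mono_at x e)"
  unfolding ev_def
  by (rule sum.mono_neutral_left) (use assms in \<open>auto simp: in_keys_iff\<close>)

lemma ev_0 [simp]: "ev x 0 = 0"
  by (simp add: ev_def)

lemma ev_single: "ev x (Poly_Mapping.single e c) = of_int c * mono_at x e"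
  by (cases "c = 0") (auto simp: ev_def)

lemma ev_1 [simp]: "ev x 1 = 1"
  using ev_single[of x 0 1] by simp

lemma ev_var [simp]: "ev x (var v) = x v"
  by (simp add: var_def ev_single)

lemma ev_add [simp]: "ev x (p + r) = ev x p + ev x r"
proof -
  let ?S = "Poly_Mapping.keys p \<union> Poly_Mapping.keys r"
  have "ev x (p + r) = (\<Sum>e\<in>?S. of_int (Poly_Mapping.lookup (p + r) e) * mono_at x e)"
    by (rule ev_superset) (use Poly_Mapping.keys_add[of p r] in auto)
  then show ?thesis
    by (simp add: ev_superset[of ?S] lookup_add algebra_simps sum.distrib)
qed

lemma ev_uminus [simp]: "ev x (- p) = - ev x p"
  by (simp add: ev_def sum_negf)

lemma ev_diff [simp]: "ev x (p - r) = ev x p - ev x r"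
  using ev_add[of x p "- r"] by simp

text \<open>Laurent polynomials with integer coefficients are the free abelian group on the exponent
  vectors, so additive statements reduce to monomials.\<close>

lemma lau_induct [case_names zero mono diff]:
  assumes "P 0" "\<And>e. P (Poly_Mapping.single e 1)" "\<And>a b. P a \<Longrightarrow> P b \<Longrightarrow> P (a - b)"
  shows "P (p :: lau)"
  by (rule frag_induction[of p UNIV]) (use assms in auto)

lemma ev_mult:
  assumes "\<And>v. x v \<noteq> 0"
  shows "ev x (p * r) = ev x p * ev x r"
proof (induction p rule: lau_induct)
  case (mono e)
  show ?case
    by (induction r rule: lau_induct)
       (simp_all add: mult_single ev_single mono_at_add assms algebra_simps)
qed (simp_all add: algebra_simps)

lemma ev_power:
  assumes "\<And>v. x v \<noteq> 0"
  shows "ev x (p ^ n) = ev x p ^ n"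
  by (induction n) (simp_all add: ev_mult assms)

lemma ev_prod:
  assumes "\<And>v. x v \<noteq> 0"
  shows "ev x (\<Prod>i\<in>S. f i) = (\<Prod>i\<in>S. ev x (f i))"
  by (induction S rule: infinite_finite_induct) (simp_all add: ev_mult assms)

lemma var_nonzero [simp]: "var v \<noteq> 0"
  by (metis var_def keys_single keys_zero empty_not_insert one_neq_zero)

section \<open>Laurent polynomials inside their field of fractions\<close>

abbreviation lau_fract :: "lau fract set" where
  "lau_fract \<equiv> range to_fract"

lemma lau_fract_intros:
  "0 \<in> lau_fract" "1 \<in> lau_fract"
  "f \<in> lau_fract \<Longrightarrow> f' \<in> lau_fract \<Longrightarrow> f + f' \<in> lau_fract"
  "f \<in> lau_fract \<Longrightarrow> f' \<in> lau_fract \<Longrightarrow> f - f' \<in> lau_fract"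
  "f \<in> lau_fract \<Longrightarrow> f' \<in> lau_fract \<Longrightarrow> f * f' \<in> lau_fract"
  by (auto simp: image_iff simp flip: to_fract_add to_fract_diff to_fract_mult)
     (metis to_fract_0 to_fract_1)+

lemma lau_fract_power: "f \<in> lau_fract \<Longrightarrow> f ^ n \<in> lau_fract"
  by (induction n) (auto intro: lau_fract_intros)

lemma lau_fract_prod: "(\<And>i. i \<in> S \<Longrightarrow> f i \<in> lau_fract) \<Longrightarrow> prod f S \<in> lau_fract"
  by (induction S rule: infinite_finite_induct) (auto intro: lau_fract_intros)

definition gen_var :: "nat \<Rightarrow> lau fract" where "gen_var v = to_fract (var v)"

lemma gen_var_nonzero [simp]: "gen_var v \<noteq> 0"
  by (simp add: gen_var_def)

lemma gen_var_powi: "gen_var v powi k = to_fract (Poly_Mapping.single (Poly_Mapping.single v k) 1)"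
proof -
  have nat: "gen_var v ^ n = to_fract (Poly_Mapping.single (Poly_Mapping.single v (int n)) 1)" for n
    by (induction n) (simp_all add: gen_var_def var_def mult_single single_add algebra_simps flip: to_fract_mult)
  show ?thesis
  proof (cases "k \<ge> 0")
    case True
    then show ?thesis using nat[of "nat k"] by (simp add: power_int_def)
  next
    case False
    have "to_fract (Poly_Mapping.single (Poly_Mapping.single v k) 1) * gen_var v ^ nat (- k) = (1 :: lau fract)"
      using False by (simp add: nat mult_single flip: to_fract_mult single_add)
    then show ?thesis using False
      by (simp add: power_int_def field_simps)
  qed
qed

lemma sum_single_lookup: "(\<Sum>v\<in>Poly_Mapping.keys e. Poly_Mapping.single v (Poly_Mapping.lookup e v)) = e"
  by (rule poly_mapping_eqI) (auto simp: lookup_sum lookup_single when_def in_keys_iff)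

lemma mono_at_gen_var: "mono_at gen_var e = to_fract (Poly_Mapping.single e 1)"
proof -
  have "(\<Prod>v\<in>S. gen_var v powi k v) = to_fract (Poly_Mapping.single (\<Sum>v\<in>S. Poly_Mapping.single v (k v)) 1)"
    if "finite S" for S k
    using that by (induction S) (simp_all add: gen_var_powi mult_single flip: to_fract_mult)
  then show ?thesis
    by (simp add: mono_at_def sum_single_lookup)
qed

lemma ev_gen_var [simp]: "ev gen_var p = to_fract p"
  by (induction p rule: lau_induct) (simp_all add: ev_single mono_at_gen_var)

text \<open>\<open>pev a f v\<close>: the fraction \<open>f\<close> is regular at the point \<open>a\<close> and has the value \<open>v\<close> there.\<close>

definition pev :: "(nat \<Rightarrow> 'f::field) \<Rightarrow> lau fract \<Rightarrow> 'f \<Rightarrow> bool" where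
  "pev a f v \<longleftrightarrow> (\<exists>N D. ev a D \<noteq> 0 \<and> f = to_fract N / to_fract D \<and> v = ev a N / ev a D)"

context
  fixes a :: "nat \<Rightarrow> 'f::field"
  assumes a: "\<And>v. a v \<noteq> 0"
begin

lemma pev_to_fract: "pev a (to_fract p) (ev a p)"
  unfolding pev_def by (intro exI[of _ p] exI[of _ 1]) simp

text \<open>Cross-multiplication is an identity of Laurent polynomials and can be evaluated; hence
  the value does not depend on the chosen fraction.\<close>

lemma pev_unique:
  assumes "pev a f v" "pev a f w"
  shows "v = w"
proof -
  obtain N D N' D' where *: "ev a D \<noteq> 0" "f = to_fract N / to_fract D" "v = ev a N / ev a D"
    "ev a D' \<noteq> 0" "f = to_fract N' / to_fract D'" "w = ev a N' / ev a D'"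
    using assms unfolding pev_def by blast
  then have "D \<noteq> 0" "D' \<noteq> 0" by auto
  then have "to_fract (N * D') = to_fract (N' * D)"
    using *(2,5) by (simp add: field_simps)
  then have "ev a (N * D') = ev a (N' * D)" by (simp only: to_fract_eq_iff)
  then have "ev a N * ev a D' = ev a N' * ev a D" by (simp add: ev_mult a)
  then show ?thesis unfolding *(3,6) using *(1,4) by (simp add: frac_eq_eq)
qed

lemma pev_add:
  assumes "pev a f v" "pev a f' v'"
  shows "pev a (f + f') (v + v')"
proof -
  obtain N D N' D' where *: "ev a D \<noteq> 0" "f = to_fract N / to_fract D" "v = ev a N / ev a D"
    "ev a D' \<noteq> 0" "f' = to_fract N' / to_fract D'" "v' = ev a N' / ev a D'"
    using assms unfolding pev_def by blast
  then have D: "D \<noteq> 0" "D' \<noteq> 0" by auto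
  have "f + f' = to_fract (N * D' + N' * D) / to_fract (D * D')"
    unfolding *(2,5) using D by (simp add: add_frac_eq)
  moreover have "v + v' = ev a (N * D' + N' * D) / ev a (D * D')"
    unfolding *(3,6) using *(1,4) by (simp add: add_frac_eq ev_mult a)
  moreover have "ev a (D * D') \<noteq> 0" using *(1,4) by (simp add: ev_mult a)
  ultimately show ?thesis unfolding pev_def by blast
qed

lemma pev_mult:
  assumes "pev a f v" "pev a f' v'"
  shows "pev a (f * f') (v * v')"
proof -
  obtain N D N' D' where *: "ev a D \<noteq> 0" "f = to_fract N / to_fract D" "v = ev a N / ev a D"
    "ev a D' \<noteq> 0" "f' = to_fract N' / to_fract D'" "v' = ev a N' / ev a D'"
    using assms unfolding pev_def by blast
  then show ?thesis unfolding pev_def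
    by (intro exI[of _ "N * N'"] exI[of _ "D * D'"]) (simp add: ev_mult a)
qed

lemma pev_1: "pev a 1 1" and pev_0: "pev a 0 0"
  using pev_to_fract[of 1] pev_to_fract[of 0] by simp_all

lemma pev_minus:
  assumes "pev a f v"
  shows "pev a (- f) (- v)"
  using pev_mult[OF pev_to_fract[of "- 1"] assms] by simp

lemma pev_diff: "pev a f v \<Longrightarrow> pev a f' v' \<Longrightarrow> pev a (f - f') (v - v')"
  using pev_add[OF _ pev_minus, of f v f' v'] by simp

lemma pev_inverse:
  assumes "pev a f v" "v \<noteq> 0"
  shows "pev a (inverse f) (inverse v)"
proof -
  obtain N D where *: "ev a D \<noteq> 0" "f = to_fract N / to_fract D" "v = ev a N / ev a D"
    using assms unfolding pev_def by blast
  then show ?thesis unfolding pev_def using assms(2)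
    by (intro exI[of _ D] exI[of _ N]) simp
qed

lemma pev_divide: "pev a f v \<Longrightarrow> pev a f' v' \<Longrightarrow> v' \<noteq> 0 \<Longrightarrow> pev a (f / f') (v / v')"
  by (simp add: divide_inverse pev_mult pev_inverse)

lemma pev_power: "pev a f v \<Longrightarrow> pev a (f ^ n) (v ^ n)"
  by (induction n) (simp_all add: pev_1 pev_mult)

lemma pev_powi: "pev a f v \<Longrightarrow> v \<noteq> 0 \<Longrightarrow> pev a (f powi n) (v powi n)"
  by (simp add: power_int_def pev_power pev_inverse)

lemma pev_prod: "(\<And>i. i \<in> S \<Longrightarrow> pev a (f i) (v i)) \<Longrightarrow> pev a (prod f S) (prod v S)"
  by (induction S rule: infinite_finite_induct) (simp_all add: pev_1 pev_mult)

lemma pev_ev: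
  assumes "\<And>v. pev a (x v) (y v)" "\<And>v. y v \<noteq> 0"
  shows "pev a (ev x p) (ev y p)"
proof (induction p rule: lau_induct)
  case (mono e)
  show ?case
    by (simp add: ev_single mono_at_def) (intro pev_prod pev_powi assms)
qed (simp_all add: pev_0 pev_diff)

lemma pev_nonzero: "pev a f v \<Longrightarrow> v \<noteq> 0 \<Longrightarrow> f \<noteq> 0"
  using pev_unique[OF pev_0] by blast

end

lemma gen_var_lau_fract: "gen_var v powi k \<in> lau_fract"
  by (simp add: gen_var_powi)

text \<open>Substituting \<open>r / m\<close> for the variable \<open>z\<close> is a ring homomorphism whose kernel is generated
  by \<open>p = r - z m\<close>, since \<open>m\<close> is a unit.\<close>

lemma linear_prime:
  fixes p :: lau and h :: "lau fract"
  assumes h: "h \<in> lau_fract" "inverse h \<in> lau_fract" "h \<noteq> 0"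
    and p: "gen_var z - h = to_fract p * c" "c \<in> lau_fract"
    and p0: "ev (gen_var(z := h)) p = 0"
    and dvd: "p dvd f * k"
  shows "p dvd f \<or> p dvd k"
proof -
  define Id where "Id = {to_fract p * f' | f'. f' \<in> lau_fract}"
  have Id_diff: "b - b' \<in> Id" if "b \<in> Id" "b' \<in> Id" for b b'
    using that unfolding Id_def by (auto simp flip: right_diff_distrib to_fract_diff)
  have Id_mult: "b * b' \<in> Id" if b: "b \<in> Id" "b' \<in> lau_fract" for b b'
  proof -
    obtain f' where "b = to_fract p * f'" "f' \<in> lau_fract" using b(1) unfolding Id_def by blast
    then have "b * b' = to_fract p * (f' * b')" "f' * b' \<in> lau_fract"
      using lau_fract_intros(5) b(2) by (simp_all add: mult.assoc)
    then show ?thesis unfolding Id_def by blast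
  qed
  let ?z = "gen_var z" and ?x = "gen_var(z := h)"
  have x: "?x v \<noteq> 0" for v using h by simp
  have z: "?z \<in> lau_fract" "inverse ?z \<in> lau_fract"
    using gen_var_lau_fract[of z 1] gen_var_lau_fract[of z "-1"] by simp_all
  have zh: "?z - h \<in> Id" using p unfolding Id_def by auto
  have nat: "?z ^ n - h ^ n \<in> Id" for n
  proof (induction n)
    case 0 then show ?case using lau_fract_intros(1) unfolding Id_def by force
  next
    case (Suc n)
    have "?z ^ Suc n - h ^ Suc n = (?z ^ n - h ^ n) * ?z - (?z - h) * (- (h ^ n))"
      by (simp add: algebra_simps)
    moreover have "- (h ^ n) \<in> lau_fract"
      using lau_fract_intros(4)[OF lau_fract_intros(1) lau_fract_power[OF h(1), of n]] by simp
    ultimately show ?case using Id_diff[OF Id_mult[OF Suc z(1)] Id_mult[OF zh]] by (simp only:)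
  qed
  have int: "?z powi n - h powi n \<in> Id" for n
  proof (cases "n \<ge> 0")
    case True then show ?thesis using nat[of "nat n"] by (simp add: power_int_def)
  next
    case False
    define m where "m = nat (- n)"
    have "?z powi n - h powi n = (?z ^ m - h ^ m) * (- (inverse ?z ^ m * inverse h ^ m))"
      using False h(3) unfolding m_def power_int_def by (simp add: field_simps)
    moreover have "- (inverse ?z ^ m * inverse h ^ m) \<in> lau_fract"
      using lau_fract_intros(4)[OF lau_fract_intros(1) lau_fract_intros(5)[OF lau_fract_power[OF z(2)] lau_fract_power[OF h(2)]]]
      by simp
    ultimately show ?thesis using Id_mult[OF nat] by (simp only:)
  qed
  \<comment> \<open>Congruence modulo \<open>p\<close> of each monomial with its substitution
    extends additively; a polynomial whose substitution vanishes is thus a multiple of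
    \<open>p\<close>.\<close>
  have ker: "to_fract f - ev ?x f \<in> Id" for f
  proof (induction f rule: lau_induct)
    case zero then show ?case using nat[of 0] by simp
  next
    case (mono e)
    let ?S = "insert z (Poly_Mapping.keys e)"
    have *: "mono_at x' e = x' z powi Poly_Mapping.lookup e z *
        (\<Prod>v\<in>Poly_Mapping.keys e - {z}. x' v powi Poly_Mapping.lookup e v)" for x' :: "nat \<Rightarrow> lau fract"
      by (subst mono_at_superset[of ?S]) (auto simp: prod.insert_remove)
    have "to_fract (Poly_Mapping.single e 1) - ev ?x (Poly_Mapping.single e 1) = mono_at gen_var e - mono_at ?x e"
      by (simp add: ev_single mono_at_gen_var)
    also have "\<dots> = (?z powi Poly_Mapping.lookup e z - h powi Poly_Mapping.lookup e z) *
        (\<Prod>v\<in>Poly_Mapping.keys e - {z}. gen_var v powi Poly_Mapping.lookup e v)"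
      unfolding * by (simp add: algebra_simps)
    also have "\<dots> \<in> Id"
      by (intro Id_mult int lau_fract_prod gen_var_lau_fract)
    finally show ?case .
  next
    case (diff a b)
    have "to_fract (a - b) - ev ?x (a - b) = (to_fract a - ev ?x a) - (to_fract b - ev ?x b)"
      by simp
    then show ?case using Id_diff[OF diff] by (simp only:)
  qed
  have dvd_iff: "p dvd f" if f: "ev ?x f = 0" for f
  proof -
    have "to_fract f \<in> Id" using ker[of f] by (simp only: f diff_0_right)
    then obtain f' where "to_fract f = to_fract p * to_fract f'"
      unfolding Id_def by blast
    then have "to_fract f = to_fract (p * f')" by simp
    then have "f = p * f'" by (simp only: to_fract_eq_iff)
    then show ?thesis by simp
  qed
  obtain b where "f * k = p * b" using dvd by auto
  then have "ev ?x f * ev ?x k = ev ?x p * ev ?x b"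
    by (simp only: flip: ev_mult[OF x])
  then have "ev ?x f * ev ?x k = 0" by (simp only: p0 mult_zero_left)
  then show ?thesis using dvd_iff by auto
qed

text \<open>A prime \<open>p\<close> in the known denominator divides the numerator, because a
  second denominator avoids \<open>p\<close>; so the primes are cancelled one at a time. They form a
  list, since a prime may occur repeatedly.\<close>

lemma cancel_primes:
  fixes f :: "lau fract"
  assumes "\<And>p a b. p \<in> set ps \<Longrightarrow> p dvd a * b \<Longrightarrow> p dvd a \<or> p dvd (b::lau)"
    and "\<And>p. p \<in> set ps \<Longrightarrow> p \<noteq> 0"
    and "\<And>p. p \<in> set ps \<Longrightarrow> \<exists>D. \<not> p dvd D \<and> f * to_fract D \<in> lau_fract"
    and "f * to_fract (prod_list ps) \<in> lau_fract"
  shows "f \<in> lau_fract"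
  using assms
proof (induction ps)
  case Nil
  then show ?case by simp
next
  case (Cons p ps)
  define f' where "f' = f * to_fract (prod_list ps)"
  obtain N where N: "f' * to_fract p = to_fract N"
    using Cons.prems(4) unfolding f'_def by (auto simp: mult_ac)
  obtain D where D: "\<not> p dvd D" "f * to_fract D \<in> lau_fract"
    using Cons.prems(3)[of p] by auto
  have "f' * to_fract D \<in> lau_fract"
    using lau_fract_intros(5)[OF D(2), of "to_fract (prod_list ps)"] unfolding f'_def by (simp add: mult_ac)
  then obtain N' where N': "f' * to_fract D = to_fract N'" by auto
  have "to_fract (N * D) = to_fract (p * N')"
    using N N' by (simp flip: N N' add: mult_ac)
  then have "p dvd N * D" by (metis dvd_triv_left to_fract_eq_iff)
  then have "p dvd N" using D(1) Cons.prems(1)[of p] by auto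
  then obtain N1 where "N = p * N1" by auto
  then have "f' = to_fract N1" using N Cons.prems(2)[of p] by simp
  then show ?case
    using Cons by (auto simp: f'_def)
qed

section \<open>The Q-system as a recursion on seeds\<close>

type_synonym 'f state = "(nat \<Rightarrow> 'f) \<times> (nat \<Rightarrow> 'f)"

text \<open>The two layers of a seed and the coefficients share the variables of \<open>lau\<close>,
  separated by the residue modulo 3.\<close>

definition old_ix :: "nat \<Rightarrow> nat" where "old_ix a = 3 * a"
definition new_ix :: "nat \<Rightarrow> nat" where "new_ix a = 3 * a + 1"
definition coef_ix :: "nat \<Rightarrow> nat" where "coef_ix a = 3 * a + 2"

definition seed_at :: "'f state \<Rightarrow> (nat \<Rightarrow> 'f) \<Rightarrow> nat \<Rightarrow> 'f" where
  "seed_at s g v = (if v mod 3 = 0 then fst s (v div 3) else if v mod 3 = 1 then snd s (v div 3) else g (v div 3))"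

lemma ix_cases:
  obtains a where "v = old_ix a" | a where "v = new_ix a" | a where "v = coef_ix a"
proof -
  have "v = old_ix (v div 3) \<or> v = new_ix (v div 3) \<or> v = coef_ix (v div 3)"
    unfolding old_ix_def new_ix_def coef_ix_def by linarith
  then show thesis using that by metis
qed

lemma ix_eq_iff [simp]:
  "old_ix a = old_ix b \<longleftrightarrow> a = b" "new_ix a = new_ix b \<longleftrightarrow> a = b" "coef_ix a = coef_ix b \<longleftrightarrow> a = b"
  "old_ix a \<noteq> new_ix b" "old_ix a \<noteq> coef_ix b" "new_ix a \<noteq> old_ix b"
  "new_ix a \<noteq> coef_ix b" "coef_ix a \<noteq> old_ix b" "coef_ix a \<noteq> new_ix b"
  unfolding old_ix_def new_ix_def coef_ix_def by presburger+

lemma seed_at_simps [simp]: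
  "seed_at s g (old_ix a) = fst s a" "seed_at s g (new_ix a) = snd s a" "seed_at s g (coef_ix a) = g a"
proof -
  have "(3 * a + 1) div 3 = a" "(3 * a + 2) div 3 = a" "(3 * a + 1) mod 3 = 1" "(3 * a + 2) mod 3 = 2"
    by presburger+
  then show "seed_at s g (old_ix a) = fst s a" "seed_at s g (new_ix a) = snd s a" "seed_at s g (coef_ix a) = g a"
    unfolding seed_at_def old_ix_def new_ix_def coef_ix_def by simp_all
qed

lemma seed_at_cases: "(\<And>a. P (fst s a)) \<Longrightarrow> (\<And>a. P (snd s a)) \<Longrightarrow> (\<And>a. P (g a)) \<Longrightarrow> P (seed_at s g v)"
  by (simp add: seed_at_def)

definition gen :: "lau fract state" where
  "gen = (\<lambda>a. gen_var (old_ix a), \<lambda>a. gen_var (new_ix a))"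

definition gen_g :: "nat \<Rightarrow> lau fract" where
  "gen_g a = gen_var (coef_ix a)"

text \<open>Between the times of two consecutive values of a long root \<open>Q\<close>, the product
  of the \<open>Q\<^bsub>\<lfloor>(\<tau> + s) / t\<rfloor>\<^esub>\<close> over \<open>s < t\<close> interpolates between them; \<open>interp t \<tau>\<close> is the exponent of the later one.\<close>

definition interp :: "nat \<Rightarrow> nat \<Rightarrow> nat" where
  "interp b \<tau> = (\<tau> + (b - 1)) mod b + 1"

lemma interp_1 [simp]: "interp (Suc 0) \<tau> = 1"
  by (simp add: interp_def)

text \<open>Only the neighbourhoods in the Dynkin diagram and the periods \<open>d\<close> enter;
  \<open>d a\<close> is the time between two moves of node \<open>a\<close>. By \<open>d_nb\<close>,
  of two neighbours with different periods one moves at every time.\<close>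

locale q_system =
  fixes nb :: "nat \<Rightarrow> nat set" and d :: "nat \<Rightarrow> nat"
  assumes finite_nb: "finite (nb a)" and nb_sym: "b \<in> nb a \<Longrightarrow> a \<in> nb b" and nb_irrefl: "a \<notin> nb a"
    and d_pos: "0 < d a" and d_nb: "b \<in> nb a \<Longrightarrow> d a = d b \<or> d a = 1 \<or> d b = 1"
begin

text \<open>The absolute value of the Cartan entry at \<open>a\<close>, \<open>b\<close> for
  neighbours.\<close>

definition bond :: "nat \<Rightarrow> nat \<Rightarrow> nat" where
  "bond a b = (if d a = d b then 1 else d b)"

lemma bond_pos: "0 < bond a b"
  by (simp add: bond_def d_pos)

definition neighbours :: "nat \<Rightarrow> 'f::comm_ring_1 state \<Rightarrow> nat \<Rightarrow> 'f" where
  "neighbours \<tau> s a = (\<Prod>b\<in>nb a.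
     fst s b ^ (bond a b - interp (bond a b) \<tau>) * snd s b ^ interp (bond a b) \<tau>)"

text \<open>A state holds the last two values at every node. The node \<open>a\<close> moves at the times divisible by
  \<open>d a\<close>: its \<open>j\<close>-th exchange relation takes place at time \<open>d a * j\<close>.\<close>

definition step :: "(nat \<Rightarrow> 'f::field) \<Rightarrow> nat \<Rightarrow> 'f state \<Rightarrow> 'f state" where
  "step g \<tau> s =
    (\<lambda>a. if d a dvd \<tau> then snd s a else fst s a,
     \<lambda>a. if d a dvd \<tau> then ((snd s a)\<^sup>2 - g a * neighbours \<tau> s a) / fst s a else snd s a)"

primrec run :: "(nat \<Rightarrow> 'f::field) \<Rightarrow> nat \<Rightarrow> nat \<Rightarrow> 'f state \<Rightarrow> 'f state" where
  "run g \<tau> 0 s = s"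
| "run g \<tau> (Suc n) s = step g (\<tau> + n) (run g \<tau> n s)"

lemma run_add: "run g \<tau> (m + n) s = run g (\<tau> + m) n (run g \<tau> m s)"
  by (induction n) (simp_all add: add.assoc)

lemma ev_neighbours:
  assumes "\<And>v. x v \<noteq> 0"
  shows "ev x (neighbours \<tau> w a) = neighbours \<tau> (\<lambda>b. ev x (fst w b), \<lambda>b. ev x (snd w b)) a"
  by (simp add: neighbours_def ev_prod ev_mult ev_power assms)

lemma pev_neighbours:
  assumes "\<And>v. x v \<noteq> 0" "\<And>b. pev x (fst s b) (fst s' b)" "\<And>b. pev x (snd s b) (snd s' b)"
  shows "pev x (neighbours \<tau> s a) (neighbours \<tau> s' a)"
  unfolding neighbours_def by (intro pev_prod pev_mult pev_power assms)

text \<open>At the point with all seed variables 1 and all coefficients \<open>g\<close> equal to \<open>-1\<close> the recursion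
  is subtraction-free, so nothing vanishes.\<close>

lemma run_gen_nonzero: "fst (run gen_g \<tau> n gen) a \<noteq> 0" "snd (run gen_g \<tau> n gen) a \<noteq> 0"
proof -
  define x :: "nat \<Rightarrow> rat" where "x = seed_at (\<lambda>_. 1, \<lambda>_. 1) (\<lambda>_. -1)"
  have x: "x v \<noteq> 0" for v unfolding x_def by (rule seed_at_cases) auto
  have var: "pev x (gen_var v) (x v)" for v
    using pev_to_fract[where a = x and p = "var v"] x by (simp add: gen_var_def)
  have g: "pev x (gen_g a) (-1)" for a
    using var[of "coef_ix a"] by (simp add: gen_g_def x_def)
  have "\<exists>s'. \<forall>a. pev x (fst (run gen_g \<tau> n gen) a) (fst s' a) \<and> pev x (snd (run gen_g \<tau> n gen) a) (snd s' a)
          \<and> 0 < fst s' a \<and> 0 < snd s' a"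
  proof (induction n)
    case 0
    show ?case
      using var[of "old_ix a" for a] var[of "new_ix a" for a]
      by (intro exI[of _ "(\<lambda>_. 1, \<lambda>_. 1)"]) (simp add: gen_def x_def)
  next
    case (Suc n)
    let ?s = "run gen_g \<tau> n gen"
    obtain s' where s': "\<And>a. pev x (fst ?s a) (fst s' a)" "\<And>a. pev x (snd ?s a) (snd s' a)"
      "\<And>a. 0 < fst s' a" "\<And>a. 0 < snd s' a"
      using Suc by blast
    have pos: "0 < neighbours (\<tau> + n) s' a" for a
      unfolding neighbours_def using s' by (intro prod_pos) simp
    have nz: "fst s' a \<noteq> 0" for a using s'(3)[of a] by simp
    have "pev x (((snd ?s a)\<^sup>2 - gen_g a * neighbours (\<tau> + n) ?s a) / fst ?s a)
        (((snd s' a)\<^sup>2 - (- 1) * neighbours (\<tau> + n) s' a) / fst s' a)" for a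
      using nz by (intro s' pev_divide pev_diff pev_power pev_mult g x pev_neighbours)
    then have "pev x (snd (run gen_g \<tau> (Suc n) gen) a) (snd (step (\<lambda>_. - 1) (\<tau> + n) s') a)" for a
      using s'(2) by (simp add: step_def)
    moreover have "0 < ((snd s' a)\<^sup>2 + neighbours (\<tau> + n) s' a) / fst s' a" for a
      by (intro divide_pos_pos add_pos_pos zero_less_power s'(3,4) pos)
    then have "0 < snd (step (\<lambda>_. - 1) (\<tau> + n) s') a" for a
      using s'(4) by (simp add: step_def)
    moreover have "pev x (fst (run gen_g \<tau> (Suc n) gen) a) (fst (step (\<lambda>_. - 1) (\<tau> + n) s') a)"
        "0 < fst (step (\<lambda>_. - 1) (\<tau> + n) s') a" for a
      using s' by (simp_all add: step_def)
    ultimately show ?case by blast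
  qed
  then obtain s' where s': "pev x (fst (run gen_g \<tau> n gen) a) (fst s' a)" "pev x (snd (run gen_g \<tau> n gen) a) (snd s' a)"
    "fst s' a \<noteq> 0" "snd s' a \<noteq> 0"
    by (metis less_irrefl)
  show "fst (run gen_g \<tau> n gen) a \<noteq> 0" "snd (run gen_g \<tau> n gen) a \<noteq> 0"
    by (rule pev_nonzero[OF x s'(1,3)], rule pev_nonzero[OF x s'(2,4)])
qed

section \<open>Seeds as Laurent polynomials in the initial seed\<close>

definition laurent_run :: "nat \<Rightarrow> nat \<Rightarrow> bool" where
  "laurent_run \<tau> n \<longleftrightarrow> (\<forall>i\<le>n. \<forall>a. fst (run gen_g \<tau> i gen) a \<in> lau_fract \<and> snd (run gen_g \<tau> i gen) a \<in> lau_fract)"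

text \<open>Meaningful only where \<open>laurent_run\<close> holds; otherwise the inverse of
  \<open>to_fract\<close> is unspecified.\<close>

definition lrun :: "nat \<Rightarrow> nat \<Rightarrow> lau state" where
  "lrun \<tau> n = (\<lambda>a. inv to_fract (fst (run gen_g \<tau> n gen) a), \<lambda>a. inv to_fract (snd (run gen_g \<tau> n gen) a))"

lemma to_fract_lrun:
  assumes "laurent_run \<tau> n" "i \<le> n"
  shows "to_fract (fst (lrun \<tau> i) a) = fst (run gen_g \<tau> i gen) a"
    "to_fract (snd (lrun \<tau> i) a) = snd (run gen_g \<tau> i gen) a"
  using assms by (simp_all add: laurent_run_def lrun_def f_inv_into_f)

lemma lrun_0: "lrun \<tau> 0 = (\<lambda>a. var (old_ix a), \<lambda>a. var (new_ix a))"
proof -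
  have "inj (to_fract :: lau \<Rightarrow> _)" by (rule injI) simp
  then show ?thesis by (simp add: lrun_def gen_def gen_var_def)
qed

lemma lrun_Suc:
  assumes "laurent_run \<tau> n" "i < n"
  shows "fst (lrun \<tau> (Suc i)) a = (if d a dvd \<tau> + i then snd (lrun \<tau> i) a else fst (lrun \<tau> i) a)"
    "\<not> d a dvd \<tau> + i \<Longrightarrow> snd (lrun \<tau> (Suc i)) a = snd (lrun \<tau> i) a"
    "d a dvd \<tau> + i \<Longrightarrow> snd (lrun \<tau> (Suc i)) a * fst (lrun \<tau> i) a
       = (snd (lrun \<tau> i) a)\<^sup>2 - var (coef_ix a) * neighbours (\<tau> + i) (lrun \<tau> i) a"
proof -
  note L = to_fract_lrun[OF assms(1)]
  show "fst (lrun \<tau> (Suc i)) a = (if d a dvd \<tau> + i then snd (lrun \<tau> i) a else fst (lrun \<tau> i) a)"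
    "\<not> d a dvd \<tau> + i \<Longrightarrow> snd (lrun \<tau> (Suc i)) a = snd (lrun \<tau> i) a"
    by (simp_all add: lrun_def step_def)
  assume act: "d a dvd \<tau> + i"
  have N: "to_fract (neighbours (\<tau> + i) (lrun \<tau> i) a) = neighbours (\<tau> + i) (run gen_g \<tau> i gen) a"
    using ev_neighbours[of gen_var "\<tau> + i" "lrun \<tau> i" a] assms(2) by (simp add: L)
  have "to_fract (snd (lrun \<tau> (Suc i)) a * fst (lrun \<tau> i) a)
     = to_fract ((snd (lrun \<tau> i) a)\<^sup>2 - var (coef_ix a) * neighbours (\<tau> + i) (lrun \<tau> i) a)"
    using assms(2) act run_gen_nonzero(1)[of \<tau> i a]
    by (simp add: L N power2_eq_square step_def gen_g_def gen_var_def)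
  then show "snd (lrun \<tau> (Suc i)) a * fst (lrun \<tau> i) a
       = (snd (lrun \<tau> i) a)\<^sup>2 - var (coef_ix a) * neighbours (\<tau> + i) (lrun \<tau> i) a"
    by (simp only: to_fract_eq_iff)
qed

text \<open>The relations of \<open>lrun\<close> are identities of Laurent polynomials and survive
  specialisation; as the divisors do not vanish, they determine the next state.\<close>

lemma run_eq_ev:
  assumes L: "laurent_run \<tau> n" and nz: "\<And>v. seed_at s g v \<noteq> 0"
    and run: "\<And>i a. i < n \<Longrightarrow> fst (run g \<tau> i s) a \<noteq> 0" and "i \<le> n"
  shows "run g \<tau> i s = (\<lambda>a. ev (seed_at s g) (fst (lrun \<tau> i) a), \<lambda>a. ev (seed_at s g) (snd (lrun \<tau> i) a))"
  using \<open>i \<le> n\<close>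
proof (induction i)
  case 0
  show ?case by (simp add: lrun_0)
next
  case (Suc i)
  then have i: "i < n" and IH: "run g \<tau> i s = (\<lambda>a. ev (seed_at s g) (fst (lrun \<tau> i) a), \<lambda>a. ev (seed_at s g) (snd (lrun \<tau> i) a))"
    by simp_all
  let ?x = "seed_at s g"
  have 1: "fst (run g \<tau> (Suc i) s) a = ev ?x (fst (lrun \<tau> (Suc i)) a)" for a
    using IH by (simp add: step_def lrun_Suc(1)[OF L i])
  have 2: "snd (run g \<tau> (Suc i) s) a = ev ?x (snd (lrun \<tau> (Suc i)) a)" for a
  proof (cases "d a dvd \<tau> + i")
    case False
    then show ?thesis using IH by (simp add: step_def lrun_Suc(2)[OF L i])
  next
    case True
    have "ev ?x (snd (lrun \<tau> (Suc i)) a) * ev ?x (fst (lrun \<tau> i) a)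
        = ev ?x ((snd (lrun \<tau> i) a)\<^sup>2 - var (coef_ix a) * neighbours (\<tau> + i) (lrun \<tau> i) a)"
      using lrun_Suc(3)[OF L i True] by (simp flip: ev_mult[OF nz])
    also have "\<dots> = (snd (run g \<tau> i s) a)\<^sup>2 - g a * neighbours (\<tau> + i) (run g \<tau> i s) a"
      using ev_var[of ?x "coef_ix a"]
      by (simp only: ev_diff ev_mult[OF nz] ev_power[OF nz] ev_neighbours[OF nz] IH fst_conv snd_conv seed_at_simps)
    finally show ?thesis using True run[OF i, of a] IH
      by (simp add: step_def field_simps)
  qed
  show ?case using 1 2 by (metis ext prod.collapse)
qed

end

section \<open>Passing the zero locus of an exchange polynomial\<close>

text \<open>A local ring inside a field, given by its residue relation.\<close>

locale residue =
  fixes res :: "'f::field \<Rightarrow> 'k::field \<Rightarrow> bool"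
  assumes res_1: "res 1 1"
    and res_diff: "res f c \<Longrightarrow> res f' c' \<Longrightarrow> res (f - f') (c - c')"
    and res_mult: "res f c \<Longrightarrow> res f' c' \<Longrightarrow> res (f * f') (c * c')"
    and res_inverse: "res f c \<Longrightarrow> c \<noteq> 0 \<Longrightarrow> res (inverse f) (inverse c)"
begin

definition reg :: "'f \<Rightarrow> bool" where "reg f \<longleftrightarrow> (\<exists>c. res f c)"

lemma regI: "res f c \<Longrightarrow> reg f"
  by (auto simp: reg_def)

lemma res_0: "res 0 0"
  using res_diff[OF res_1 res_1] by simp

lemma res_minus: "res f c \<Longrightarrow> res (- f) (- c)"
  using res_diff[OF res_0, of f c] by simp

lemma res_add: "res f c \<Longrightarrow> res f' c' \<Longrightarrow> res (f + f') (c + c')"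
  using res_diff[OF _ res_minus, of f c f' c'] by simp

lemma res_divide: "res f c \<Longrightarrow> res f' c' \<Longrightarrow> c' \<noteq> 0 \<Longrightarrow> res (f / f') (c / c')"
  by (simp add: divide_inverse res_mult res_inverse)

lemma res_power: "res f c \<Longrightarrow> res (f ^ n) (c ^ n)"
  by (induction n) (simp_all add: res_1 res_mult)

lemma res_prod: "(\<And>i. i \<in> S \<Longrightarrow> res (f i) (c i)) \<Longrightarrow> res (prod f S) (prod c S)"
  by (induction S rule: infinite_finite_induct) (simp_all add: res_1 res_mult)

lemma reg_mult: "reg f \<Longrightarrow> reg f' \<Longrightarrow> reg (f * f')"
  and reg_power: "reg f \<Longrightarrow> reg (f ^ n)"
  unfolding reg_def by (blast intro: res_mult res_power)+

lemma reg_prod: "(\<And>i. i \<in> S \<Longrightarrow> reg (f i)) \<Longrightarrow> reg (prod f S)"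
  by (induction S rule: infinite_finite_induct) (auto intro: reg_mult regI res_1)

text \<open>Congruence modulo \<open>z\<close> times the maximal ideal.\<close>

definition cong_mod :: "'f \<Rightarrow> 'f \<Rightarrow> 'f \<Rightarrow> bool" where
  "cong_mod z f f' \<longleftrightarrow> (\<exists>h. res h 0 \<and> f = f' + z * h)"

lemma cong_mod_refl: "cong_mod z f f"
  unfolding cong_mod_def by (intro exI[of _ 0]) (simp add: res_0)

lemma cong_mod_sym: "cong_mod z f f' \<Longrightarrow> cong_mod z f' f"
  unfolding cong_mod_def using res_minus by (metis add.inverse_neutral add_diff_cancel diff_conv_add_uminus mult_minus_right)

lemma cong_mod_trans: "cong_mod z f f' \<Longrightarrow> cong_mod z f' f'' \<Longrightarrow> cong_mod z f f''"
  unfolding cong_mod_def using res_add by (metis add.assoc add.right_neutral add.commute distrib_left)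

lemma cong_mod_mult:
  assumes "cong_mod z f f'" "cong_mod z k k'" "reg f" "reg k'"
  shows "cong_mod z (f * k) (f' * k')"
proof -
  obtain h1 h2 c c' where h: "res h1 0" "f = f' + z * h1" "res h2 0" "k = k' + z * h2" "res f c" "res k' c'"
    using assms unfolding cong_mod_def reg_def by blast
  have "res (f * h2 + h1 * k') 0"
    using res_add[OF res_mult[OF h(5,3)] res_mult[OF h(1,6)]] by simp
  moreover have "f * k = f' * k' + z * (f * h2 + h1 * k')"
    using h(2,4) by (simp add: algebra_simps)
  ultimately show ?thesis unfolding cong_mod_def by blast
qed

lemma cong_mod_power:
  assumes "cong_mod z f f'" "reg f" "reg f'"
  shows "cong_mod z (f ^ n) (f' ^ n)"
  by (induction n) (auto intro: cong_mod_refl cong_mod_mult reg_power assms)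

lemma cong_mod_prod:
  assumes "\<And>i. i \<in> S \<Longrightarrow> cong_mod z (f i) (f' i)" "\<And>i. i \<in> S \<Longrightarrow> reg (f i)" "\<And>i. i \<in> S \<Longrightarrow> reg (f' i)"
  shows "cong_mod z (prod f S) (prod f' S)"
  using assms
  by (induction S rule: infinite_finite_induct) (auto intro!: cong_mod_mult reg_prod intro: cong_mod_refl)

text \<open>Dividing by the units \<open>r i\<close>, all quotients of consecutive terms agree with
  \<open>\<rho>\<close> modulo \<open>z\<close> times the maximal ideal, so \<open>r i\<close> is
  congruent to \<open>r 0 * \<rho> ^ i\<close>.\<close>

lemma cong_mod_geometric:
  assumes res: "\<And>i. i \<le> 2 * n \<Longrightarrow> res (r i) 1"
    and rec: "\<And>i. 0 < i \<Longrightarrow> i < 2 * n \<Longrightarrow> cong_mod z (r (Suc i) * r (i - 1)) ((r i)\<^sup>2)"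
    and nz: "\<And>i. r i \<noteq> 0"
  shows "cong_mod z (r 0 * r (2 * n)) ((r n)\<^sup>2)"
proof (cases "n = 0")
  case True
  then show ?thesis by (simp add: cong_mod_refl power2_eq_square)
next
  case False
  define \<rho> where "\<rho> = r 1 / r 0"
  have reg: "reg (r i)" if "i \<le> 2 * n" for i using res[OF that] by (rule regI)
  have reg_inv: "reg (inverse (r i))" if "i \<le> 2 * n" for i
    using res_inverse[OF res[OF that]] regI by simp
  have regr: "reg \<rho>" unfolding \<rho>_def divide_inverse using False by (intro reg_mult reg reg_inv) auto
  have ratio: "cong_mod z (r (Suc i)) (r i * \<rho>)" if "Suc i \<le> 2 * n" for i
    using that
  proof (induction i)
    case 0
    show ?case using nz[of 0] by (simp add: \<rho>_def cong_mod_refl)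
  next
    case (Suc i)
    have "cong_mod z (r (Suc (Suc i)) * r i) (r (Suc i) * r (Suc i))"
      using rec[of "Suc i"] Suc.prems by (simp add: power2_eq_square)
    also have "cong_mod z (r (Suc i) * r (Suc i)) (r (Suc i) * (r i * \<rho>))"
      using Suc by (intro cong_mod_mult cong_mod_refl reg reg_mult regr) auto
    finally (cong_mod_trans) have *: "cong_mod z (r (Suc (Suc i)) * r i) (r (Suc i) * (r i * \<rho>))" .
    have "cong_mod z (r (Suc (Suc i)) * r i * inverse (r i)) (r (Suc i) * (r i * \<rho>) * inverse (r i))"
      using Suc.prems by (intro cong_mod_mult[OF * cong_mod_refl] reg reg_mult reg_inv) auto
    then show ?case using nz[of i] by (simp add: field_simps)
  qed
  have pow: "cong_mod z (r i) (r 0 * \<rho> ^ i)" if "i \<le> 2 * n" for i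
    using that
  proof (induction i)
    case 0
    show ?case by (simp add: cong_mod_refl)
  next
    case (Suc i)
    have "cong_mod z (r (Suc i)) (r i * \<rho>)" using ratio Suc by simp
    also have "cong_mod z (r i * \<rho>) (r 0 * \<rho> ^ i * \<rho>)"
      using Suc by (intro cong_mod_mult cong_mod_refl reg regr) auto
    finally (cong_mod_trans) show ?case by (simp add: mult_ac)
  qed
  have "cong_mod z (r 0 * r (2 * n)) (r 0 * (r 0 * \<rho> ^ (2 * n)))"
    by (intro cong_mod_mult cong_mod_refl pow reg reg_mult reg_power regr) auto
  also have "r 0 * (r 0 * \<rho> ^ (2 * n)) = (r 0 * \<rho> ^ n) ^ 2"
    unfolding power_even_eq by (simp add: power2_eq_square mult_ac)
  also have "cong_mod z \<dots> ((r n) ^ 2)"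
    by (intro cong_mod_sym[OF cong_mod_power] pow reg reg_mult reg_power regr) auto
  finally (cong_mod_trans) show ?thesis .
qed

end

context q_system begin

lemma neighbours_factor:
  assumes "c \<in> nb b"
  shows "neighbours \<tau> s b = fst s c ^ (bond b c - interp (bond b c) \<tau>) * snd s c ^ interp (bond b c) \<tau>
    * (\<Prod>c\<in>nb b - {c}. fst s c ^ (bond b c - interp (bond b c) \<tau>) * snd s c ^ interp (bond b c) \<tau>)"
  unfolding neighbours_def using assms finite_nb by (subst prod.remove) auto

lemma run_inactive:
  assumes "\<And>j. i \<le> j \<Longrightarrow> j < i + k \<Longrightarrow> \<not> d b dvd \<tau> + j"
  shows "fst (run g \<tau> (i + k) s) b = fst (run g \<tau> i s) b" "snd (run g \<tau> (i + k) s) b = snd (run g \<tau> i s) b"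
proof -
  have "fst (run g \<tau> (i + k) s) b = fst (run g \<tau> i s) b \<and> snd (run g \<tau> (i + k) s) b = snd (run g \<tau> i s) b"
    using assms by (induction k) (simp_all add: step_def)
  then show "fst (run g \<tau> (i + k) s) b = fst (run g \<tau> i s) b" "snd (run g \<tau> (i + k) s) b = snd (run g \<tau> i s) b"
    by auto
qed

lemma run_active:
  assumes "d b dvd \<tau> + i" "fst (run g \<tau> i s) b \<noteq> 0"
  shows "fst (run g \<tau> (Suc i) s) b = snd (run g \<tau> i s) b"
    "snd (run g \<tau> (Suc i) s) b * fst (run g \<tau> i s) b
       = (snd (run g \<tau> i s) b)\<^sup>2 - g b * neighbours (\<tau> + i) (run g \<tau> i s) b"
  using assms by (simp_all add: step_def)

end

lemma interp_pos: "0 < interp b \<tau>"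
  by (simp add: interp_def)

lemma interp_dvd: "b dvd \<tau> \<Longrightarrow> interp b (\<tau> + i) = interp b i"
  by (simp add: interp_def add.assoc mod_add_eq[symmetric, of \<tau>] del: mod_add_left_eq)

lemma interp_id: "0 < i \<Longrightarrow> i \<le> b \<Longrightarrow> interp b i = i"
proof -
  assume i: "0 < i" "i \<le> b"
  then have "(i + (b - 1)) mod b = ((i - 1) + b) mod b" by simp
  also have "\<dots> = i - 1" using i by (simp only: mod_add_self2) simp
  finally show ?thesis using i by (simp add: interp_def)
qed

lemma interp_add_self: "interp b (i + b) = interp b i"
  by (simp add: interp_def algebra_simps)

text \<open>The recursion near a generic point of the zero locus of the exchange polynomial of \<open>a\<close> at
  time \<open>\<tau>\<close>. The successive values \<open>y0, \<dots>, y4\<close> at \<open>a\<close> have residues \<open>1, 1, 0, -1, -1\<close>, those at other nodes have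
  residue 1. Since \<open>y4\<close> is a quotient by \<open>y2\<close>, its residue needs the neighbour products \<open>M1, M2, M3\<close>
  to be a geometric progression modulo \<open>y2\<close> times the maximal ideal.\<close>

locale vanishing = q_system nb d + residue res
  for nb d and res :: "'f::field \<Rightarrow> 'k::field \<Rightarrow> bool" +
  fixes g :: "nat \<Rightarrow> 'f" and \<tau> :: nat and a :: nat and s :: "nat \<Rightarrow> 'f state"
  assumes s_def: "s i = run g \<tau> i (s 0)"
    and active: "d a dvd \<tau>"
    and nonzero: "fst (s i) b \<noteq> 0" "snd (s i) b \<noteq> 0"
    and res_s0: "res (fst (s 0) b) 1" "res (snd (s 0) b) 1"
    and res_g: "res (g a) 1" "b \<noteq> a \<Longrightarrow> res (g b) 0"
begin

lemma s_inactive: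
  assumes "\<And>j. i \<le> j \<Longrightarrow> j < i + k \<Longrightarrow> \<not> d b dvd \<tau> + j"
  shows "fst (s (i + k)) b = fst (s i) b" "snd (s (i + k)) b = snd (s i) b"
  using run_inactive[of i k b \<tau> g "s 0"] assms by (simp_all add: s_def[of i] s_def[of "i + k"])

lemma s_active:
  assumes "d b dvd \<tau> + i"
  shows "fst (s (Suc i)) b = snd (s i) b"
    "snd (s (Suc i)) b * fst (s i) b = (snd (s i) b)\<^sup>2 - g b * neighbours (\<tau> + i) (s i) b"
proof -
  have eq: "run g \<tau> i (s 0) = s i" "run g \<tau> (Suc i) (s 0) = s (Suc i)"
    by (rule s_def[symmetric])+
  show "fst (s (Suc i)) b = snd (s i) b"
    "snd (s (Suc i)) b * fst (s i) b = (snd (s i) b)\<^sup>2 - g b * neighbours (\<tau> + i) (s i) b"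
    by (rule run_active[of b \<tau> i g "s 0", unfolded eq, OF assms nonzero(1)])+
qed

lemma s_Suc:
  "fst (s (Suc i)) b = (if d b dvd \<tau> + i then snd (s i) b else fst (s i) b)"
  "\<not> d b dvd \<tau> + i \<Longrightarrow> snd (s (Suc i)) b = snd (s i) b"
proof -
  have *: "fst (s (Suc i)) b = fst (s i) b \<and> snd (s (Suc i)) b = snd (s i) b" if n: "\<not> d b dvd \<tau> + i"
  proof -
    have "\<not> d b dvd \<tau> + j" if "i \<le> j" "j < i + 1" for j
      using n that by (cases "j = i") auto
    from s_inactive[of i 1, OF this] show ?thesis by simp
  qed
  show "fst (s (Suc i)) b = (if d b dvd \<tau> + i then snd (s i) b else fst (s i) b)"
    "\<not> d b dvd \<tau> + i \<Longrightarrow> snd (s (Suc i)) b = snd (s i) b"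
    using s_active(1)[of b i] * by auto
qed

section \<open>Five consecutive values at the distinguished node\<close>

abbreviation "D \<equiv> d a"

lemma not_dvd: "0 < j \<Longrightarrow> j < D \<Longrightarrow> \<not> D dvd \<tau> + j"
  "D < j \<Longrightarrow> j < 2 * D \<Longrightarrow> \<not> D dvd \<tau> + j"
proof -
  show "\<not> D dvd \<tau> + j" if "0 < j" "j < D" for j
    using active that by (metis dvd_add_right_iff nat_dvd_not_less)
  from this[of "j - D"] show "\<not> D dvd \<tau> + j" if "D < j" "j < 2 * D"
    using that active d_pos[of a] by (metis (no_types, lifting) Nat.add_diff_assoc dvd_add_triv_right_iff add.assoc
        le_add_diff_inverse2 less_imp_le_nat less_diff_conv2 mult_2 zero_less_diff)
qed

definition "y0 \<equiv> fst (s 0) a"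
definition "y1 \<equiv> snd (s 0) a"
definition "y2 \<equiv> snd (s 1) a"
definition "y3 \<equiv> snd (s (Suc D)) a"
definition "y4 \<equiv> snd (s (Suc (2 * D))) a"
definition "M1 \<equiv> neighbours \<tau> (s 0) a"
definition "M2 \<equiv> neighbours (\<tau> + D) (s D) a"
definition "M3 \<equiv> neighbours (\<tau> + 2 * D) (s (2 * D)) a"

lemma s_a1:
  assumes "0 < i" "i \<le> D"
  shows "fst (s i) a = y1" "snd (s i) a = y2"
  using s_inactive[of 1 "i - 1" a] s_active(1)[of a 0] assms not_dvd active
  by (auto simp: y1_def y2_def)

lemma s_a2:
  assumes "D < i" "i \<le> 2 * D"
  shows "fst (s i) a = y2" "snd (s i) a = y3"
  using s_inactive[of "Suc D" "i - Suc D" a] s_active(1)[of a D] assms not_dvd active d_pos[of a] s_a1[of D]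
  by (auto simp: y3_def)

lemma s_a3: "fst (s (Suc (2 * D))) a = y3" "snd (s (Suc (2 * D))) a = y4"
  using s_active(1)[of a "2 * D"] active d_pos[of a] s_a2[of "2 * D"] by (auto simp: y4_def)

lemma rel2: "y2 * y0 = y1\<^sup>2 - g a * M1"
  using s_active(2)[of a 0] active by (simp add: y2_def y0_def y1_def M1_def)

lemma rel3: "y3 * y1 = y2\<^sup>2 - g a * M2"
  using s_active(2)[of a D] active s_a1[of D] d_pos[of a] by (simp add: y3_def M2_def)

lemma rel4: "y4 * y2 = y3\<^sup>2 - g a * M3"
  using s_active(2)[of a "2 * D"] active s_a2[of "2 * D"] d_pos[of a] by (simp add: y4_def M3_def)

lemma y_nonzero: "y0 \<noteq> 0" "y1 \<noteq> 0" "y2 \<noteq> 0"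
  by (simp_all add: y0_def y1_def y2_def nonzero)

definition others_one :: "nat \<Rightarrow> bool" where
  "others_one i \<longleftrightarrow> (\<forall>b. b \<noteq> a \<longrightarrow> res (fst (s i) b) 1 \<and> res (snd (s i) b) 1)"

lemma res_neighbours_a:
  assumes "others_one i"
  shows "res (neighbours \<tau>' (s i) a) 1"
proof -
  have "res (neighbours \<tau>' (s i) a)
     (\<Prod>b\<in>nb a. 1 ^ (bond a b - interp (bond a b) \<tau>') * 1 ^ interp (bond a b) \<tau>')"
    unfolding neighbours_def using assms nb_irrefl[of a] unfolding others_one_def
    by (intro res_prod res_mult res_power) auto
  then show ?thesis by simp
qed

text \<open>For \<open>b \<noteq> a\<close> the coefficient \<open>g b\<close> lies in the maximal
  ideal, so modulo that ideal the relation at \<open>b\<close> says that new times old value is the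
  square of the current one, all of residue 1; the values at \<open>a\<close> only have to be
  regular.\<close>

lemma others_one_Suc:
  assumes "others_one i" "reg (fst (s i) a)" "reg (snd (s i) a)"
  shows "others_one (Suc i)"
proof -
  have reg: "reg (fst (s i) b)" "reg (snd (s i) b)" for b
    using assms regI unfolding others_one_def by (metis)+
  have "res (fst (s (Suc i)) b) 1 \<and> res (snd (s (Suc i)) b) 1" if b: "b \<noteq> a" for b
  proof (cases "d b dvd \<tau> + i")
    case False
    then show ?thesis using assms(1) b unfolding others_one_def by (simp add: s_Suc)
  next
    case True
    have "reg (neighbours (\<tau> + i) (s i) b)"
      unfolding neighbours_def by (intro reg_prod reg_mult reg_power reg)
    then obtain c where "res (neighbours (\<tau> + i) (s i) b) c" unfolding reg_def by auto
    then have "res (g b * neighbours (\<tau> + i) (s i) b) 0" using res_mult[OF res_g(2)[OF b]] by simp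
    then have "res (((snd (s i) b)\<^sup>2 - g b * neighbours (\<tau> + i) (s i) b) / fst (s i) b) ((1\<^sup>2 - 0) / 1)"
      using assms(1) b unfolding others_one_def by (intro res_divide res_diff res_power) auto
    moreover have "snd (s (Suc i)) b = ((snd (s i) b)\<^sup>2 - g b * neighbours (\<tau> + i) (s i) b) / fst (s i) b"
      using s_active(2)[OF True] nonzero(1)[of i b] by (simp add: field_simps)
    ultimately show ?thesis
      using s_active(1)[OF True] assms(1) b unfolding others_one_def by simp
  qed
  then show ?thesis unfolding others_one_def by blast
qed

lemma res_y012: "res y0 1" "res y1 1" "res y2 0"
proof -
  show y: "res y0 1" "res y1 1" by (simp_all add: y0_def y1_def res_s0)
  have "res M1 1" unfolding M1_def by (rule res_neighbours_a) (simp add: others_one_def res_s0)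
  then have "res ((y1\<^sup>2 - g a * M1) / y0) ((1\<^sup>2 - 1 * 1) / 1)"
    by (intro res_divide res_diff res_power res_mult y res_g) auto
  then show "res y2 0" by (simp add: y_nonzero flip: rel2)
qed

lemma others_one1: "i \<le> Suc D \<Longrightarrow> others_one i"
proof (induction i)
  case 0 then show ?case by (simp add: others_one_def res_s0)
next
  case (Suc i)
  then have "reg (fst (s i) a) \<and> reg (snd (s i) a)"
    using s_a1[of i] regI[OF res_y012(1)] regI[OF res_y012(2)] regI[OF res_y012(3)]
    by (cases "i = 0") (auto simp: y0_def y1_def)
  then show ?case using Suc others_one_Suc by simp
qed

lemma res_M2: "res M2 1"
  unfolding M2_def by (rule res_neighbours_a) (simp add: others_one1)

lemma res_y3: "res y3 (- 1)"
proof -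
  have "res ((y2\<^sup>2 - g a * M2) / y1) ((0\<^sup>2 - 1 * 1) / 1)"
    by (intro res_divide res_diff res_power res_mult res_y012 res_M2 res_g) auto
  then show ?thesis by (simp add: y_nonzero flip: rel3)
qed

lemma others_one2: "i \<le> Suc (2 * D) \<Longrightarrow> others_one i"
proof (induction i)
  case 0 then show ?case by (simp add: others_one_def res_s0)
next
  case (Suc i)
  show ?case
  proof (cases "i \<le> D")
    case True then show ?thesis by (simp add: others_one1)
  next
    case False
    then show ?thesis
      using Suc s_a2[of i] regI[OF res_y012(3)] regI[OF res_y3] by (intro others_one_Suc) auto
  qed
qed

lemma res_M3: "res M3 1"
  unfolding M3_def by (rule res_neighbours_a) (simp add: others_one2)

lemma reg_s: "i \<le> 2 * D \<Longrightarrow> reg (fst (s i) b)" "i \<le> 2 * D \<Longrightarrow> reg (snd (s i) b)"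
proof -
  assume i: "i \<le> 2 * D"
  have "reg (fst (s i) b) \<and> reg (snd (s i) b)"
  proof (cases "b = a")
    case False
    then show ?thesis using others_one2[of i] i regI unfolding others_one_def by fastforce
  next
    case True
    consider "i = 0" | "0 < i" "i \<le> D" | "D < i" by linarith
    then show ?thesis
    proof cases
      case 1 then show ?thesis using res_s0 regI by blast
    next
      case 2 then show ?thesis using s_a1[of i] True res_y012 regI by metis
    next
      case 3 then show ?thesis using s_a2[of i] i True res_y012 res_y3 regI by metis
    qed
  qed
  then show "reg (fst (s i) b)" "reg (snd (s i) b)" by auto
qed

text \<open>The neighbour product of \<open>b\<close> contains a factor \<open>y2\<close> as long as
  \<open>y2\<close> is one of the two values at \<open>a\<close> and has a positive exponent. Since
  \<open>g b\<close> lies in the maximal ideal, the correction term is \<open>y2\<close> times an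
  element of that ideal.\<close>

lemma geometric_step:
  assumes b: "b \<in> nb a" and i: "d b dvd \<tau> + i" "i \<le> 2 * D"
    and "snd (s i) a = y2 \<or> fst (s i) a = y2 \<and> interp (bond b a) (\<tau> + i) < bond b a"
  shows "cong_mod y2 (snd (s (Suc i)) b * fst (s i) b) ((snd (s i) b)\<^sup>2)"
proof -
  let ?\<rho> = "interp (bond b a) (\<tau> + i)"
  have ba: "b \<noteq> a" using b nb_irrefl by auto
  have pw: "y2 ^ n = y2 * y2 ^ (n - 1)" if "0 < n" for n
    using that by (cases n) auto
  have reg_y2: "reg y2" using res_y012 regI by blast
  have "\<exists>N. reg N \<and> fst (s i) a ^ (bond b a - ?\<rho>) * snd (s i) a ^ ?\<rho> = y2 * N"
    using assms(4)
  proof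
    assume "snd (s i) a = y2"
    then show ?thesis
      using pw[OF interp_pos] reg_s[OF i(2)] reg_y2
      by (intro exI[of _ "fst (s i) a ^ (bond b a - ?\<rho>) * y2 ^ (?\<rho> - 1)"])
         (auto intro!: reg_mult reg_power simp: mult_ac)
  next
    assume "fst (s i) a = y2 \<and> ?\<rho> < bond b a"
    then show ?thesis
      using pw[of "bond b a - ?\<rho>"] reg_s[OF i(2)] reg_y2
      by (intro exI[of _ "y2 ^ (bond b a - ?\<rho> - 1) * snd (s i) a ^ ?\<rho>"])
         (auto intro!: reg_mult reg_power simp: mult_ac)
  qed
  then obtain N where N: "reg N" "fst (s i) a ^ (bond b a - ?\<rho>) * snd (s i) a ^ ?\<rho> = y2 * N" by blast
  define N' where "N' = (\<Prod>c\<in>nb b - {a}. fst (s i) c ^ (bond b c - interp (bond b c) (\<tau> + i)) * snd (s i) c ^ interp (bond b c) (\<tau> + i))"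
  have "reg (N * N')"
    unfolding N'_def using i(2) by (intro reg_mult N reg_prod reg_power reg_s)
  then obtain c where "res (N * N') c" unfolding reg_def by blast
  then have "res (- (g b * (N * N'))) 0"
    using res_minus[OF res_mult[OF res_g(2)[OF ba]]] by fastforce
  moreover have "neighbours (\<tau> + i) (s i) b = y2 * N * N'"
    unfolding N'_def using neighbours_factor[OF nb_sym[OF b], of "\<tau> + i" "s i"] N(2) by simp
  ultimately show ?thesis
    unfolding cong_mod_def using s_active(2)[OF i(1)]
    by (intro exI[of _ "- (g b * (N * N'))"]) (simp add: algebra_simps)
qed

definition factor :: "nat \<Rightarrow> nat \<Rightarrow> 'f" where
  "factor i b = fst (s i) b ^ (bond a b - interp (bond a b) (\<tau> + i)) * snd (s i) b ^ interp (bond a b) (\<tau> + i)"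

text \<open>\<open>b\<close> moves together with \<open>a\<close>, so the three factors are
  consecutive values at \<open>b\<close>, tied by the single relation at time
  \<open>\<tau> + D\<close>, where \<open>y2\<close> is the newest value at
  \<open>a\<close>.\<close>

lemma cong_factor_same:
  assumes b: "b \<in> nb a" "d b = D"
  shows "cong_mod y2 (factor 0 b * factor (2 * D) b) ((factor D b)\<^sup>2)"
proof -
  have f: "factor i b = snd (s i) b" for i
    using b by (simp add: factor_def bond_def)
  have 1: "fst (s D) b = snd (s 0) b"
    using s_inactive(1)[of 1 "D - 1" b] s_active(1)[of b 0] b active not_dvd(1) d_pos[of a] by auto
  have 2: "snd (s (2 * D)) b = snd (s (Suc D)) b"
    using s_inactive(2)[of "Suc D" "D - 1" b] b not_dvd(2) d_pos[of a] by (auto simp: mult_2)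
  have "cong_mod y2 (snd (s (Suc D)) b * fst (s D) b) ((snd (s D) b)\<^sup>2)"
    using b active d_pos[of a] s_a1(2)[of D] by (intro geometric_step) auto
  then show ?thesis unfolding f 1 2 by (simp only: mult.commute)
qed

text \<open>Here \<open>b\<close> moves at every time, and \<open>y2\<close> occurs in its relations
  at all times strictly between \<open>\<tau>\<close> and \<open>\<tau> + 2 * D\<close>: first as
  the newest, then as the previous value at \<open>a\<close>.\<close>

lemma cong_factor_short:
  assumes b: "b \<in> nb a" "d b = 1" "D \<noteq> 1"
  shows "cong_mod y2 (factor 0 b * factor (2 * D) b) ((factor D b)\<^sup>2)"
proof -
  have f: "factor i b = snd (s i) b" for i
    using b by (simp add: factor_def bond_def)
  have ba: "b \<noteq> a" using b nb_irrefl by auto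
  have "cong_mod y2 (snd (s 0) b * snd (s (2 * D)) b) ((snd (s D) b)\<^sup>2)"
  proof (rule cong_mod_geometric)
    show "res (snd (s i) b) 1" if "i \<le> 2 * D" for i
      using others_one2[of i] that ba unfolding others_one_def by simp
    show "snd (s i) b \<noteq> 0" for i by (rule nonzero)
    fix i assume i: "0 < i" "i < 2 * D"
    have prev: "fst (s i) b = snd (s (i - 1)) b"
      using s_active(1)[of b "i - 1"] b(2) i(1) by simp
    have "snd (s i) a = y2 \<or> fst (s i) a = y2 \<and> interp (bond b a) (\<tau> + i) < bond b a"
    proof (cases "i \<le> D")
      case True
      then show ?thesis using s_a1(2) i by simp
    next
      case False
      \<comment> \<open>After \<open>\<tau> + D\<close> the older value \<open>y2\<close> has
        exponent \<open>D - interp D (\<tau> + i)\<close>, which drops to 0 only at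
        \<open>\<tau> + 2 * D\<close>.\<close>
      have "interp D (\<tau> + i) = interp D (i - D + D)"
        using interp_dvd[OF active] False by simp
      also have "\<dots> = i - D"
        using False i by (simp only: interp_add_self interp_id)
      finally have "interp D (\<tau> + i) < D" using i False by simp
      then show ?thesis using s_a2(1)[of i] False i b by (simp add: bond_def)
    qed
    then have "cong_mod y2 (snd (s (Suc i)) b * fst (s i) b) ((snd (s i) b)\<^sup>2)"
      using b i by (intro geometric_step) auto
    then show "cong_mod y2 (snd (s (Suc i)) b * snd (s (i - 1)) b) ((snd (s i) b)\<^sup>2)"
      by (simp add: prev)
  qed
  then show ?thesis by (simp add: f)
qed

text \<open>Now \<open>a\<close> moves at every time and the factors interpolate between values at
  \<open>b\<close>. As long as \<open>b\<close> does not move at time \<open>\<tau> + 1\<close>,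
  their exponents are in arithmetic progression and the congruence is an equality. If it does, the
  third factor contains a new value, which the relation of \<open>b\<close> at
  \<open>\<tau> + 1\<close> controls.\<close>

lemma cong_factor_long:
  assumes b: "b \<in> nb a" "D = 1" "d b \<noteq> 1"
  shows "cong_mod y2 (factor 0 b * factor (2 * D) b) ((factor D b)\<^sup>2)"
proof -
  define t' where "t' = d b"
  have t': "2 \<le> t'" using b(3) d_pos[of b] by (simp add: t'_def)
  have bond: "bond a b = t'" using b by (simp add: bond_def t'_def)
  have f: "factor i b = fst (s i) b ^ (t' - interp t' (\<tau> + i)) * snd (s i) b ^ interp t' (\<tau> + i)" for i
    by (simp add: factor_def bond)
  consider "t' dvd \<tau> + 1" | "t' dvd \<tau>" | "\<not> t' dvd \<tau>" "\<not> t' dvd \<tau> + 1" by blast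
  then show ?thesis
  proof cases
    case 1
    have n0: "\<not> t' dvd \<tau>"
      using 1 t' by (metis One_nat_def Suc_eq_plus1 dvd_add_right_iff nat_dvd_1_iff_1 numeral_le_one_iff semiring_norm(69))
    have s1: "fst (s 1) b = fst (s 0) b" "snd (s 1) b = snd (s 0) b"
      using s_Suc[where i = 0 and b = b] n0 by (simp_all add: t'_def)
    have s2: "fst (s 2) b = snd (s 0) b"
      using s_Suc(1)[of 1 b] 1 s1 by (simp add: t'_def numeral_2_eq_2)
    have i1: "interp t' (\<tau> + 1) = t'"
      using interp_dvd[OF 1, of 0] interp_add_self[of t' 0] interp_id[of t' t'] t' by simp
    have i2: "interp t' (\<tau> + 2) = 1"
      using interp_dvd[OF 1, of 1] interp_id[of 1 t'] t' by simp
    have i0: "interp t' \<tau> = t' - 1"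
      using interp_dvd[OF 1, of "t' - 1"] interp_id[of "t' - 1" t'] interp_add_self[of t' \<tau>] t' by simp
    have f0: "factor 0 b = fst (s 0) b * snd (s 0) b ^ (t' - 1)" using t' by (simp add: f i0)
    have f1: "factor 1 b = snd (s 0) b ^ t'" unfolding f i1 s1 by simp
    have f2: "factor 2 b = snd (s 0) b ^ (t' - 1) * snd (s 2) b" unfolding f i2 s2 by simp
    have D: "factor (2 * D) b = factor 2 b" "factor D b = factor 1 b" using b(2) by simp_all
    have "cong_mod y2 (snd (s (Suc 1)) b * fst (s 1) b) ((snd (s 1) b)\<^sup>2)"
      using b 1 s_a1(2)[of 1] by (intro geometric_step) (auto simp: t'_def)
    then have *: "cong_mod y2 (snd (s 2) b * fst (s 0) b) ((snd (s 0) b)\<^sup>2)"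
      unfolding s1 Suc_1 .
    have "cong_mod y2 (snd (s 2) b * fst (s 0) b * snd (s 0) b ^ (2 * (t' - 1))) ((snd (s 0) b)\<^sup>2 * snd (s 0) b ^ (2 * (t' - 1)))"
      using b by (intro cong_mod_mult[OF * cong_mod_refl] reg_mult reg_power reg_s) auto
    moreover have "factor 0 b * factor (2 * D) b = snd (s 2) b * fst (s 0) b * snd (s 0) b ^ (2 * (t' - 1))"
      unfolding D f0 f2 by (simp add: power_add mult_2)
    moreover have "(snd (s 0) b)\<^sup>2 * snd (s 0) b ^ (2 * (t' - 1)) = (factor D b)\<^sup>2"
    proof -
      have "2 + 2 * (t' - 1) = t' * 2" using t' by simp
      then show ?thesis unfolding D f1 by (simp flip: power_add power_mult)
    qed
    ultimately show ?thesis by simp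
  next
    case 2
    have n1: "\<not> t' dvd \<tau> + 1"
      using 2 t' by (metis One_nat_def dvd_add_right_iff nat_dvd_1_iff_1 numeral_le_one_iff semiring_norm(69))
    have s12: "fst (s 1) b = snd (s 0) b" "fst (s 2) b = snd (s 0) b" "snd (s 2) b = snd (s 1) b"
      using s_Suc[where i = 0 and b = b] s_Suc[where i = 1 and b = b] 2 n1 by (simp_all add: t'_def numeral_2_eq_2)
    have i: "interp t' \<tau> = t'" "interp t' (\<tau> + 1) = 1" "interp t' (\<tau> + 2) = 2"
      using interp_dvd[OF 2, of 0] interp_dvd[OF 2, of 1] interp_dvd[OF 2, of 2] interp_add_self[of t' 0]
        interp_id[of t' t'] interp_id[of 1 t'] interp_id[of 2 t'] t' by simp_all
    have D: "factor (2 * D) b = factor 2 b" "factor D b = factor 1 b" using b(2) by simp_all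
    obtain k where k: "t' = k + 2" using t' by (metis add.commute le_iff_add)
    have f0: "factor 0 b = snd (s 0) b ^ (k + 2)" using i(1) k by (simp add: f)
    have f1: "factor 1 b = snd (s 0) b ^ (k + 1) * snd (s 1) b" unfolding f i s12 using k by simp
    have f2: "factor 2 b = snd (s 0) b ^ k * (snd (s 1) b)\<^sup>2" unfolding f i s12 using k by simp
    have "factor 0 b * factor (2 * D) b = (factor D b)\<^sup>2"
      unfolding D f0 f1 f2 by (simp add: power_add power2_eq_square mult_ac)
    then show ?thesis by (simp add: cong_mod_refl)
  next
    case 3
    define e where "e = \<tau> mod t'"
    have e: "0 < e" using 3(1) unfolding e_def by (simp add: mod_greater_zero_iff_not_dvd)
    have "e < t'" unfolding e_def using t' by simp
    moreover have "e + 1 \<noteq> t'" using 3(2) unfolding e_def by (metis dvd_eq_mod_eq_0 mod_add_left_eq mod_self)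
    ultimately have e2: "e + 2 \<le> t'" by simp
    have "t' dvd \<tau> - e" "\<tau> = (\<tau> - e) + e" unfolding e_def by (simp_all add: minus_mod_eq_mult_div)
    then have int_j: "interp t' (\<tau> + j) = interp t' (e + j)" for j
      using interp_dvd[of t' "\<tau> - e" "e + j"] by (simp add: add.assoc)
    have i: "interp t' \<tau> = e" "interp t' (\<tau> + 1) = e + 1" "interp t' (\<tau> + 2) = e + 2"

      using e e2 interp_id[of e t'] interp_id[of "e + 1" t'] interp_id[of "e + 2" t'] int_j[of 0] int_j[of 1] int_j[of 2]
      by simp_all
    have s12: "fst (s 1) b = fst (s 0) b" "snd (s 1) b = snd (s 0) b" "fst (s 2) b = fst (s 0) b" "snd (s 2) b = snd (s 0) b"
      using s_Suc[where i = 0 and b = b] s_Suc[where i = 1 and b = b] 3 by (simp_all add: t'_def numeral_2_eq_2)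
    have D: "factor (2 * D) b = factor 2 b" "factor D b = factor 1 b" using b(2) by simp_all
    obtain k where k: "t' = e + k + 2" using e2 by (metis add.assoc add.commute le_iff_add)
    have f0: "factor 0 b = fst (s 0) b ^ (k + 2) * snd (s 0) b ^ e" using i(1) k by (simp add: f)
    have f1: "factor 1 b = fst (s 0) b ^ (k + 1) * snd (s 0) b ^ (e + 1)" unfolding f i s12 using k by simp
    have f2: "factor 2 b = fst (s 0) b ^ k * snd (s 0) b ^ (e + 2)" unfolding f i s12 using k by simp
    have "factor 0 b * factor (2 * D) b = (factor D b)\<^sup>2"
      unfolding D f0 f1 f2 by (simp add: power_add power2_eq_square mult_ac)
    then show ?thesis by (simp add: cong_mod_refl)
  qed
qed

lemma cong_neighbours: "cong_mod y2 (M1 * M3) (M2\<^sup>2)"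
proof -
  have M: "M1 = (\<Prod>b\<in>nb a. factor 0 b)" "M2 = (\<Prod>b\<in>nb a. factor D b)" "M3 = (\<Prod>b\<in>nb a. factor (2 * D) b)"
    by (simp_all add: M1_def M2_def M3_def neighbours_def factor_def)
  have reg: "reg (factor i b)" if "i \<le> 2 * D" for i b
    unfolding factor_def using that by (intro reg_mult reg_power reg_s)
  have "cong_mod y2 (factor 0 b * factor (2 * D) b) ((factor D b)\<^sup>2)" if "b \<in> nb a" for b
    using cong_factor_same cong_factor_short cong_factor_long d_nb[OF that] that by metis
  then have "cong_mod y2 (\<Prod>b\<in>nb a. factor 0 b * factor (2 * D) b) (\<Prod>b\<in>nb a. (factor D b)\<^sup>2)"
    by (intro cong_mod_prod reg_mult reg_power reg) auto
  then show ?thesis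
    unfolding M by (simp add: prod.distrib prod_power_distrib)
qed

text \<open>After multiplication by \<open>y1\<^sup>2\<close> and insertion of the two earlier
  relations, the only part without a visible factor \<open>y2\<close> is
  \<open>(g a)\<^sup>2 * (M2\<^sup>2 - M1 * M3)\<close>, which \<open>cong_neighbours\<close> turns
  into \<open>y2\<close> times something of residue 0. Once \<open>y2\<close> is cancelled, only
  \<open>- g a * y0 * M3\<close> has non-zero residue.\<close>

lemma res_y4: "res y4 (- 1)"
proof -
  obtain h where h: "res h 0" "M1 * M3 = M2\<^sup>2 + y2 * h"
    using cong_neighbours unfolding cong_mod_def by blast
  have "y1\<^sup>2 * (y4 * y2) = (y3 * y1)\<^sup>2 - g a * M3 * y1\<^sup>2"
    unfolding rel4 by (simp add: power2_eq_square algebra_simps)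
  also have "\<dots> = (y2\<^sup>2 - g a * M2)\<^sup>2 - g a * M3 * (y2 * y0 + g a * M1)"
    by (simp add: rel3 rel2)
  also have "\<dots> = y2 * (y2 ^ 3 - 2 * g a * y2 * M2 - g a * y0 * M3) + (g a)\<^sup>2 * (M2\<^sup>2 - M1 * M3)"
    by (simp add: power2_eq_square power3_eq_cube algebra_simps)
  also have "\<dots> = y2 * (y2 ^ 3 - 2 * g a * y2 * M2 - g a * y0 * M3 - (g a)\<^sup>2 * h)"
    unfolding h(2) by (simp add: algebra_simps)
  finally have "y1\<^sup>2 * y4 = y2 ^ 3 - 2 * g a * y2 * M2 - g a * y0 * M3 - (g a)\<^sup>2 * h"
    using y_nonzero(3) by (simp add: mult_ac)
  then have y4: "y4 = (y2 ^ 3 - (1 + 1) * g a * y2 * M2 - g a * y0 * M3 - (g a)\<^sup>2 * h) / y1\<^sup>2"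
    using y_nonzero(2) by (simp add: field_simps)
  have "res y4 ((0 ^ 3 - (1 + 1) * 1 * 0 * 1 - 1 * 1 * 1 - 1\<^sup>2 * 0) / 1\<^sup>2)"
    unfolding y4 by (intro res_divide res_diff res_add res_1 res_power res_mult res_y012 res_M2 res_M3 res_g h) auto
  then show ?thesis by simp
qed

theorem res_window:
  assumes "i \<le> Suc (2 * D)"
  shows "\<exists>c. res (fst (s i) b) c" "\<exists>c. res (snd (s i) b) c"
proof -
  have "reg (fst (s (Suc (2 * D))) b)" "reg (snd (s (Suc (2 * D))) b)"
    using others_one2[of "Suc (2 * D)"] s_a3 regI res_y3 res_y4 unfolding others_one_def by (metis order_refl)+
  then show "\<exists>c. res (fst (s i) b) c" "\<exists>c. res (snd (s i) b) c"
    using assms reg_s[of i b] unfolding reg_def by (metis le_SucE)+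
qed

theorem res_end:
  "\<exists>c. c \<noteq> 0 \<and> res (fst (s (Suc (2 * D))) b) c" "\<exists>c. c \<noteq> 0 \<and> res (snd (s (Suc (2 * D))) b) c"
  using others_one2[of "Suc (2 * D)"] s_a3 res_y3 res_y4 unfolding others_one_def
  by (metis order_refl one_neq_zero neg_equal_0_iff_equal)+

end

section \<open>The Laurent phenomenon\<close>

context q_system begin

lemma laurent_run_mono: "laurent_run \<tau> n \<Longrightarrow> m \<le> n \<Longrightarrow> laurent_run \<tau> m"
  by (auto simp: laurent_run_def)

definition exchange :: "nat \<Rightarrow> nat \<Rightarrow> lau" where
  "exchange \<tau> a = (var (new_ix a))\<^sup>2
     - var (coef_ix a) * neighbours \<tau> (\<lambda>b. var (old_ix b), \<lambda>b. var (new_ix b)) a"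

lemma ev_exchange:
  assumes "\<And>v. x v \<noteq> 0"
  shows "ev x (exchange \<tau> a) = (x (new_ix a))\<^sup>2
    - x (coef_ix a) * neighbours \<tau> (\<lambda>b. x (old_ix b), \<lambda>b. x (new_ix b)) a"
  by (simp add: exchange_def ev_mult ev_power ev_neighbours assms)

lemma to_fract_exchange: "to_fract (exchange \<tau> a) = (snd gen a)\<^sup>2 - gen_g a * neighbours \<tau> gen a"
  using ev_exchange[of gen_var \<tau> a] by (simp add: gen_def gen_g_def)

lemma exchange_nonzero: "d a dvd \<tau> \<Longrightarrow> exchange \<tau> a \<noteq> 0"
  using run_gen_nonzero(2)[of \<tau> 1 a] to_fract_exchange[of \<tau> a] by (auto simp: step_def)

text \<open>The polynomial is linear in the coefficient of node \<open>a\<close>, with a unit as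
  leading coefficient, and solving for it substitutes a Laurent monomial.\<close>

lemma exchange_prime:
  assumes dvd: "exchange \<tau> a dvd f * k"
  shows "exchange \<tau> a dvd f \<or> exchange \<tau> a dvd k"
proof -
  define mon where "mon f \<longleftrightarrow> f \<in> lau_fract \<and> inverse f \<in> lau_fract \<and> f \<noteq> 0" for f
  have mon_var: "mon (gen_var v)" for v
    using gen_var_lau_fract[of v 1] gen_var_lau_fract[of v "-1"] by (simp add: mon_def)
  have mon_mult: "mon f \<Longrightarrow> mon f' \<Longrightarrow> mon (f * f')" for f f'
    unfolding mon_def by (auto intro: lau_fract_intros simp only: inverse_mult_distrib mult_eq_0_iff)
  have mon_1: "mon 1" using lau_fract_intros(2) by (simp add: mon_def)
  have mon_power: "mon f \<Longrightarrow> mon (f ^ n)" for f n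
    by (induction n) (auto intro: mon_mult mon_1)
  have mon_inv: "mon f \<Longrightarrow> mon (inverse f)" for f
    unfolding mon_def by auto
  have mon_prod: "(\<And>i. i \<in> S \<Longrightarrow> mon (f i)) \<Longrightarrow> mon (prod f S)" for f and S :: "nat set"
    by (induction S rule: infinite_finite_induct) (auto intro: mon_mult mon_1)
  let ?M = "neighbours \<tau> gen a"
  have M: "mon ?M"
    unfolding neighbours_def gen_def fst_conv snd_conv by (intro mon_prod mon_mult mon_power mon_var)
  define h where "h = (snd gen a)\<^sup>2 * inverse ?M"
  have h: "mon h" unfolding h_def gen_def snd_conv using M
    by (intro mon_mult mon_power mon_var mon_inv) (simp add: gen_def)
  show ?thesis
  proof (rule linear_prime[of h "coef_ix a" "exchange \<tau> a" "- inverse ?M"])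
    show "h \<in> lau_fract" "inverse h \<in> lau_fract" "h \<noteq> 0"
      using h by (simp_all add: mon_def)
    show "gen_var (coef_ix a) - h = to_fract (exchange \<tau> a) * - inverse ?M"
      using M unfolding to_fract_exchange h_def mon_def gen_g_def by (simp add: field_simps)
    show "- inverse ?M \<in> lau_fract"
      using M lau_fract_intros(4)[OF lau_fract_intros(1), of "inverse ?M"] by (simp add: mon_def)
    have "ev (gen_var(coef_ix a := h)) (exchange \<tau> a) = (snd gen a)\<^sup>2 - h * ?M"
      using h unfolding mon_def by (subst ev_exchange) (auto simp: gen_def)
    then show "ev (gen_var(coef_ix a := h)) (exchange \<tau> a) = 0"
      using M by (simp add: h_def mon_def)
    show "exchange \<tau> a dvd f * k" by (rule dvd)
  qed
qed

text \<open>A new entry is an exchange polynomial divided by an old variable, so inverting it is the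
  only source of denominators.\<close>

lemma ev_first_step_denominator:
  "\<exists>ps. set ps \<subseteq> exchange \<tau> ` {a. d a dvd \<tau>} \<and>
     ev (seed_at (step gen_g \<tau> gen) gen_g) p * to_fract (prod_list ps) \<in> lau_fract"
proof -
  define den where "den f \<longleftrightarrow> (\<exists>ps. set ps \<subseteq> exchange \<tau> ` {a. d a dvd \<tau>} \<and> f * to_fract (prod_list ps) \<in> lau_fract)" for f
  have den_lau: "f \<in> lau_fract \<Longrightarrow> den f" for f
    unfolding den_def by (intro exI[of _ "[]"]) simp
  have den_mult: "den (f * f')" if f: "den f" "den f'" for f f'
  proof -
    obtain ps ps' where ps: "set ps \<subseteq> exchange \<tau> ` {a. d a dvd \<tau>}" "f * to_fract (prod_list ps) \<in> lau_fract"
      "set ps' \<subseteq> exchange \<tau> ` {a. d a dvd \<tau>}" "f' * to_fract (prod_list ps') \<in> lau_fract"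
      using f unfolding den_def by blast
    have "(f * f') * to_fract (prod_list (ps @ ps')) = (f * to_fract (prod_list ps)) * (f' * to_fract (prod_list ps'))"
      by simp
    also have "\<dots> \<in> lau_fract" by (rule lau_fract_intros(5)[OF ps(2,4)])
    finally show ?thesis using ps unfolding den_def by (intro exI[of _ "ps @ ps'"]) auto
  qed
  have den_diff: "den (f - f')" if f: "den f" "den f'" for f f'
  proof -
    obtain ps ps' where ps: "set ps \<subseteq> exchange \<tau> ` {a. d a dvd \<tau>}" "f * to_fract (prod_list ps) \<in> lau_fract"
      "set ps' \<subseteq> exchange \<tau> ` {a. d a dvd \<tau>}" "f' * to_fract (prod_list ps') \<in> lau_fract"
      using f unfolding den_def by blast
    have "(f - f') * to_fract (prod_list (ps @ ps')) =
        (f * to_fract (prod_list ps)) * to_fract (prod_list ps') - (f' * to_fract (prod_list ps')) * to_fract (prod_list ps)"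
      by (simp add: algebra_simps)
    also have "\<dots> \<in> lau_fract"
      by (rule lau_fract_intros(4)[OF lau_fract_intros(5)[OF ps(2)] lau_fract_intros(5)[OF ps(4)]]) auto
    finally show ?thesis using ps unfolding den_def by (intro exI[of _ "ps @ ps'"]) auto
  qed
  have den_prod: "(\<And>i. i \<in> S \<Longrightarrow> den (f i)) \<Longrightarrow> den (prod f S)" for f and S :: "nat set"
    by (induction S rule: infinite_finite_induct) (auto intro: den_mult den_lau lau_fract_intros)
  have den_power: "den f \<Longrightarrow> den (f ^ n)" for f n
    by (induction n) (auto intro: den_mult den_lau lau_fract_intros)
  have den_var: "den (gen_var v powi k)" for v k
    by (intro den_lau gen_var_lau_fract)
  let ?x = "seed_at (step gen_g \<tau> gen) gen_g"
  have new: "den (snd (step gen_g \<tau> gen) a powi k)" for a k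
  proof (cases "d a dvd \<tau>")
    case False
    then show ?thesis using den_var[of "new_ix a" k] by (simp add: step_def gen_def)
  next
    case True
    let ?P = "to_fract (exchange \<tau> a)"
    have P: "snd (step gen_g \<tau> gen) a = ?P * gen_var (old_ix a) powi (- 1)"
      using True by (simp add: step_def to_fract_exchange gen_def divide_inverse)
    have "den (inverse ?P)"
      unfolding den_def using True exchange_nonzero[OF True] lau_fract_intros(2)
      by (intro exI[of _ "[exchange \<tau> a]"]) auto
    then have inv: "den (inverse (snd (step gen_g \<tau> gen) a))"
      unfolding P using den_var[of "old_ix a" 1] by (auto intro: den_mult simp: inverse_mult_distrib)
    have "den (snd (step gen_g \<tau> gen) a)"
      unfolding P by (intro den_mult den_var den_lau) auto
    then show ?thesis using inv by (auto simp: power_int_def intro: den_power)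
  qed
  have var: "den (?x v powi k)" for v k
  proof (cases v rule: ix_cases)
    case (1 a)
    then show ?thesis using den_var[of "old_ix a" k] den_var[of "new_ix a" k] by (simp add: step_def gen_def)
  next
    case (2 a)
    then show ?thesis using new by simp
  next
    case (3 a)
    then show ?thesis using den_var[of "coef_ix a" k] by (simp add: gen_g_def)
  qed
  have "den (ev ?x p)"
  proof (induction p rule: lau_induct)
    case zero then show ?case by (auto intro: den_lau lau_fract_intros)
  next
    case (mono e)
    then show ?case by (simp add: ev_single mono_at_def) (intro den_prod var)
  next
    case (diff a b)
    then show ?case by (simp add: den_diff)
  qed
  then show ?thesis unfolding den_def .
qed

text \<open>The point at which numerator and denominator are evaluated lies on the divisor
  \<open>exchange \<tau> a = 0\<close>; the other coefficients are infinitesimal.\<close>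

definition point :: "nat \<Rightarrow> nat \<Rightarrow> rat fls" where
  "point a = seed_at (\<lambda>_. 1, \<lambda>_. 1) (\<lambda>b. if b = a then 1 else fls_X)"

lemma point_nonzero: "point a v \<noteq> 0"
  unfolding point_def by (rule seed_at_cases) auto

lemma ev_point_exchange: "ev (point a) (exchange \<tau> a) = 0"
  by (subst ev_exchange) (auto simp: point_nonzero neighbours_def, simp add: point_def)

text \<open>The coefficients at other nodes are \<open>fls_X\<close>, not 0, because evaluation
  inverts them; taking the constant coefficient then sends them to 0.\<close>

definition point_res :: "nat \<Rightarrow> lau fract \<Rightarrow> rat \<Rightarrow> bool" where
  "point_res a f c \<longleftrightarrow> (\<exists>h. pev (point a) f (fps_to_fls h) \<and> fps_nth h 0 = c)"

lemma pev_point_gen_var: "pev (point a) (gen_var v) (point a v)"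
  using pev_to_fract[where a = "point a" and p = "var v"] point_nonzero by (simp add: gen_var_def)

lemma vanishing_gen:
  assumes "d a dvd \<tau>"
  shows "vanishing nb d (point_res a) gen_g \<tau> a (\<lambda>i. run gen_g \<tau> i gen)"
proof -
  note x = point_nonzero[of a]
  have one: "fps_to_fls 1 = (1 :: rat fls)" by simp
  show ?thesis
  proof unfold_locales
    show "point_res a 1 1"
      unfolding point_res_def using pev_1[OF x] by (intro exI[of _ 1]) simp
    show "point_res a (f - f') (c - c')" if "point_res a f c" "point_res a f' c'" for f f' c c'
    proof -
      obtain h h' where h: "pev (point a) f (fps_to_fls h)" "fps_nth h 0 = c"
        "pev (point a) f' (fps_to_fls h')" "fps_nth h' 0 = c'"
        using \<open>point_res a f c\<close> \<open>point_res a f' c'\<close> unfolding point_res_def by blast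
      then show ?thesis unfolding point_res_def
        using pev_diff[OF x h(1,3)] by (intro exI[of _ "h - h'"]) simp
    qed
    show "point_res a (f * f') (c * c')" if "point_res a f c" "point_res a f' c'" for f f' c c'
    proof -
      obtain h h' where h: "pev (point a) f (fps_to_fls h)" "fps_nth h 0 = c"
        "pev (point a) f' (fps_to_fls h')" "fps_nth h' 0 = c'"
        using \<open>point_res a f c\<close> \<open>point_res a f' c'\<close> unfolding point_res_def by blast
      then show ?thesis unfolding point_res_def
        using pev_mult[OF x h(1,3)] by (intro exI[of _ "h * h'"]) (simp add: fls_times_fps_to_fls)
    qed
    show "point_res a (inverse f) (inverse c)" if "point_res a f c" "c \<noteq> 0" for f c
    proof -
      obtain h where h: "pev (point a) f (fps_to_fls h)" "fps_nth h 0 = c"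
        using \<open>point_res a f c\<close> unfolding point_res_def by blast
      then have "fps_to_fls h \<noteq> 0" using \<open>c \<noteq> 0\<close> by auto
      then show ?thesis unfolding point_res_def
        using pev_inverse[OF x h(1)] h(2) \<open>c \<noteq> 0\<close>
        by (intro exI[of _ "inverse h"]) (simp add: fls_inverse_fps_to_fls)
    qed
    show "d a dvd \<tau>" by (rule assms)
    show "run gen_g \<tau> i gen = run gen_g \<tau> i (run gen_g \<tau> 0 gen)" for i by simp
    show "fst (run gen_g \<tau> i gen) b \<noteq> 0" "snd (run gen_g \<tau> i gen) b \<noteq> 0" for i b
      by (rule run_gen_nonzero)+
    show "point_res a (fst (run gen_g \<tau> 0 gen) b) 1" "point_res a (snd (run gen_g \<tau> 0 gen) b) 1" for b
      unfolding point_res_def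
      using pev_point_gen_var[of a "old_ix b"] pev_point_gen_var[of a "new_ix b"]
      by (auto intro!: exI[of _ 1] simp: gen_def) (simp_all add: point_def)
    show "point_res a (gen_g a) 1"
      unfolding point_res_def using pev_point_gen_var[of a "coef_ix a"]
      by (auto intro!: exI[of _ 1] simp: gen_g_def) (simp add: point_def)
    show "point_res a (gen_g b) 0" if "b \<noteq> a" for b
      unfolding point_res_def using pev_point_gen_var[of a "coef_ix b"] that
      by (auto intro!: exI[of _ fps_X] simp: gen_g_def) (simp add: point_def)
  qed
qed

text \<open>The exchange polynomial vanishes at \<open>point a\<close>, so it suffices that
  \<open>f\<close> is regular there. Up to \<open>2 * d a + 1\<close> steps this is
  \<open>res_window\<close>. Beyond, the induction hypothesis, applied from the seed after
  \<open>2 * d a + 1\<close> steps, writes \<open>f\<close> as a Laurent polynomial in entries that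
  do not vanish at the point.\<close>

lemma denominator_not_exchange:
  assumes IH: "\<And>\<tau>. laurent_run \<tau> n" and act: "d a dvd \<tau>"
    and f: "f = fst (run gen_g \<tau> (Suc n) gen) b \<or> f = snd (run gen_g \<tau> (Suc n) gen) b"
  shows "\<exists>D. \<not> exchange \<tau> a dvd D \<and> f * to_fract D \<in> lau_fract"
proof -
  note x = point_nonzero[of a]
  interpret vanishing nb d "point_res a" gen_g \<tau> a "\<lambda>i. run gen_g \<tau> i gen"
    by (rule vanishing_gen[OF act])
  have "\<exists>v. pev (point a) f v"
  proof (cases "Suc n \<le> Suc (2 * d a)")
    case True
    then show ?thesis using res_window[of "Suc n" b] f unfolding point_res_def by blast
  next
    case False
    define m where "m = Suc (2 * d a)"
    let ?s = "run gen_g \<tau> m gen"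
    have m: "m \<le> Suc n" "0 < m" using False by (auto simp: m_def)
    then have run: "run gen_g \<tau> (Suc n) gen = run gen_g (\<tau> + m) (Suc n - m) ?s"
      using run_add[of gen_g \<tau> m "Suc n - m" gen] by simp
    have "run gen_g (\<tau> + m) (Suc n - m) ?s =
       (\<lambda>a. ev (seed_at ?s gen_g) (fst (lrun (\<tau> + m) (Suc n - m)) a),
        \<lambda>a. ev (seed_at ?s gen_g) (snd (lrun (\<tau> + m) (Suc n - m)) a))"
    proof (rule run_eq_ev)
      show "laurent_run (\<tau> + m) (Suc n - m)"
        using laurent_run_mono[OF IH] m by simp
      show "seed_at ?s gen_g v \<noteq> 0" for v
        by (rule seed_at_cases) (simp_all add: run_gen_nonzero gen_g_def)
      show "fst (run gen_g (\<tau> + m) i ?s) a \<noteq> 0" for i a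
        using run_gen_nonzero(1)[of \<tau> "m + i" a] by (simp add: run_add)
    qed simp
    then obtain W where W: "f = ev (seed_at ?s gen_g) W"
      using f unfolding run by auto
    have "\<exists>y. y \<noteq> 0 \<and> pev (point a) (seed_at ?s gen_g v) y" for v
    proof (rule seed_at_cases)
      have nz: "fps_to_fls h \<noteq> (0 :: rat fls)" if "fps_nth h 0 \<noteq> 0" for h
        using that by auto
      show "\<exists>y. y \<noteq> 0 \<and> pev (point a) (fst ?s b) y" for b
        using res_end(1)[of b] nz unfolding m_def point_res_def by blast
      show "\<exists>y. y \<noteq> 0 \<and> pev (point a) (snd ?s b) y" for b
        using res_end(2)[of b] nz unfolding m_def point_res_def by blast
      show "\<exists>y. y \<noteq> 0 \<and> pev (point a) (gen_g b) y" for b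
        using pev_point_gen_var[of a "coef_ix b"] x unfolding gen_g_def by blast
    qed
    then obtain y where "\<And>v. y v \<noteq> 0" "\<And>v. pev (point a) (seed_at ?s gen_g v) (y v)"
      by metis
    then show ?thesis
      unfolding W using pev_ev[where a = "point a" and x = "seed_at ?s gen_g" and y = y and p = W] x by blast
  qed
  then obtain N D where D: "ev (point a) D \<noteq> 0" "f = to_fract N / to_fract D"
    unfolding pev_def by blast
  have "\<not> exchange \<tau> a dvd D"
    using D(1) ev_mult[OF x] ev_point_exchange by (auto elim!: dvdE)
  moreover have "f * to_fract D = to_fract N" using D by auto
  ultimately show ?thesis by blast
qed

lemma run_shift:
  assumes "laurent_run (\<tau> + 1) n"
  shows "run gen_g \<tau> (Suc n) gen =
    (\<lambda>a. ev (seed_at (step gen_g \<tau> gen) gen_g) (fst (lrun (\<tau> + 1) n) a),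
     \<lambda>a. ev (seed_at (step gen_g \<tau> gen) gen_g) (snd (lrun (\<tau> + 1) n) a))"
proof -
  let ?s = "step gen_g \<tau> gen"
  have s1: "run gen_g \<tau> 1 gen = ?s" by simp
  have run: "run gen_g \<tau> (Suc n) gen = run gen_g (\<tau> + 1) n ?s"
    using run_add[of gen_g \<tau> 1 n gen] by simp
  show ?thesis unfolding run
  proof (rule run_eq_ev[OF assms])
    show "seed_at ?s gen_g v \<noteq> 0" for v
      by (rule seed_at_cases) (simp_all add: run_gen_nonzero gen_g_def flip: s1 del: run.simps)
    show "fst (run gen_g (\<tau> + 1) i ?s) a \<noteq> 0" for i a
      using run_gen_nonzero(1)[of \<tau> "1 + i" a] unfolding run_add s1 .
  qed simp
qed

text \<open>All starting times are treated at once, because the hypothesis is used from the seeds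
  one step and \<open>2 * d a + 1\<close> steps later. The former limits the denominator to exchange
  polynomials, the latter excludes each of these primes.\<close>

theorem laurent_phenomenon: "laurent_run \<tau> n"
proof (induction n arbitrary: \<tau>)
  case 0
  show ?case by (simp add: laurent_run_def gen_def gen_var_def)
next
  case (Suc n)
  let ?s = "step gen_g \<tau> gen"
  have "f \<in> lau_fract"
    if f: "f = fst (run gen_g \<tau> (Suc n) gen) b \<or> f = snd (run gen_g \<tau> (Suc n) gen) b" for f b
  proof -
    obtain W where W: "f = ev (seed_at ?s gen_g) W"
      using f unfolding run_shift[OF Suc.IH] by auto
    obtain ps where ps: "set ps \<subseteq> exchange \<tau> ` {a. d a dvd \<tau>}" "f * to_fract (prod_list ps) \<in> lau_fract"
      using ev_first_step_denominator unfolding W by blast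
    show ?thesis
    proof (rule cancel_primes[OF _ _ _ ps(2)])
      fix p assume "p \<in> set ps"
      then obtain a where a: "p = exchange \<tau> a" "d a dvd \<tau>" using ps(1) by auto
      show "p dvd f \<or> p dvd k" if "p dvd f * k" for f k
        using that exchange_prime unfolding a(1) by blast
      show "p \<noteq> 0" using exchange_nonzero a by simp
      show "\<exists>D. \<not> p dvd D \<and> f * to_fract D \<in> lau_fract"
        unfolding a(1) using denominator_not_exchange[OF Suc.IH a(2) f] .
    qed
  qed
  then show ?case
    using Suc.IH[of \<tau>] unfolding laurent_run_def by (metis le_Suc_eq)
qed

end

section \<open>Polynomiality\<close>

locale coeff_ring =
  fixes S :: "'a::field set"
  assumes S_1: "1 \<in> S" and S_diff: "x \<in> S \<Longrightarrow> y \<in> S \<Longrightarrow> x - y \<in> S"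
    and S_mult: "x \<in> S \<Longrightarrow> y \<in> S \<Longrightarrow> x * y \<in> S"
begin

lemma S_0: "0 \<in> S"
  using S_diff[OF S_1 S_1] by simp

lemma S_minus: "x \<in> S \<Longrightarrow> - x \<in> S"
  using S_diff[OF S_0, of x] by simp

lemma S_add: "x \<in> S \<Longrightarrow> y \<in> S \<Longrightarrow> x + y \<in> S"
  using S_diff[OF _ S_minus, of x y] by simp

lemma S_sum: "(\<And>i. i \<in> I \<Longrightarrow> f i \<in> S) \<Longrightarrow> sum f I \<in> S"
  by (induction I rule: infinite_finite_induct) (simp_all add: S_0 S_add)

text \<open>A multiplicative group, since inverting a constant term 1 does not leave
  \<open>S\<close>; this admits negative exponents. \<open>S\<close> will be the integers, or the
  Laurent polynomials without negative powers of one variable.\<close>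

definition unit_series :: "'a fls set" where
  "unit_series = {f. \<exists>h. f = fps_to_fls h \<and> fps_nth h 0 = 1 \<and> (\<forall>n. fps_nth h n \<in> S)}"

lemma unit_seriesI: "fps_nth h 0 = 1 \<Longrightarrow> (\<And>n. fps_nth h n \<in> S) \<Longrightarrow> fps_to_fls h \<in> unit_series"
  unfolding unit_series_def by blast

lemma unit_series_1: "1 \<in> unit_series"
  using unit_seriesI[of 1] by (simp add: fps_one_nth S_0 S_1)

lemma unit_series_mult:
  assumes "f \<in> unit_series" "f' \<in> unit_series"
  shows "f * f' \<in> unit_series"
proof -
  obtain h h' where h: "f = fps_to_fls h" "fps_nth h 0 = 1" "\<And>n. fps_nth h n \<in> S"
    "f' = fps_to_fls h'" "fps_nth h' 0 = 1" "\<And>n. fps_nth h' n \<in> S"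
    using assms unfolding unit_series_def by blast
  have "f * f' = fps_to_fls (h * h')" using h by (simp add: fls_times_fps_to_fls)
  moreover have "fps_nth (h * h') n \<in> S" for n
    by (auto simp: fps_mult_nth intro!: S_sum S_mult h)
  ultimately show ?thesis using h by (auto intro!: unit_seriesI)
qed

lemma fps_inverse_coeffs:
  assumes "fps_nth h 0 = 1" "\<And>n. fps_nth h n \<in> S"
  shows "fps_nth (inverse h) n \<in> S"
proof (induction n rule: less_induct)
  case (less n)
  show ?case
  proof (cases n)
    case 0
    then show ?thesis using assms(1) S_1 by simp
  next
    case (Suc k)
    have "inverse h * h = 1" using assms(1) by (intro inverse_mult_eq_1) simp
    then have "fps_nth (inverse h * h) n = 0"
      using Suc by simp
    then have "(\<Sum>i=0..n. fps_nth (inverse h) i * fps_nth h (n - i)) = 0"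
      unfolding fps_mult_nth .
    then have "fps_nth (inverse h) n = - (\<Sum>i=0..k. fps_nth (inverse h) i * fps_nth h (n - i))"
      using Suc assms(1) by (simp add: eq_neg_iff_add_eq_0) (simp only: add.commute)
    also have "\<dots> \<in> S" using less Suc by (intro S_minus S_sum S_mult assms) auto
    finally show ?thesis .
  qed
qed

lemma unit_series_inverse:
  assumes "f \<in> unit_series"
  shows "inverse f \<in> unit_series"
proof -
  obtain h where h: "f = fps_to_fls h" "fps_nth h 0 = 1" "\<And>n. fps_nth h n \<in> S"
    using assms unfolding unit_series_def by blast
  have "inverse f = fps_to_fls (inverse h)" using h by (simp add: fls_inverse_fps_to_fls)
  then show ?thesis using h fps_inverse_coeffs[OF h(2,3)] by (auto intro!: unit_seriesI)
qed

lemma unit_series_power: "f \<in> unit_series \<Longrightarrow> f ^ n \<in> unit_series"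
  by (induction n) (simp_all add: unit_series_1 unit_series_mult)

lemma unit_series_powi: "f \<in> unit_series \<Longrightarrow> f powi n \<in> unit_series"
  by (simp add: power_int_def unit_series_power unit_series_inverse)

lemma unit_series_nonzero: "f \<in> unit_series \<Longrightarrow> f \<noteq> 0"
  unfolding unit_series_def by auto

end

interpretation int_coeffs: coeff_ring "\<int> :: 'a::field set"
  by unfold_locales auto

context residue begin

lemma res_powi: "res f c \<Longrightarrow> c \<noteq> 0 \<Longrightarrow> res (f powi n) (c powi n)"
  by (simp add: power_int_def res_power res_inverse)

lemma res_ev:
  assumes "\<And>v. res (x v) (y v)" "\<And>v. y v \<noteq> 0"
  shows "res (ev x p) (ev y p)"
proof (induction p rule: lau_induct)
  case (mono e)
  show ?case
    by (simp add: ev_single mono_at_def) (intro res_prod res_powi assms)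
qed (simp_all add: res_0 res_diff)

end

definition const_res :: "'a::field fls \<Rightarrow> 'a \<Rightarrow> bool" where
  "const_res f c \<longleftrightarrow> (\<exists>h. f = fps_to_fls h \<and> fps_nth h 0 = c)"

interpretation const_res: residue const_res
proof
  show "const_res 1 (1 :: 'a::field)"
    unfolding const_res_def by (intro exI[of _ 1]) simp
  show "const_res (f - f') (c - c')" if "const_res f c" "const_res f' c'" for f f' :: "'a fls" and c c'
    using that unfolding const_res_def by (metis fps_sub_nth fps_to_fls_minus)
  show "const_res (f * f') (c * c')" if "const_res f c" "const_res f' c'" for f f' :: "'a fls" and c c'
    using that unfolding const_res_def by (metis fps_mult_nth_0 fls_times_fps_to_fls)
  show "const_res (inverse f) (inverse c)" if "const_res f c" "c \<noteq> 0" for f :: "'a fls" and c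
    using that unfolding const_res_def by (metis fls_inverse_fps_to_fls fps_inverse_nth_0 subdegree_eq_0)
qed

lemma const_res_nth: "const_res f c \<Longrightarrow> fls_nth f 0 = c"
  unfolding const_res_def by auto

text \<open>Initial data \<open>Q a 0 = 1\<close>, \<open>Q a 1 = x_a\<close> with all coefficients
  1. Here \<open>x_a\<close> is variable number \<open>a\<close> itself, not
  \<open>new_ix a\<close>.\<close>

definition unit_seed :: "nat \<Rightarrow> lau fract" where
  "unit_seed = seed_at (\<lambda>_. 1, gen_var) (\<lambda>_. 1)"

lemma unit_seed_nonzero: "unit_seed v \<noteq> 0"
  unfolding unit_seed_def by (rule seed_at_cases) auto

lemma ev_unit_seed_lau_fract: "ev unit_seed p \<in> lau_fract"
proof (induction p rule: lau_induct)
  case zero then show ?case using lau_fract_intros(1) by simp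
next
  case (diff a b) then show ?case using lau_fract_intros(4) by simp
next
  case (mono e)
  have "unit_seed v powi k \<in> lau_fract" for v k
    using lau_fract_intros(2) gen_var_lau_fract
    by (cases v rule: ix_cases) (simp_all add: unit_seed_def)
  then show ?case by (simp add: ev_single mono_at_def lau_fract_prod)
qed

text \<open>For the coefficients \<open>g = 1 - X^\<kappa>\<close> the seed with both layers equal to \<open>1\<close> and \<open>x\<close> is one
  step after the seed with layers \<open>X^\<kappa> / x\<close> and \<open>1\<close>. Expanding in the latter, a monomial with
  a negative power of \<open>x\<^sub>a\<close> carries a positive power of \<open>X\<close> as soon as \<open>\<kappa> a\<close> is large.\<close>

definition deform :: "(nat \<Rightarrow> nat) \<Rightarrow> nat \<Rightarrow> lau fract fls" where
  "deform \<kappa> b = 1 - fls_X ^ \<kappa> b"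

definition seed_before :: "(nat \<Rightarrow> nat) \<Rightarrow> nat \<Rightarrow> lau fract fls" where
  "seed_before \<kappa> = seed_at (\<lambda>b. fls_const (gen_var b powi (- 1)) * fls_X powi int (\<kappa> b), \<lambda>_. 1) (deform \<kappa>)"

definition seed_after :: "(nat \<Rightarrow> nat) \<Rightarrow> nat \<Rightarrow> lau fract fls" where
  "seed_after \<kappa> = seed_at (\<lambda>_. 1, \<lambda>b. fls_const (gen_var b)) (deform \<kappa>)"

lemma deform_unit:
  assumes "0 < \<kappa> b"
  shows "deform \<kappa> b \<in> int_coeffs.unit_series"
proof -
  have "deform \<kappa> b = fps_to_fls (1 - fps_X ^ \<kappa> b)"
    by (simp add: deform_def fps_to_fls_power)
  also have "\<dots> \<in> int_coeffs.unit_series"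
    using assms by (intro int_coeffs.unit_seriesI) (auto simp: fps_X_power_nth)
  finally show ?thesis .
qed

lemma seeds_nonzero:
  assumes "\<And>b. 0 < \<kappa> b"
  shows "seed_before \<kappa> v \<noteq> 0" "seed_after \<kappa> v \<noteq> 0"
  using int_coeffs.unit_series_nonzero[OF deform_unit[where \<kappa> = \<kappa>, OF assms]]
  by (cases v rule: ix_cases; simp add: seed_before_def seed_after_def)+

lemma fls_nth_ev_seed_after:
  assumes "\<And>b. 0 < \<kappa> b"
  shows "fls_nth (ev (seed_after \<kappa>) p) 0 = ev unit_seed p"
proof (rule const_res_nth, rule const_res.res_ev)
  show "unit_seed v \<noteq> 0" for v by (rule unit_seed_nonzero)
  show "const_res (seed_after \<kappa> v) (unit_seed v)" for v
  proof (cases v rule: ix_cases)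
    case (1 a)
    then show ?thesis by (simp add: seed_after_def unit_seed_def const_res.res_1)
  next
    case (2 a)
    then show ?thesis unfolding const_res_def
      by (intro exI[of _ "fps_const (gen_var a)"]) (simp add: seed_after_def unit_seed_def)
  next
    case (3 a)
    then show ?thesis unfolding const_res_def
      using deform_unit[of \<kappa> a] assms by (auto simp: int_coeffs.unit_series_def seed_after_def unit_seed_def)
  qed
qed

definition pos_in :: "nat \<Rightarrow> lau fract set" where
  "pos_in a = {to_fract p | p. \<forall>e\<in>Poly_Mapping.keys p. 0 \<le> Poly_Mapping.lookup e a}"

lemma pos_in_diff: "f \<in> pos_in a \<Longrightarrow> f' \<in> pos_in a \<Longrightarrow> f - f' \<in> pos_in a"
proof -
  assume "f \<in> pos_in a" "f' \<in> pos_in a"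
  then obtain p p' where p: "f = to_fract p" "\<forall>e\<in>Poly_Mapping.keys p. 0 \<le> Poly_Mapping.lookup e a"
    "f' = to_fract p'" "\<forall>e\<in>Poly_Mapping.keys p'. 0 \<le> Poly_Mapping.lookup e a"
    unfolding pos_in_def by blast
  then show ?thesis
    unfolding pos_in_def using keys_diff[of p p'] by (intro CollectI exI[of _ "p - p'"]) auto
qed

lemma pos_in_0: "0 \<in> pos_in a"
  unfolding pos_in_def by (intro CollectI exI[of _ 0]) simp

lemma pos_in_sum: "(\<And>i. i \<in> I \<Longrightarrow> f i \<in> pos_in a) \<Longrightarrow> sum f I \<in> pos_in a"
proof (induction I rule: infinite_finite_induct)
  case (insert i I)
  have "f i - (0 - sum f I) \<in> pos_in a"
    using insert by (intro pos_in_diff pos_in_0) auto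
  then show ?case using insert by simp
qed (simp_all add: pos_in_0)

lemma pos_in_of_int: "f \<in> pos_in a \<Longrightarrow> of_int c * f \<in> pos_in a"
proof (induction c rule: int_induct[of _ 0])
  case base then show ?case by (simp add: pos_in_0)
next
  case (step1 i)
  then have "of_int i * f - (0 - f) \<in> pos_in a" by (intro pos_in_diff pos_in_0) auto
  then show ?case by (simp add: algebra_simps)
next
  case (step2 i)
  then have "of_int i * f - f \<in> pos_in a" by (intro pos_in_diff) auto
  then show ?case by (simp add: algebra_simps)
qed

text \<open>Up to a unit with integer coefficients, \<open>f\<close> is a monomial with \<open>x\<^sub>a\<close>-exponent \<open>m\<close> and order \<open>k\<close> in \<open>X\<close>.\<close>

definition graded :: "nat \<Rightarrow> int \<Rightarrow> int \<Rightarrow> lau fract fls \<Rightarrow> bool" where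
  "graded a m k f \<longleftrightarrow> (\<exists>\<mu> h. Poly_Mapping.lookup \<mu> a = m \<and> h \<in> int_coeffs.unit_series \<and>
     f = fls_const (to_fract (Poly_Mapping.single \<mu> 1)) * fls_X powi k * h)"

lemma graded_mult:
  assumes "graded a m k f" "graded a m' k' f'"
  shows "graded a (m + m') (k + k') (f * f')"
proof -
  obtain \<mu> h \<mu>' h' where *: "Poly_Mapping.lookup \<mu> a = m" "h \<in> int_coeffs.unit_series"
    "f = fls_const (to_fract (Poly_Mapping.single \<mu> 1)) * fls_X powi k * h"
    "Poly_Mapping.lookup \<mu>' a = m'" "h' \<in> int_coeffs.unit_series"
    "f' = fls_const (to_fract (Poly_Mapping.single \<mu>' 1)) * fls_X powi k' * h'"
    using assms unfolding graded_def by blast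
  have "to_fract (Poly_Mapping.single (\<mu> + \<mu>') 1) =
      to_fract (Poly_Mapping.single \<mu> 1) * (to_fract (Poly_Mapping.single \<mu>' 1) :: lau fract)"
    by (simp add: mult_single flip: to_fract_mult)
  then have "f * f' = fls_const (to_fract (Poly_Mapping.single (\<mu> + \<mu>') 1)) * fls_X powi (k + k') * (h * h')"
    unfolding * by (simp add: power_int_add mult_ac del: fls_X_power_int flip: fls_const_mult_const)
  then show ?thesis unfolding graded_def
    using * by (intro exI[of _ "\<mu> + \<mu>'"] exI[of _ "h * h'"]) (simp add: lookup_add int_coeffs.unit_series_mult)
qed

lemma graded_unit: "h \<in> int_coeffs.unit_series \<Longrightarrow> graded a 0 0 h"
  unfolding graded_def by (intro exI[of _ 0] exI[of _ h]) simp

lemma graded_prod: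
  "finite I \<Longrightarrow> (\<And>i. i \<in> I \<Longrightarrow> graded a (m i) (k i) (f i)) \<Longrightarrow> graded a (sum m I) (sum k I) (prod f I)"
  by (induction I rule: finite_induct) (simp_all add: graded_unit int_coeffs.unit_series_1 graded_mult)

text \<open>A positive order in \<open>X\<close> leaves no constant coefficient; otherwise it is an
  integer times a monomial with a non-negative power of \<open>x_a\<close>.\<close>

lemma graded_nth:
  assumes "graded a m k f" "k \<le> 0 \<Longrightarrow> 0 \<le> m"
  shows "fls_nth f 0 \<in> pos_in a"
proof -
  obtain \<mu> h where *: "Poly_Mapping.lookup \<mu> a = m" "fps_nth h 0 = 1" "\<And>n. fps_nth h n \<in> \<int>"
    "f = fls_const (to_fract (Poly_Mapping.single \<mu> 1)) * fls_X powi k * fps_to_fls h"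
    using assms unfolding graded_def int_coeffs.unit_series_def by blast
  have nth: "fls_nth f 0 = to_fract (Poly_Mapping.single \<mu> 1) * fls_nth (fps_to_fls h) (- k)"
    unfolding *(4) fls_X_power_int mult.assoc fls_X_intpow_times_conv_shift(1) by simp
  show ?thesis
  proof (cases "k \<le> 0")
    case False
    then show ?thesis using nth by (simp add: pos_in_0)
  next
    case True
    then obtain c where "fls_nth (fps_to_fls h) (- k) = of_int c"
      using *(3)[of "nat (- k)"] by (auto elim: Ints_cases)
    moreover have "to_fract (Poly_Mapping.single \<mu> 1) \<in> pos_in a"
      unfolding pos_in_def using True assms(2) *(1) by (intro CollectI exI[of _ "Poly_Mapping.single \<mu> 1"]) simp
    ultimately show ?thesis unfolding nth using pos_in_of_int by (metis mult.commute)
  qed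
qed

context q_system begin

lemma lrun_shift:
  "to_fract (snd (lrun \<tau> (Suc n)) b) = ev (seed_at (step gen_g \<tau> gen) gen_g) (snd (lrun (\<tau> + 1) n) b)"
  using to_fract_lrun(2)[OF laurent_phenomenon, of "Suc n" "Suc n" \<tau> b] run_shift[OF laurent_phenomenon]
  by simp

text \<open>One step at time 0 leads from \<open>seed_before\<close> to \<open>seed_after\<close>,
  as \<open>1 - (1 - X ^ \<kappa>) = x * (X ^ \<kappa> / x)\<close>; both sides are the same value
  of the recursion, written in two seeds.\<close>

lemma ev_seeds:
  assumes "\<And>b. 0 < \<kappa> b"
  shows "ev (seed_before \<kappa>) (snd (lrun 0 (Suc n)) b) = ev (seed_after \<kappa>) (snd (lrun 1 n) b)"
proof -
  let ?A = "seed_before \<kappa>" and ?B = "seed_after \<kappa>"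
  note A = seeds_nonzero(1)[of \<kappa>, OF assms] and B = seeds_nonzero(2)[of \<kappa>, OF assms]
  have var: "pev ?A (gen_var v) (?A v)" for v
    using pev_to_fract[where a = "?A" and p = "var v"] A by (simp add: gen_var_def)
  have new: "pev ?A (snd (step gen_g 0 gen) b) (fls_const (gen_var b))" for b
  proof -
    have "pev ?A (neighbours 0 gen b) (neighbours 0 (\<lambda>b. ?A (old_ix b), \<lambda>b. ?A (new_ix b)) b)"
      unfolding gen_def by (rule pev_neighbours) (auto simp: A var)
    moreover have "neighbours 0 (\<lambda>b. ?A (old_ix b), \<lambda>b. ?A (new_ix b)) b = 1"
    proof -
      \<comment> \<open>At time 0 only the newer layer, here constantly 1, enters the neighbour
        products.\<close>
      have "interp (bond b c) 0 = bond b c" for c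
        using bond_pos[of b c] by (simp add: interp_def)
      then show ?thesis by (simp add: neighbours_def seed_before_def)
    qed
    ultimately have "pev ?A (((snd gen b)\<^sup>2 - gen_g b * neighbours 0 gen b) / fst gen b)
        (((?A (new_ix b))\<^sup>2 - ?A (coef_ix b) * 1) / ?A (old_ix b))"
      unfolding gen_def gen_g_def fst_conv snd_conv
      by (intro pev_divide pev_diff pev_mult pev_power var A) simp
    moreover have "((?A (new_ix b))\<^sup>2 - ?A (coef_ix b) * 1) / ?A (old_ix b) = fls_const (gen_var b)"
    proof -
      have "fls_const (gen_var b) * fls_const (gen_var b powi (- 1)) = 1" by simp
      then have eq: "fls_X ^ \<kappa> b = fls_const (gen_var b) * ?A (old_ix b)"
        by (simp add: seed_before_def mult.assoc[symmetric] power_int_of_nat del: fls_const_mult_const fls_X_power_int)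
      have "(?A (new_ix b))\<^sup>2 - ?A (coef_ix b) * 1 = fls_X ^ \<kappa> b"
        by (simp add: seed_before_def deform_def)
      then show ?thesis unfolding eq using A[of "old_ix b"] by simp
    qed
    ultimately show ?thesis by (simp add: step_def)
  qed
  have "pev ?A (seed_at (step gen_g 0 gen) gen_g v) (?B v)" for v
  proof (cases v rule: ix_cases)
    case (1 a)
    then show ?thesis using var[of "new_ix a"] by (simp add: step_def gen_def seed_before_def seed_after_def)
  next
    case (2 a)
    then show ?thesis using new[of a] by (simp add: seed_after_def)
  next
    case (3 a)
    then show ?thesis using var[of "coef_ix a"] by (simp add: gen_g_def seed_before_def seed_after_def)
  qed
  then have "pev ?A (ev (seed_at (step gen_g 0 gen) gen_g) (snd (lrun (0 + 1) n) b)) (ev ?B (snd (lrun 1 n) b))"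
    using pev_ev[where a = "?A"] A B by simp
  moreover have "pev ?A (to_fract (snd (lrun 0 (Suc n)) b)) (ev ?A (snd (lrun 0 (Suc n)) b))"
    by (rule pev_to_fract) (rule A)
  ultimately show ?thesis
    unfolding lrun_shift[symmetric] using pev_unique[where a = "?A"] A by blast
qed

lemma ev_unit_seed_pos: "ev unit_seed (snd (lrun 1 n) b) \<in> pos_in a"
proof -
  let ?W = "snd (lrun 0 (Suc n)) b"
  define r :: "(nat \<Rightarrow>\<^sub>0 int) \<Rightarrow> int" where "r e = (\<Sum>v\<in>Poly_Mapping.keys e. if v \<in> range old_ix \<and> v \<noteq> old_ix a then Poly_Mapping.lookup e v else 0)" for e
  \<comment> \<open>\<open>K\<close> exceeds the absolute value of \<open>r e\<close>, the total
    exponent of the old variables at the other nodes, for every monomial. A negative power of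
    \<open>x_a\<close> then comes with order at least \<open>K + r e > 0\<close> in
    \<open>X\<close>.\<close>
  define K where "K = Suc (\<Sum>e\<in>Poly_Mapping.keys ?W. nat \<bar>r e\<bar>)"
  define \<kappa> where "\<kappa> b = (if b = a then K else 1)" for b
  have \<kappa>: "0 < \<kappa> b" for b by (simp add: \<kappa>_def K_def)
  define m k where "m v = (if v = old_ix a then - 1 else 0 :: int)"
    and "k v = (if v \<in> range old_ix then int (\<kappa> (inv old_ix v)) else 0)" for v
  have inj: "inj old_ix" by (rule injI) simp
  have powi: "graded a (m v * j) (k v * j) (seed_before \<kappa> v powi j)" for v j
  proof (cases v rule: ix_cases)
    case (1 c)
    have "seed_before \<kappa> v powi j = fls_const (gen_var c powi (- j)) * fls_X powi (int (\<kappa> c) * j)"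
      by (simp only: 1 seed_before_def seed_at_simps fst_conv power_int_mult_distrib
          fls_const_power_int[symmetric] power_int_mult[symmetric]) simp
    then show ?thesis unfolding graded_def
      using inj by (intro exI[of _ "Poly_Mapping.single c (- j)"] exI[of _ 1])
        (auto simp: gen_var_powi 1 m_def k_def lookup_single int_coeffs.unit_series_1 when_def)
  next
    case (2 c)
    then show ?thesis
      by (auto simp: seed_before_def m_def k_def graded_unit int_coeffs.unit_series_1)
  next
    case (3 c)
    then show ?thesis
      by (auto simp: seed_before_def m_def k_def intro!: graded_unit int_coeffs.unit_series_powi deform_unit \<kappa>)
  qed
  have "fls_nth (of_int (Poly_Mapping.lookup ?W e) * mono_at (seed_before \<kappa>) e) 0 \<in> pos_in a"
    if e: "e \<in> Poly_Mapping.keys ?W" for e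
  proof -
    let ?l = "Poly_Mapping.lookup e"
    have gr: "graded a (\<Sum>v\<in>Poly_Mapping.keys e. m v * ?l v) (\<Sum>v\<in>Poly_Mapping.keys e. k v * ?l v) (mono_at (seed_before \<kappa>) e)"
      unfolding mono_at_def by (rule graded_prod) (auto simp: powi)
    have "(\<Sum>v\<in>Poly_Mapping.keys e. k v * ?l v) =
        (\<Sum>v\<in>Poly_Mapping.keys e. (if v = old_ix a then int K * ?l v else 0)
           + (if v \<in> range old_ix \<and> v \<noteq> old_ix a then ?l v else 0))"
      using inj by (intro sum.cong) (auto simp: k_def \<kappa>_def)
    then have k: "(\<Sum>v\<in>Poly_Mapping.keys e. k v * ?l v) = int K * ?l (old_ix a) + r e"
      by (simp add: sum.distrib r_def in_keys_iff)
    have "(\<Sum>v\<in>Poly_Mapping.keys e. m v * ?l v) = (\<Sum>v\<in>Poly_Mapping.keys e. if v = old_ix a then - ?l v else 0)"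
      by (intro sum.cong) (auto simp: m_def)
    then have m: "(\<Sum>v\<in>Poly_Mapping.keys e. m v * ?l v) = - ?l (old_ix a)"
      by (simp add: in_keys_iff)
    have "nat \<bar>r e\<bar> \<le> (\<Sum>e\<in>Poly_Mapping.keys ?W. nat \<bar>r e\<bar>)"
      using e by (intro member_le_sum) auto
    then have "nat \<bar>r e\<bar> < K" unfolding K_def by simp
    then have K: "\<bar>r e\<bar> < int K" by linarith
    have "0 \<le> - ?l (old_ix a)" if "int K * ?l (old_ix a) + r e \<le> 0"
    proof (rule ccontr)
      assume "\<not> 0 \<le> - ?l (old_ix a)"
      then have "int K * 1 \<le> int K * ?l (old_ix a)" by (intro mult_left_mono) auto
      then show False using that K by linarith
    qed
    then have "fls_nth (mono_at (seed_before \<kappa>) e) 0 \<in> pos_in a"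
      using graded_nth[OF gr] unfolding k m by blast
    then show ?thesis by (simp add: fls_of_int pos_in_of_int)
  qed
  then have "fls_nth (ev (seed_before \<kappa>) ?W) 0 \<in> pos_in a"
    unfolding ev_def by (simp add: fls_nth_sum pos_in_sum)
  then show ?thesis
    unfolding ev_seeds[of \<kappa>, OF \<kappa>] fls_nth_ev_seed_after[of \<kappa>, OF \<kappa>] .
qed

end

section \<open>The solution of the Q-system with value 1 at index 0\<close>

lemma to_fract_prod: "to_fract (prod f S) = (\<Prod>i\<in>S. to_fract (f i))"
  by (induction S rule: infinite_finite_induct) simp_all

lemma div_Suc_dvd: "0 < m \<Longrightarrow> Suc n div m = (if m dvd Suc n then Suc (n div m) else n div m)"
  by (simp add: div_Suc dvd_eq_mod_eq_0)

text \<open>The floors take only two consecutive values, and \<open>interp\<close> counts how often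
  the larger one occurs; this links the exponents of \<open>neighbours\<close> with the floor
  products of the Q-system.\<close>

lemma prod_interp:
  fixes f :: "nat \<Rightarrow> 'a::comm_monoid_mult"
  assumes "0 < t'"
  shows "(\<Prod>s<t'. f ((Suc n + s) div t')) = f (n div t') ^ (t' - interp t' (Suc n)) * f (Suc (n div t')) ^ interp t' (Suc n)"
proof -
  define w e where "w = n div t'" and "e = n mod t'"
  have n: "n = t' * w + e" "e < t'" using assms by (simp_all add: w_def e_def)
  have "interp t' (Suc n) = Suc ((n + t') mod t')" using assms by (simp add: interp_def)
  then have \<rho>: "interp t' (Suc n) = Suc e" by (simp add: e_def)
  have low: "(Suc n + s) div t' = w" if "s < t' - Suc e" for s
    using that n by (intro div_nat_eqI) auto
  have high: "(Suc n + s) div t' = Suc w" if "t' - Suc e \<le> s" "s < t'" for s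
    using that n by (intro div_nat_eqI) auto
  have "{..<t'} = {..<t' - Suc e} \<union> {t' - Suc e..<t'}" by auto
  then have "(\<Prod>s<t'. f ((Suc n + s) div t')) =
      (\<Prod>s<t' - Suc e. f ((Suc n + s) div t')) * (\<Prod>s=t' - Suc e..<t'. f ((Suc n + s) div t'))"
    by (simp add: prod.union_disjoint ivl_disj_int)
  also have "(\<Prod>s<t' - Suc e. f ((Suc n + s) div t')) = (\<Prod>s<t' - Suc e. f w)"
    by (intro prod.cong refl arg_cong[of _ _ f] low) simp
  also have "(\<Prod>s=t' - Suc e..<t'. f ((Suc n + s) div t')) = (\<Prod>s=t' - Suc e..<t'. f (Suc w))"
    by (intro prod.cong refl arg_cong[of _ _ f] high) simp_all
  also have "(\<Prod>s<t' - Suc e. f w) * (\<Prod>s=t' - Suc e..<t'. f (Suc w)) = f w ^ (t' - Suc e) * f (Suc w) ^ Suc e"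
    using n(2) by simp
  finally show ?thesis by (simp add: \<rho> w_def)
qed

context q_system begin

text \<open>The run starts at time 1, after the exchange that leaves \<open>seed_before\<close>. The
  initial layers have indices 0 and 1, so index \<open>j\<close> appears after
  \<open>d b * (j - 1)\<close> steps.\<close>

definition q_poly :: "nat \<Rightarrow> nat \<Rightarrow> lau" where
  "q_poly b j = (if j = 0 then 1 else inv to_fract (ev unit_seed (snd (lrun 1 (d b * (j - 1))) b)))"

lemma q_poly_0 [simp]: "q_poly b 0 = 1"
  by (simp add: q_poly_def)

lemma to_fract_q_poly_Suc: "to_fract (q_poly b (Suc j)) = ev unit_seed (snd (lrun 1 (d b * j)) b)"
  by (simp add: q_poly_def f_inv_into_f ev_unit_seed_lau_fract)

lemma q_poly_1: "q_poly b (Suc 0) = var b"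
proof -
  have "to_fract (q_poly b (Suc 0)) = to_fract (var b)"
    using to_fract_q_poly_Suc[of b 0] by (simp add: lrun_0 unit_seed_def gen_var_def)
  then show ?thesis by (simp only: to_fract_eq_iff)
qed

lemma ev_lrun_q_poly:
  "ev unit_seed (snd (lrun 1 n) b) = to_fract (q_poly b (Suc (n div d b)))"
  "ev unit_seed (fst (lrun 1 n) b) = to_fract (q_poly b (n div d b))"
proof -
  have "ev unit_seed (snd (lrun 1 n) b) = to_fract (q_poly b (Suc (n div d b))) \<and>
     ev unit_seed (fst (lrun 1 n) b) = to_fract (q_poly b (n div d b))"
  proof (induction n)
    case 0
    show ?case using to_fract_q_poly_Suc[of b 0] by (simp add: lrun_0 unit_seed_def)
  next
    case (Suc n)
    have L: "laurent_run 1 (Suc n)" by (rule laurent_phenomenon)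
    note rel = lrun_Suc[OF L lessI, of b]
    show ?case
    proof (cases "d b dvd Suc n")
      case True
      then have "d b * (Suc n div d b) = Suc n" by simp
      then have "ev unit_seed (snd (lrun 1 (Suc n)) b) = to_fract (q_poly b (Suc (Suc n div d b)))"
        using to_fract_q_poly_Suc[of b "Suc n div d b"] by simp
      then show ?thesis using rel(1) True Suc.IH by (simp add: div_Suc_dvd d_pos)
    next
      case False
      then show ?thesis using rel(1,2) Suc.IH by (simp add: div_Suc_dvd d_pos)
    qed
  qed
  then show "ev unit_seed (snd (lrun 1 n) b) = to_fract (q_poly b (Suc (n div d b)))"
    "ev unit_seed (fst (lrun 1 n) b) = to_fract (q_poly b (n div d b))" by auto
qed

text \<open>The Q-system in its usual form, \<open>bond\<close> being the absolute Cartan entries: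
  the \<open>j\<close>-th relation at \<open>b\<close> is the exchange at time
  \<open>d b * j\<close>, specialised to coefficients 1.\<close>

theorem q_poly_relation:
  assumes "0 < j"
  shows "q_poly b (Suc j) * q_poly b (j - 1) = (q_poly b j)\<^sup>2
    - (\<Prod>c\<in>nb b. \<Prod>s<bond b c. q_poly c ((bond c b * j + s) div bond b c))"
proof -
  define n where "n = d b * j - 1"
  have n: "Suc n = d b * j" using assms d_pos[of b] by (simp add: n_def)
  have nd: "n div d b = j - 1"
    using assms d_pos[of b] by (intro div_nat_eqI) (auto simp: n_def algebra_simps)
  have L: "laurent_run 1 (Suc n)" by (rule laurent_phenomenon)
  have act: "d b dvd 1 + n" using n by simp
  note ev_simps = ev_mult[OF unit_seed_nonzero] ev_power[OF unit_seed_nonzero] ev_neighbours[OF unit_seed_nonzero]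
  have snd: "ev unit_seed (snd (lrun 1 (Suc n)) b) = to_fract (q_poly b (Suc j))"
    using d_pos[of b] by (simp only: ev_lrun_q_poly n) simp
  have fac: "fst s' c ^ (bond b c - interp (bond b c) (1 + n)) * snd s' c ^ interp (bond b c) (1 + n) =
      (\<Prod>s<bond b c. to_fract (q_poly c ((bond c b * j + s) div bond b c)))"
    if c: "c \<in> nb b" and s': "s' = (\<lambda>c. ev unit_seed (fst (lrun 1 n) c), \<lambda>c. ev unit_seed (snd (lrun 1 n) c))" for c s'
  proof -
    consider "d c = d b" | "d c = 1" "d b \<noteq> 1" | "d b = 1" "d c \<noteq> 1"
      using d_nb[OF c] by metis
    then show ?thesis
    proof cases
      case 1
      then have "bond b c = 1" "bond c b = 1" by (simp_all add: bond_def)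
      then show ?thesis using nd 1 assms unfolding s' fst_conv snd_conv ev_lrun_q_poly by simp
    next
      case 2
      then have "bond b c = 1" "bond c b = d b" by (simp_all add: bond_def)
      then show ?thesis using n 2 unfolding s' fst_conv snd_conv ev_lrun_q_poly by simp
    next
      case 3
      then have b: "bond b c = d c" "bond c b = 1" by (simp_all add: bond_def)
      have "j = Suc n" using n 3 by simp
      then show ?thesis
        using prod_interp[OF d_pos, of "\<lambda>i. to_fract (q_poly c i)" n c] unfolding s' ev_lrun_q_poly b by simp
    qed
  qed
  have "to_fract (q_poly b (Suc j) * q_poly b (j - 1)) = ev unit_seed (snd (lrun 1 (Suc n)) b * fst (lrun 1 n) b)"
    unfolding ev_simps snd ev_lrun_q_poly(2) nd to_fract_mult ..
  also have "\<dots> = (ev unit_seed (snd (lrun 1 n) b))\<^sup>2 - neighbours (1 + n) (\<lambda>c. ev unit_seed (fst (lrun 1 n) c), \<lambda>c. ev unit_seed (snd (lrun 1 n) c)) b"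
    unfolding lrun_Suc(3)[OF L lessI act] by (simp add: ev_simps) (simp add: unit_seed_def)
  also have "neighbours (1 + n) (\<lambda>c. ev unit_seed (fst (lrun 1 n) c), \<lambda>c. ev unit_seed (snd (lrun 1 n) c)) b
      = (\<Prod>c\<in>nb b. \<Prod>s<bond b c. to_fract (q_poly c ((bond c b * j + s) div bond b c)))"
    unfolding neighbours_def by (intro prod.cong refl fac) auto
  also have "\<dots> = to_fract (\<Prod>c\<in>nb b. \<Prod>s<bond b c. q_poly c ((bond c b * j + s) div bond b c))"
    by (simp add: to_fract_prod)
  also have "ev unit_seed (snd (lrun 1 n) b) = to_fract (q_poly b j)"
    unfolding ev_lrun_q_poly nd using assms by simp
  finally have "to_fract (q_poly b (Suc j) * q_poly b (j - 1)) = to_fract ((q_poly b j)\<^sup>2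
    - (\<Prod>c\<in>nb b. \<Prod>s<bond b c. q_poly c ((bond c b * j + s) div bond b c)))"
    by (simp add: power2_eq_square)
  then show ?thesis by (simp only: to_fract_eq_iff)
qed

theorem q_poly_polynomial:
  assumes "e \<in> Poly_Mapping.keys (q_poly b j)"
  shows "0 \<le> Poly_Mapping.lookup e a"
proof (cases j)
  case 0
  then show ?thesis using assms by simp
next
  case (Suc i)
  have "to_fract (q_poly b j) \<in> pos_in a"
    unfolding Suc to_fract_q_poly_Suc by (rule ev_unit_seed_pos)
  then show ?thesis using assms unfolding pos_in_def by auto
qed

end

section \<open>Binomial sums\<close>

lemma binom_Suc: "binom (Suc m) p = binom (Suc m) (p - 1) + binom m p"
  using gbinomial_Suc_Suc[of "of_int (int m + p) :: rat" m] by (simp add: binom_def algebra_simps)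

lemma binom_0 [simp]: "binom 0 p = 1"
  by (simp add: binom_def)

lemma binom_neg1: "binom (Suc m) (- 1) = 0"
proof -
  have "binom (Suc m) (- 1) = of_nat m gchoose Suc m" by (simp add: binom_def)
  also have "\<dots> = 0" by (simp flip: binomial_gbinomial)
  finally show ?thesis .
qed

text \<open>Pascal's rule carries integrality in both directions from \<open>p = - 1\<close>, where
  the coefficient is 0.\<close>

lemma binom_Ints: "binom m p \<in> \<int>"
proof (induction m arbitrary: p)
  case (Suc m)
  show ?case
  proof (induction p rule: int_induct[of _ "- 1"])
    case (step1 i)
    then show ?case using binom_Suc[of m "i + 1"] Suc by simp
  next
    case (step2 i)
    then have "binom (Suc m) (i - 1) = binom (Suc m) i - binom m i" using binom_Suc[of m i] by simp
    then show ?case using step2 Suc by simp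
  qed (simp add: binom_neg1)
qed simp

definition int_binom :: "nat \<Rightarrow> int \<Rightarrow> int" where
  "int_binom m p = \<lfloor>binom m p\<rfloor>"

lemma binom_eq_int_binom: "binom m p = of_int (int_binom m p)"
  using binom_Ints[of m p] by (auto simp: int_binom_def elim: Ints_cases)

lemma int_binom_Suc: "int_binom (Suc m) p = int_binom (Suc m) (p - 1) + int_binom m p"
  using binom_Suc[of m p] unfolding binom_eq_int_binom by (simp only: of_int_eq_iff flip: of_int_add)

lemma int_binom_0 [simp]: "int_binom 0 p = 1"
  by (simp add: int_binom_def)

lemma int_binom_neg1: "int_binom (Suc m) (- 1) = 0"
  by (simp add: int_binom_def binom_neg1)

lemma (in residue) cong_mod_sum:
  "(\<And>i. i \<in> I \<Longrightarrow> cong_mod z (f i) (f' i)) \<Longrightarrow> cong_mod z (sum f I) (sum f' I)"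
proof (induction I rule: infinite_finite_induct)
  case (insert i I)
  then obtain h h' where "res h 0" "f i = f' i + z * h" "res h' 0" "sum f I = sum f' I + z * h'"
    unfolding cong_mod_def by blast
  then show ?case
    using insert.hyps res_add[of h 0 h' 0]
    by (auto simp: cong_mod_def algebra_simps intro!: exI[of _ "h + h'"])
qed (simp_all add: cong_mod_refl)

lemma (in residue) cong_mod_mult_left: "reg c \<Longrightarrow> cong_mod z f f' \<Longrightarrow> cong_mod z (c * f) (c * f')"
proof -
  assume "reg c" "cong_mod z f f'"
  then obtain h k where "res h 0" "f = f' + z * h" "res c k"
    unfolding cong_mod_def reg_def by blast
  then show ?thesis
    using res_mult[of c k h 0] by (auto simp: cong_mod_def algebra_simps intro!: exI[of _ "c * h"])
qed

lemma (in residue) reg_of_int: "reg (of_int n)"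
proof (induction n rule: int_induct[of _ 0])
  case base then show ?case using res_0 by (auto intro: regI)
next
  case (step1 i) then show ?case using res_1 by (auto simp: reg_def dest: res_add)
next
  case (step2 i) then show ?case using res_1 by (auto simp: reg_def dest: res_diff)
qed

text \<open>Since the maximal ideal supplies one more factor \<open>X\<close>, coefficients up to
  and including degree \<open>N\<close> agree.\<close>

abbreviation cong_X :: "nat \<Rightarrow> 'a::field fls \<Rightarrow> 'a fls \<Rightarrow> bool" where
  "cong_X N \<equiv> const_res.cong_mod (fls_X ^ N)"

lemma cong_X_nth:
  assumes "cong_X N f f'" "n \<le> int N"
  shows "fls_nth f n = fls_nth f' n"
proof -
  obtain h where h: "fps_nth h 0 = 0" "f = f' + fls_X ^ N * fps_to_fls h"
    using assms(1) unfolding const_res.cong_mod_def const_res_def by blast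
  have "fls_nth (fls_X ^ N * fps_to_fls h) n = fls_nth (fps_to_fls h) (n - int N)"
    using fls_X_intpow_times_conv_shift(1)[of "int N" "fps_to_fls h"]
    by (simp add: fls_X_power_conv_shift_1)
  also have "\<dots> = 0" using assms(2) h(1) by (cases "n = int N") auto
  finally show ?thesis using h(2) by simp
qed

text \<open>By Pascal's rule \<open>(1 - W) * s p\<close> telescopes to \<open>s (p - 1)\<close> up
  to a multiple of \<open>W ^ Suc N\<close>, and \<open>s (- 1) = 1\<close>; this determines the
  truncated sum for every integer \<open>p\<close>.\<close>

lemma negative_binomial:
  fixes W :: "'a::field fls"
  assumes W: "const_res W 0"
  shows "cong_X N (\<Sum>m\<le>N. of_int (int_binom m p) * W ^ m) ((1 - W) powi (- p - 1))"
proof -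
  define s where "s p = (\<Sum>m\<le>N. of_int (int_binom m p) * W ^ m)" for p
  have res1: "const_res (1 - W) 1"
    using const_res.res_diff[OF const_res.res_1 W] by simp
  then have nz: "1 - W \<noteq> 0" using const_res_nth by fastforce
  have reg: "const_res.reg (1 - W)" "const_res.reg (inverse (1 - W))"
    using res1 const_res.res_inverse[OF res1] by (auto intro: const_res.regI)
  obtain h where h: "W = fps_to_fls h" "fps_nth h 0 = 0" using W unfolding const_res_def by blast
  have WN: "\<exists>k. const_res k 0 \<and> W ^ Suc N = fls_X ^ N * k"
  proof -
    have "h = fps_X * fps_shift 1 h"
      using h(2) by (intro fps_ext) auto
    then have "W = fls_X * fps_to_fls (fps_shift 1 h)"
      using h(1) by (metis fls_times_fps_to_fls fps_X_to_fls)
    then have "W ^ Suc N = fls_X ^ N * (W * fps_to_fls (fps_shift 1 h) ^ N)"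
      by (metis power_Suc power_mult_distrib mult.left_commute)
    moreover have "const_res (W * fps_to_fls (fps_shift 1 h) ^ N) 0"
      using const_res.res_mult[OF W const_res.res_power] unfolding const_res_def
      by (metis mult_zero_left)
    ultimately show ?thesis by blast
  qed
  have step: "cong_X N ((1 - W) * s p) (s (p - 1))" for p
  proof -
    have "(1 - W) * (\<Sum>m\<le>n. of_int (int_binom m p) * W ^ m) =
        (\<Sum>m\<le>n. of_int (int_binom m (p - 1)) * W ^ m) - of_int (int_binom n p) * W ^ Suc n" for n
      by (induction n) (simp_all add: algebra_simps int_binom_Suc[of _ p])
    then have eq: "(1 - W) * s p = s (p - 1) - of_int (int_binom N p) * W ^ Suc N"
      unfolding s_def .
    obtain k where k: "const_res k 0" "W ^ Suc N = fls_X ^ N * k" using WN by blast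
    obtain c where "const_res (of_int (int_binom N p) :: 'a fls) c"
      using const_res.reg_of_int unfolding const_res.reg_def by blast
    then have "const_res (- (of_int (int_binom N p) * k)) 0"
      using const_res.res_minus[OF const_res.res_mult[OF _ k(1)]] by fastforce
    then show ?thesis unfolding const_res.cong_mod_def eq k(2)
      by (intro exI[of _ "- (of_int (int_binom N p) * k)"]) (simp add: algebra_simps)
  qed
  have base: "s (- 1) = 1"
  proof -
    have "s (- 1) = (\<Sum>m\<in>{0}. of_int (int_binom m (- 1)) * W ^ m)"
      unfolding s_def
    proof (rule sum.mono_neutral_right)
      show "\<forall>i\<in>{..N} - {0}. of_int (int_binom i (- 1)) * W ^ i = 0"
        using int_binom_neg1 by (metis DiffE insertCI mult_zero_left not0_implies_Suc of_int_0)
    qed auto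
    then show ?thesis by simp
  qed
  have "cong_X N (s p) ((1 - W) powi (- p - 1))"
  proof (induction p rule: int_induct[of _ "- 1"])
    case base
    then show ?case using \<open>s (- 1) = 1\<close> by (simp add: const_res.cong_mod_refl)
  next
    case (step1 i)
    have "cong_X N (inverse (1 - W) * ((1 - W) * s (i + 1))) (inverse (1 - W) * s i)"
      using const_res.cong_mod_mult_left[OF reg(2) step[of "i + 1"]] by simp
    also have "cong_X N (inverse (1 - W) * s i) (inverse (1 - W) * (1 - W) powi (- i - 1))"
      by (rule const_res.cong_mod_mult_left[OF reg(2) step1(2)])
    finally (const_res.cong_mod_trans)
    have "cong_X N (inverse (1 - W) * ((1 - W) * s (i + 1))) (inverse (1 - W) * (1 - W) powi (- i - 1))" .
    moreover have "inverse (1 - W) * ((1 - W) * s (i + 1)) = s (i + 1)"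
      by (simp only: mult.assoc[symmetric] left_inverse[OF nz] mult_1_left)
    moreover have "inverse (1 - W) * (1 - W) powi (- i - 1) = (1 - W) powi (- (i + 1) - 1)"
    proof -
      have "- (i + 1) - 1 = - 1 + (- i - 1)" by simp
      then show ?thesis using nz by (simp only: power_int_add power_int_minus power_int_1_right simp_thms)
    qed
    ultimately show ?case by simp
  next
    case (step2 i)
    have "cong_X N (s (i - 1)) ((1 - W) * s i)"
      by (rule const_res.cong_mod_sym[OF step])
    also have "cong_X N ((1 - W) * s i) ((1 - W) * (1 - W) powi (- i - 1))"
      by (rule const_res.cong_mod_mult_left[OF reg(1) step2(2)])
    finally (const_res.cong_mod_trans)
    have "cong_X N (s (i - 1)) ((1 - W) * (1 - W) powi (- i - 1))" .
    moreover have "(1 - W) * (1 - W) powi (- i - 1) = (1 - W) powi (- (i - 1) - 1)"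
    proof -
      have "- (i - 1) - 1 = 1 + (- i - 1)" by simp
      then show ?thesis using nz by (simp only: power_int_add power_int_1_right simp_thms)
    qed
    ultimately show ?case by simp
  qed
  then show ?thesis unfolding s_def .
qed

section \<open>Summing out the variables of a triangular system\<close>

definition box :: "'i set \<Rightarrow> nat \<Rightarrow> ('i \<Rightarrow> nat) set" where
  "box L N = {m. (\<forall>x\<in>L. m x \<le> N) \<and> (\<forall>x. x \<notin> L \<longrightarrow> m x = 0)}"

lemma finite_box: "finite L \<Longrightarrow> finite (box L N)"
  by (rule finite_subset[OF _ finite_set_of_finite_funs[of L "{..N}" 0]]) (auto simp: box_def)

lemma box_empty: "box {} N = {\<lambda>_. 0}"
  by (auto simp: box_def)

lemma sum_box_insert:
  assumes "x \<notin> L" "finite L"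
  shows "(\<Sum>m\<in>box (insert x L) N. f m) = (\<Sum>m\<in>box L N. \<Sum>i\<le>N. f (m(x := i)))"
proof -
  have "(\<Sum>m\<in>box L N. \<Sum>i\<le>N. f (m(x := i))) = (\<Sum>(m, i)\<in>box L N \<times> {..N}. f (m(x := i)))"
    by (rule sum.cartesian_product)
  also have "\<dots> = (\<Sum>m\<in>box (insert x L) N. f m)"
    by (rule sum.reindex_bij_witness[where i = "\<lambda>m. (m(x := 0), m x)" and j = "\<lambda>(m, i). m(x := i)"])
       (use assms in \<open>auto simp: box_def fun_eq_iff\<close>)
  finally show ?thesis ..
qed

text \<open>Summing out the variables in the order of increasing \<open>time\<close>.\<close>

lemma triangular_sum:
  fixes F :: "'i \<Rightarrow> 'a::field fls" and c :: "'i \<Rightarrow> 'i \<Rightarrow> int" and time :: "'i \<Rightarrow> nat"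
  assumes "finite L"
    and c: "\<And>x y. x \<in> L \<Longrightarrow> y \<in> L \<Longrightarrow> c x y \<noteq> 0 \<Longrightarrow> time x < time y"
    and Y: "\<And>x. x \<in> L \<Longrightarrow> const_res (Y x) 0"
    and F: "\<And>x. x \<in> L \<Longrightarrow> F x = 1 - Y x * (\<Prod>z\<in>L. F z powi (- c z x))"
    and "\<And>x. x \<in> L \<Longrightarrow> const_res (F x) 1"
  shows "cong_X N (\<Sum>m\<in>box L N. \<Prod>x\<in>L. of_int (int_binom (m x) (b x + (\<Sum>y\<in>L. c x y * int (m y)))) * Y x ^ m x)
    (\<Prod>x\<in>L. F x powi (- b x - 1))"
  using assms
proof (induction L arbitrary: Y rule: finite_ranking_induct[where f = "\<lambda>x. - int (time x)"])
  case empty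
  then show ?case by (simp add: box_empty const_res.cong_mod_refl)
next
  case (insert x0 L)
  show ?case
  proof (cases "x0 \<in> L")
    case True
    then show ?thesis using insert.IH[of Y] insert.prems by (simp add: insert_absorb)
  next
    case False
    note L = \<open>finite L\<close> False
    \<comment> \<open>The ranking inserts variables by decreasing time, so \<open>x0\<close> is the
      earliest and its multiplicity occurs in the upper argument of no other binomial.\<close>
    have c0: "c z x0 = 0" if "z \<in> insert x0 L" for z
      using insert.prems(1)[of z x0] insert.hyps(2)[of z] that by fastforce
    have F0: "F x0 = 1 - Y x0"
      using insert.prems(3)[of x0] by (simp add: c0)
    have Fnz: "F x \<noteq> 0" if "x \<in> insert x0 L" for x
      using const_res_nth[OF insert.prems(4)[OF that]] by auto
    have Fpow: "const_res (F x powi n) 1" if "x \<in> insert x0 L" for x n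
      using const_res.res_powi[OF insert.prems(4)[OF that]] by simp
    \<comment> \<open>Summing over the multiplicity of \<open>x0\<close> produces a power of
      \<open>F x0\<close> that depends on the remaining multiplicities; it is absorbed into their
      weights \<open>Y\<close>.\<close>
    define Y' where "Y' x = Y x * F x0 powi (- c x0 x)" for x
    define B where "B m x = (of_int (int_binom (m x) (b x + (\<Sum>y\<in>L. c x y * int (m y)))) :: 'a fls)" for m x
    have IH: "cong_X N (\<Sum>m\<in>box L N. \<Prod>x\<in>L. B m x * Y' x ^ m x) (\<Prod>x\<in>L. F x powi (- b x - 1))"
      unfolding B_def
    proof (rule insert.IH)
      show "const_res (Y' x) 0" if "x \<in> L" for x
        using const_res.res_mult[OF insert.prems(2)[of x] Fpow[of x0]] that unfolding Y'_def by fastforce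
      show "F x = 1 - Y' x * (\<Prod>z\<in>L. F z powi (- c z x))" if "x \<in> L" for x
        using insert.prems(3)[of x] that L by (simp add: Y'_def mult.assoc)
    qed (use insert.prems in auto)
    have regB: "const_res.reg (\<Prod>x\<in>L. B m x * Y x ^ m x)" for m
      unfolding B_def using insert.prems(2)
      by (intro const_res.reg_prod const_res.reg_mult const_res.reg_of_int const_res.reg_power) (auto intro: const_res.regI)
    have "(\<Sum>m\<in>box (insert x0 L) N. \<Prod>x\<in>insert x0 L.
          of_int (int_binom (m x) (b x + (\<Sum>y\<in>insert x0 L. c x y * int (m y)))) * Y x ^ m x)
        = (\<Sum>m\<in>box L N. \<Sum>i\<le>N. (\<Prod>x\<in>L. B m x * Y x ^ m x)
            * (of_int (int_binom i (b x0 + (\<Sum>y\<in>L. c x0 y * int (m y)))) * Y x0 ^ i))"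
    proof (unfold sum_box_insert[OF L(2,1)], intro sum.cong refl)
      fix m i
      have upd: "(\<Sum>y\<in>insert x0 L. c x y * int ((m(x0 := i)) y)) = (\<Sum>y\<in>L. c x y * int (m y))"
        if "x \<in> insert x0 L" for x
        using L c0[OF that] by (auto intro!: sum.cong)
      have "(\<Prod>x\<in>insert x0 L. of_int (int_binom ((m(x0 := i)) x) (b x + (\<Sum>y\<in>insert x0 L. c x y * int ((m(x0 := i)) y)))) * Y x ^ (m(x0 := i)) x)
          = (\<Prod>x\<in>insert x0 L. of_int (int_binom ((m(x0 := i)) x) (b x + (\<Sum>y\<in>L. c x y * int (m y)))) * Y x ^ (m(x0 := i)) x)"
        by (intro prod.cong refl) (simp only: upd)
      also have "\<dots> = of_int (int_binom i (b x0 + (\<Sum>y\<in>L. c x0 y * int (m y)))) * Y x0 ^ i * (\<Prod>x\<in>L. B m x * Y x ^ m x)"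
        unfolding prod.insert[OF L] B_def
        by (intro arg_cong2[where f = "(*)"] prod.cong) (use L in auto)
      finally show "(\<Prod>x\<in>insert x0 L. of_int (int_binom ((m(x0 := i)) x) (b x + (\<Sum>y\<in>insert x0 L. c x y * int ((m(x0 := i)) y)))) * Y x ^ (m(x0 := i)) x)
         = (\<Prod>x\<in>L. B m x * Y x ^ m x) * (of_int (int_binom i (b x0 + (\<Sum>y\<in>L. c x0 y * int (m y)))) * Y x0 ^ i)"
        by (simp only: mult_ac)
    qed
    also have "\<dots> = (\<Sum>m\<in>box L N. (\<Prod>x\<in>L. B m x * Y x ^ m x)
            * (\<Sum>i\<le>N. of_int (int_binom i (b x0 + (\<Sum>y\<in>L. c x0 y * int (m y)))) * Y x0 ^ i))"
      by (simp only: sum_distrib_left)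
    also have "cong_X N \<dots> (\<Sum>m\<in>box L N. (\<Prod>x\<in>L. B m x * Y x ^ m x)
            * F x0 powi (- (b x0 + (\<Sum>y\<in>L. c x0 y * int (m y))) - 1))"
      unfolding F0
      by (intro const_res.cong_mod_sum const_res.cong_mod_mult_left regB negative_binomial insert.prems) simp
    also have "(\<Sum>m\<in>box L N. (\<Prod>x\<in>L. B m x * Y x ^ m x)
            * F x0 powi (- (b x0 + (\<Sum>y\<in>L. c x0 y * int (m y))) - 1))
        = F x0 powi (- b x0 - 1) * (\<Sum>m\<in>box L N. \<Prod>x\<in>L. B m x * Y' x ^ m x)"
    proof (unfold sum_distrib_left, intro sum.cong refl)
      fix m
      have nz: "F x0 \<noteq> 0" using Fnz by simp
      have "F x0 powi (- (\<Sum>y\<in>L. c x0 y * int (m y))) = (\<Prod>y\<in>L. (F x0 powi (- c x0 y)) ^ m y)"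
        using L(1)
      proof (induction L rule: finite_induct)
        case (insert y L)
        have "F x0 powi (- (c x0 y * int (m y) + (\<Sum>y\<in>L. c x0 y * int (m y)))) =
            F x0 powi (- c x0 y * int (m y)) * F x0 powi (- (\<Sum>y\<in>L. c x0 y * int (m y)))"
          using nz by (simp flip: power_int_add)
        moreover have "(F x0 powi (- c x0 y)) ^ m y = F x0 powi (- c x0 y * int (m y))"
          using power_int_mult[of "F x0" "- c x0 y" "int (m y)"] by simp
        ultimately show ?case using insert by simp
      qed simp
      moreover have "- (b x0 + (\<Sum>y\<in>L. c x0 y * int (m y))) - 1 = (- b x0 - 1) + - (\<Sum>y\<in>L. c x0 y * int (m y))"
        by simp
      ultimately have "F x0 powi (- (b x0 + (\<Sum>y\<in>L. c x0 y * int (m y))) - 1)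
          = F x0 powi (- b x0 - 1) * (\<Prod>y\<in>L. (F x0 powi (- c x0 y)) ^ m y)"
        using nz by (simp only: power_int_add simp_thms)
      then show "(\<Prod>x\<in>L. B m x * Y x ^ m x) * F x0 powi (- (b x0 + (\<Sum>y\<in>L. c x0 y * int (m y))) - 1)
          = F x0 powi (- b x0 - 1) * (\<Prod>x\<in>L. B m x * Y' x ^ m x)"
        by (simp only: Y'_def power_mult_distrib prod.distrib mult_ac)
    qed
    also have "cong_X N \<dots> (F x0 powi (- b x0 - 1) * (\<Prod>x\<in>L. F x powi (- b x - 1)))"
      by (rule const_res.cong_mod_mult_left[OF const_res.regI[OF Fpow] IH]) simp
    finally (const_res.cong_mod_trans) show ?thesis using L by simp
  qed
qed

section \<open>The normalised Q-system\<close>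

lemma hermite_identity: "0 < b \<Longrightarrow> (\<Sum>s<b. (n + s) div b) = (n::nat)"
proof (induction n)
  case 0
  then show ?case by simp
next
  case (Suc n)
  have 1: "(\<Sum>s<b. (Suc n + s) div b) = (\<Sum>s<b. (n + Suc s) div b)" by simp
  have 2: "(\<Sum>s<Suc b. (n + s) div b) = n div b + (\<Sum>s<b. (n + Suc s) div b)"
    unfolding sum.lessThan_Suc_shift add_0_right ..
  have 3: "(\<Sum>s<Suc b. (n + s) div b) = (\<Sum>s<b. (n + s) div b) + (n + b) div b"
    by (rule sum.lessThan_Suc)
  have 4: "(n + b) div b = Suc (n div b)" using Suc.prems by simp
  show ?case using 1 2 3 4 Suc.IH[OF Suc.prems] by linarith
qed

text \<open>Subtracting \<open>j\<close> from each floor shifts the numerator by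
  \<open>b * j\<close>, and truncation takes effect for all summands or for none. This matches the
  truncated differences in the \<open>q\<close>.\<close>

lemma hermite_truncated:
  assumes "0 < b"
  shows "(\<Sum>s<b. (n + s) div b - j) = n - b * (j::nat)"
proof (cases "b * j \<le> n")
  case True
  then obtain k where n: "n = b * j + k" by (auto simp: le_iff_add)
  have "(n + s) div b - j = (n - b * j + s) div b" for s
    using div_mult_self2[of b "k + s" j] assms by (simp add: n add.assoc)
  then show ?thesis using hermite_identity[OF assms, of "n - b * j"] by simp
next
  case False
  have "(n + s) div b - j = 0" if "s < b" for s
  proof -
    have "n + s < b * Suc j" using False that by simp
    then have "(n + s) div b < Suc j" using assms by (simp add: less_mult_imp_div_less mult.commute)
    then show ?thesis by simp
  qed
  then show ?thesis using False by simp
qed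

definition second_ratio :: "(nat \<Rightarrow> 'f::field) \<Rightarrow> nat \<Rightarrow> 'f" where
  "second_ratio g j = g (Suc j) * g (j - 1) / (g j)\<^sup>2"

lemma second_ratio_prod:
  assumes "g 0 = 1" "g 1 = 1" "\<And>j. g j \<noteq> 0"
  shows "(\<Prod>j=1..n. second_ratio g j) = g (Suc n) / g n"
proof (induction n)
  case 0
  then show ?case using assms by simp
next
  case (Suc n)
  then show ?case using assms(3) by (simp add: second_ratio_def power2_eq_square)
qed

text \<open>A multiplicative double summation: the ratios are second differences, and the initial
  values 1 leave no boundary terms. Truncated subtraction trivialises the factors with
  \<open>j \<ge> i\<close>, so any \<open>n\<close> with \<open>i \<le> Suc n\<close> will
  do.\<close>

lemma second_ratio_telescope:
  assumes g: "g 0 = 1" "g 1 = 1" "\<And>j. g j \<noteq> 0" and "i \<le> Suc n"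
  shows "(\<Prod>j=1..n. second_ratio g j ^ (i - j)) = g i"
proof -
  have trunc: "(\<Prod>j=1..n. second_ratio g j ^ (i - j)) = (\<Prod>j=1..m. second_ratio g j ^ (i - j))"
    if "i \<le> Suc m" "m \<le> n" for i m n
    using that by (intro prod.mono_neutral_right) auto
  have "(\<Prod>j=1..i - 1. second_ratio g j ^ (i - j)) = g i"
  proof (induction i)
    case 0
    then show ?case using g by simp
  next
    case (Suc i)
    have "(\<Prod>j=1..i. second_ratio g j ^ (Suc i - j)) = (\<Prod>j=1..i. second_ratio g j ^ (i - j) * second_ratio g j)"
      by (intro prod.cong) (auto simp: Suc_diff_le)
    also have "\<dots> = g i * (g (Suc i) / g i)"
      unfolding prod.distrib second_ratio_prod[of g, OF g] using trunc[of i "i - 1" i] Suc by simp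
    finally show ?case using g(3) by simp
  qed
  then show ?thesis using trunc[of i "i - 1" n] assms(4) by simp
qed

locale graded_q_system = q_system nb d for nb d +
  fixes I :: "nat set" and w :: "nat \<Rightarrow> int"
  assumes finite_I: "finite I" and nb_I: "nb a \<subseteq> I"
begin

definition cart :: "nat \<Rightarrow> nat \<Rightarrow> int" where
  "cart a b = (if a = b then 2 else if b \<in> nb a then - int (bond a b) else 0)"

text \<open>The variable \<open>x\<^sub>a = 1 / u\<^sub>a\<close>, graded by \<open>X\<close> so that every \<open>yy b = \<Prod>\<^sub>a u\<^sub>a\<^bsup>C\<^sub>a\<^sub>b\<^esup>\<close> gets a positive degree and the
  sums over \<open>m\<close> become \<open>X\<close>-adically convergent.\<close>

definition xi :: "nat \<Rightarrow> lau fract fls" where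
  "xi a = fls_const (gen_var a) * fls_X powi (- w a)"

definition Q :: "nat \<Rightarrow> nat \<Rightarrow> lau fract fls" where
  "Q a j = ev xi (q_poly a j)"

text \<open>This normalisation makes the values at 0 and 1 equal to 1, as telescoping requires, and
  leaves the ratios in \<open>F\<close> unchanged for \<open>j \<ge> 1\<close>.\<close>

definition G :: "nat \<Rightarrow> nat \<Rightarrow> lau fract fls" where
  "G a j = Q a j * xi a powi (- int j)"

definition yy :: "nat \<Rightarrow> lau fract fls" where
  "yy a = (\<Prod>b\<in>I. xi b powi (- cart b a))"

definition F :: "nat \<times> nat \<Rightarrow> lau fract fls" where
  "F = (\<lambda>(a, j). second_ratio (G a) j)"

definition height :: "nat \<Rightarrow> int" where
  "height a = (\<Sum>b\<in>I. w b * cart b a)"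

lemma xi_nonzero: "xi a \<noteq> 0"
  by (simp add: xi_def fls_shift_eq0_iff)

lemma yy_eq: "yy a = fls_const (\<Prod>b\<in>I. gen_var b powi (- cart b a)) * fls_X powi height a"
proof -
  have "(\<Prod>b\<in>S. xi b powi (- cart b a)) =
     fls_const (\<Prod>b\<in>S. gen_var b powi (- cart b a)) * fls_X powi (\<Sum>b\<in>S. w b * cart b a)" if "finite S" for S
    using that
  proof (induction S rule: finite_induct)
    case (insert b S)
    have "xi b powi (- cart b a) = fls_const (gen_var b powi (- cart b a)) * fls_X powi (w b * cart b a)"
      unfolding xi_def power_int_mult_distrib fls_const_power_int[symmetric] power_int_mult[symmetric] by simp
    then show ?case
      using insert by (simp add: power_int_add mult_ac del: fls_X_power_int flip: fls_const_mult_const)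
  qed simp
  then show ?thesis unfolding yy_def height_def using finite_I by blast
qed

lemma G_0: "G a 0 = 1" and G_1: "G a 1 = 1"
  using xi_nonzero[of a] by (simp_all add: G_def Q_def q_poly_1 power_int_minus)

text \<open>Hermite's identity collects the powers of the \<open>xi b\<close>; together with those
  of \<open>xi a\<close> they form \<open>yy a ^ j\<close>.\<close>

lemma ev_xi_prod_neighbours:
  assumes "a \<in> I"
  shows "(\<Prod>b\<in>nb a. \<Prod>s<bond a b. Q b ((bond b a * j + s) div bond a b)) * xi a powi (- 2 * int j) =
    yy a ^ j * (\<Prod>b\<in>nb a. \<Prod>s<bond a b. G b ((bond b a * j + s) div bond a b))"
proof -
  have Q: "Q b i = G b i * xi b ^ i" for b i
    using xi_nonzero[of b] by (simp add: G_def power_int_minus)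
  have inner: "(\<Prod>s<bond a b. Q b ((bond b a * j + s) div bond a b)) =
      (\<Prod>s<bond a b. G b ((bond b a * j + s) div bond a b)) * xi b powi (int (bond b a) * int j)" for b
  proof -
    have "(\<Prod>s<bond a b. xi b ^ ((bond b a * j + s) div bond a b)) = xi b ^ (bond b a * j)"
      using hermite_identity[OF bond_pos[of a b], of "bond b a * j"] by (simp flip: power_sum)
    then show ?thesis unfolding Q prod.distrib by (simp flip: of_nat_mult)
  qed
  have "yy a = xi a powi (- 2) * (\<Prod>b\<in>nb a. xi b powi int (bond b a))"
  proof -
    have "yy a = (\<Prod>b\<in>insert a (nb a). xi b powi (- cart b a))"
      unfolding yy_def
      by (rule prod.mono_neutral_right) (use finite_I nb_I assms nb_sym in \<open>auto simp: cart_def\<close>)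
    also have "\<dots> = xi a powi (- cart a a) * (\<Prod>b\<in>nb a. xi b powi (- cart b a))"
      using finite_nb nb_irrefl by simp
    also have "(\<Prod>b\<in>nb a. xi b powi (- cart b a)) = (\<Prod>b\<in>nb a. xi b powi int (bond b a))"
      using nb_sym nb_irrefl by (intro prod.cong) (auto simp: cart_def)
    finally show ?thesis by (simp add: cart_def)
  qed
  moreover have "(xi b powi k) ^ j = xi b powi (k * int j)" for b k
    by (simp only: power_int_mult power_int_of_nat)
  ultimately have "yy a ^ j = xi a powi (- 2 * int j) * (\<Prod>b\<in>nb a. xi b powi (int (bond b a) * int j))"
    by (simp only: power_mult_distrib prod_power_distrib)
  then show ?thesis unfolding inner prod.distrib by (simp only: mult_ac)
qed

lemma G_relation:
  assumes "a \<in> I" "0 < j"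
  shows "G a (Suc j) * G a (j - 1) = (G a j)\<^sup>2 -
    yy a ^ j * (\<Prod>b\<in>nb a. \<Prod>s<bond a b. G b ((bond b a * j + s) div bond a b))"
proof -
  have "Q a (Suc j) * Q a (j - 1) = (Q a j)\<^sup>2 - (\<Prod>b\<in>nb a. \<Prod>s<bond a b. Q b ((bond b a * j + s) div bond a b))"
    using arg_cong[OF q_poly_relation[OF assms(2), of a], of "ev xi"]
    by (simp add: Q_def ev_mult ev_power ev_prod xi_nonzero)
  then have "Q a (Suc j) * Q a (j - 1) * xi a powi (- 2 * int j) = (Q a j)\<^sup>2 * xi a powi (- 2 * int j)
      - (\<Prod>b\<in>nb a. \<Prod>s<bond a b. Q b ((bond b a * j + s) div bond a b)) * xi a powi (- 2 * int j)"
    by (simp only: left_diff_distrib)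
  moreover have "Q a (Suc j) * Q a (j - 1) * xi a powi (- 2 * int j) = G a (Suc j) * G a (j - 1)"
  proof -
    have "- 2 * int j = - int (Suc j) + - int (j - 1)" using assms(2) by simp
    then have "xi a powi (- 2 * int j) = xi a powi (- int (Suc j)) * xi a powi (- int (j - 1))"
      using xi_nonzero by (simp only: power_int_add simp_thms)
    then show ?thesis by (simp only: G_def mult_ac)
  qed
  moreover have "(Q a j)\<^sup>2 * xi a powi (- 2 * int j) = (G a j)\<^sup>2"
  proof -
    have "- 2 * int j = - int j + - int j" by simp
    then have "xi a powi (- 2 * int j) = xi a powi (- int j) * xi a powi (- int j)"
      using xi_nonzero by (simp only: power_int_add simp_thms)
    then show ?thesis by (simp only: G_def power2_eq_square mult_ac)
  qed
  ultimately show ?thesis unfolding ev_xi_prod_neighbours[OF assms(1)] by simp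
qed

lemma d_bond: "b \<in> nb a \<Longrightarrow> d a * bond a b = d b * bond b a"
  using d_nb[of b a] by (auto simp: bond_def)

text \<open>The value with index \<open>i\<close> at \<open>b\<close> is created at time
  \<open>d b * (i - 1)\<close>; all values used by the relation at time \<open>d a * j\<close> are
  older, or initial.\<close>

lemma neighbour_index_time:
  assumes "b \<in> nb a" "s < bond a b"
  shows "d b * ((bond b a * j + s) div bond a b - 1) < d a * j \<or> (bond b a * j + s) div bond a b \<le> 1 "
proof (cases "(bond b a * j + s) div bond a b \<le> 1")
  case False
  define i where "i = (bond b a * j + s) div bond a b"
  have "bond a b * i \<le> bond b a * j + s" unfolding i_def by (simp add: mult.commute)
  then have "bond a b * (i - 1) < bond b a * j" using assms(2) False unfolding i_def[symmetric]
    by (cases i) auto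
  then have "d b * (bond a b * (i - 1)) < d b * (bond b a * j)" using d_pos by simp
  also have "\<dots> = d a * bond a b * j" using d_bond[OF assms(1)] by (simp add: mult.assoc)
  finally have "bond a b * (d b * (i - 1)) < bond a b * (d a * j)" by (simp add: mult_ac)
  then show ?thesis unfolding i_def by simp
qed simp

end

locale positive_q_system = graded_q_system +
  assumes height_pos: "a \<in> I \<Longrightarrow> 1 \<le> height a"
begin

lemma const_res_yy_pow:
  assumes "a \<in> I" "0 < j"
  shows "const_res (yy a ^ j) 0"
proof -
  have "const_res (yy a) 0"
  proof -
    have "yy a = fps_to_fls (fps_const (\<Prod>b\<in>I. gen_var b powi (- cart b a)) * fps_X ^ nat (height a))"
      using height_pos[OF assms(1)]
      by (simp add: yy_eq fls_times_fps_to_fls fps_to_fls_power fls_X_power_conv_shift_1)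
    then show ?thesis unfolding const_res_def using height_pos[OF assms(1)] by (auto simp: fps_X_power_nth)
  qed
  from const_res.res_power[OF this, of j] show ?thesis using assms(2) by (simp add: zero_power)
qed

text \<open>Induction on the time of creation; \<open>yy a\<close> has positive degree in
  \<open>X\<close>, so the subtracted term of the relation has residue 0.\<close>

lemma const_res_G: "a \<in> I \<Longrightarrow> const_res (G a j) 1"
proof (induction "d a * (j - 1)" arbitrary: a j rule: less_induct)
  case less
  have IH: "const_res (G b i) 1" if "b \<in> I" "d b * (i - 1) < d a * (j - 1) \<or> i \<le> 1" for b i
    using that less.hyps[of b i] G_0[of b] G_1[of b] const_res.res_1
    by (cases "i = 0"; cases "i = 1") auto
  show ?case
  proof (cases "j \<le> 1")
    case True
    then show ?thesis using IH less.prems by blast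
  next
    case False
    define i where "i = j - 1"
    have i: "0 < i" "j = Suc i" using False by (auto simp: i_def)
    have G: "const_res (G a i) 1" "const_res (G a (i - 1)) 1"
      using i d_pos[of a] less.prems by (auto intro!: IH)
    have "const_res (\<Prod>b\<in>nb a. \<Prod>s<bond a b. G b ((bond b a * i + s) div bond a b)) (\<Prod>b\<in>nb a. \<Prod>s<bond a b. 1)"
    proof (intro const_res.res_prod IH)
      fix b s assume b: "b \<in> nb a" "s \<in> {..<bond a b}"
      show "b \<in> I" using b nb_I by auto
      show "d b * ((bond b a * i + s) div bond a b - 1) < d a * (j - 1) \<or> (bond b a * i + s) div bond a b \<le> 1"
        using neighbour_index_time[of b a s i] b i by simp
    qed
    then have "const_res (((G a i)\<^sup>2 - yy a ^ i * (\<Prod>b\<in>nb a. \<Prod>s<bond a b. G b ((bond b a * i + s) div bond a b))) / G a (i - 1))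
       ((1\<^sup>2 - 0 * (\<Prod>b\<in>nb a. \<Prod>s<bond a b. 1)) / 1)"
      by (intro const_res.res_divide const_res.res_diff const_res.res_mult const_res.res_power G const_res_yy_pow less.prems i) simp_all
    moreover have "G a (i - 1) \<noteq> 0" using const_res_nth[OF G(2)] by auto
    then have "G a j = ((G a i)\<^sup>2 - yy a ^ i * (\<Prod>b\<in>nb a. \<Prod>s<bond a b. G b ((bond b a * i + s) div bond a b))) / G a (i - 1)"
      using G_relation[OF less.prems i(1)] i(2) by (simp add: field_simps)
    ultimately show ?thesis by simp
  qed
qed

lemma G_nonzero: "a \<in> I \<Longrightarrow> G a j \<noteq> 0"
  using const_res_nth[OF const_res_G[of a j]] by auto

lemma const_res_F: "a \<in> I \<Longrightarrow> const_res (F (a, j)) 1"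
proof -
  assume a: "a \<in> I"
  have "const_res (G a (Suc j) * G a (j - 1) / (G a j)\<^sup>2) (1 * 1 / 1\<^sup>2)"
    by (intro const_res.res_divide const_res.res_mult const_res.res_power const_res_G a) simp
  then show ?thesis by (simp add: F_def second_ratio_def)
qed

text \<open>The coefficient of \<open>m y\<close> in the \<open>q\<close> at \<open>x\<close>;
  truncation at 0 replaces the restricted range of summation.\<close>

definition dep :: "nat \<times> nat \<Rightarrow> nat \<times> nat \<Rightarrow> int" where
  "dep x y = sgn (cart (fst x) (fst y)) * max 0 (\<bar>cart (fst x) (fst y)\<bar> * int (snd y) - \<bar>cart (fst y) (fst x)\<bar> * int (snd x))"

definition upto_time :: "nat \<Rightarrow> (nat \<times> nat) set" where
  "upto_time T = Sigma I (\<lambda>b. {1..T div d b})"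

lemma finite_upto_time: "finite (upto_time T)"
  unfolding upto_time_def using finite_I by (intro finite_SigmaI) auto

lemma upto_time_iff: "(b, j) \<in> upto_time T \<longleftrightarrow> b \<in> I \<and> 1 \<le> j \<and> d b * j \<le> T"
  using d_pos[of b] by (auto simp: upto_time_def less_eq_div_iff_mult_less_eq mult.commute)

lemma dep_time:
  assumes "dep (a, i) (b, j) \<noteq> 0"
  shows "d a * i < d b * j"
proof -
  have C: "cart a b \<noteq> 0" "\<bar>cart b a\<bar> * int i < \<bar>cart a b\<bar> * int j"
    using assms by (auto simp: dep_def sgn_if max_def split: if_splits)
  show ?thesis
  proof (cases "a = b")
    case True
    then show ?thesis using C d_pos[of b] by (simp add: cart_def)
  next
    case False
    then have b1: "b \<in> nb a" using C(1) by (simp add: cart_def split: if_splits)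
    note b = b1 nb_sym[OF b1]
    have "int (bond b a * i) < int (bond a b * j)" using C(2) False b by (simp add: cart_def)
    then have "bond b a * i < bond a b * j" by (simp only: of_nat_less_iff)
    then have lt: "d b * (bond b a * i) < d b * (bond a b * j)" using d_pos[of b] by simp
    have eq: "d b * (bond b a * i) = bond a b * (d a * i)"
      by (simp only: mult.assoc[symmetric] d_bond[OF b(1), symmetric]) (simp only: mult_ac)
    have "bond a b * (d a * i) < bond a b * (d b * j)"
      using lt unfolding eq mult.left_commute[of "d b" "bond a b"] .
    then show ?thesis by simp
  qed
qed

text \<open>The powers of \<open>F\<close> telescope, the truncation in \<open>dep\<close> being the
  one that telescoping needs: node \<open>a\<close> contributes \<open>G a i\<close> to the power
  -2, the neighbours their product in the relation, and the claim becomes \<open>G_relation\<close>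
  divided by \<open>(G a i)\<^sup>2\<close>.\<close>

lemma F_fixpoint:
  assumes "(a, i) \<in> upto_time T"
  shows "F (a, i) = 1 - yy a ^ i * (\<Prod>z\<in>upto_time T. F z powi (- dep z (a, i)))"
proof -
  have ai: "a \<in> I" "0 < i" "d a * i \<le> T" using assms by (auto simp: upto_time_iff)
  have tele: "(\<Prod>j=1..T div d b. F (b, j) ^ (k - j)) = G b k" if "b \<in> I" "k \<le> Suc (T div d b)" for b k
    unfolding F_def prod.case using that G_0 G_1 G_nonzero by (intro second_ratio_telescope) auto
  define f where "f b = (\<Prod>j=1..T div d b. F (b, j) powi (- dep (b, j) (a, i)))" for b
  have "(\<Prod>z\<in>upto_time T. F z powi (- dep z (a, i))) = (\<Prod>b\<in>I. f b)"
    unfolding upto_time_def f_def using finite_I by (subst prod.Sigma) (auto simp: case_prod_beta)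
  also have "\<dots> = (\<Prod>b\<in>insert a (nb a). f b)"
    by (rule prod.mono_neutral_right) (use finite_I nb_I ai nb_sym in \<open>auto simp: f_def dep_def cart_def\<close>)
  also have "\<dots> = f a * (\<Prod>b\<in>nb a. f b)"
    using finite_nb nb_irrefl by simp
  also have "f a = inverse ((G a i)\<^sup>2)"
  proof -
    have "f a = (\<Prod>j=1..T div d a. inverse ((F (a, j) ^ (i - j))\<^sup>2))"
      unfolding f_def
    proof (intro prod.cong refl)
      fix j assume "j \<in> {1..T div d a}"
      have "dep (a, j) (a, i) = int (2 * (i - j))" by (auto simp: dep_def cart_def max_def)
      then have "F (a, j) powi (- dep (a, j) (a, i)) = inverse (F (a, j) ^ (2 * (i - j)))"
        by (simp only: power_int_minus power_int_of_nat)
      also have "F (a, j) ^ (2 * (i - j)) = (F (a, j) ^ (i - j))\<^sup>2" by (rule power_even_eq)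
      finally show "F (a, j) powi (- dep (a, j) (a, i)) = inverse ((F (a, j) ^ (i - j))\<^sup>2)" .
    qed
    also have "\<dots> = inverse ((\<Prod>j=1..T div d a. F (a, j) ^ (i - j))\<^sup>2)"
      by (simp only: prod_inversef[unfolded comp_def] prod_power_distrib)
    also have "(\<Prod>j=1..T div d a. F (a, j) ^ (i - j)) = G a i"
      using ai d_pos[of a] by (intro tele) (auto simp: less_eq_div_iff_mult_less_eq mult.commute le_SucI)
    finally show ?thesis .
  qed
  also have "(\<Prod>b\<in>nb a. f b) = (\<Prod>b\<in>nb a. \<Prod>s<bond a b. G b ((bond b a * i + s) div bond a b))"
  proof (intro prod.cong refl)
    fix b assume b: "b \<in> nb a"
    have bI: "b \<in> I" using b nb_I by auto
    have ab: "a \<noteq> b" "a \<in> nb b" using b nb_irrefl nb_sym by auto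
    have "f b = (\<Prod>j=1..T div d b. \<Prod>s<bond a b. F (b, j) ^ ((bond b a * i + s) div bond a b - j))"
      unfolding f_def
    proof (intro prod.cong refl)
      fix j assume "j \<in> {1..T div d b}"
      have "- dep (b, j) (a, i) = int (bond b a * i - bond a b * j)"
      proof -
        have "- dep (b, j) (a, i) = max 0 (int (bond b a * i) - int (bond a b * j))"
          using ab b bond_pos[of b a] by (simp add: dep_def cart_def)
        also have "max 0 (int x - int y) = int (x - y)" for x y by auto
        finally show ?thesis .
      qed
      then show "F (b, j) powi (- dep (b, j) (a, i)) = (\<Prod>s<bond a b. F (b, j) ^ ((bond b a * i + s) div bond a b - j))"
        using hermite_truncated[OF bond_pos[of a b], of "bond b a * i" j] by (simp flip: power_sum)
    qed
    also have "\<dots> = (\<Prod>s<bond a b. \<Prod>j=1..T div d b. F (b, j) ^ ((bond b a * i + s) div bond a b - j))"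
      by (rule prod.swap)
    also have "\<dots> = (\<Prod>s<bond a b. G b ((bond b a * i + s) div bond a b))"
    proof (intro prod.cong refl tele bI)
      fix s assume "s \<in> {..<bond a b}"
      then have "d b * ((bond b a * i + s) div bond a b - 1) < d a * i \<or> (bond b a * i + s) div bond a b \<le> 1"
        using neighbour_index_time[OF b] by simp
      then show "(bond b a * i + s) div bond a b \<le> Suc (T div d b)"
      proof
        assume "d b * ((bond b a * i + s) div bond a b - 1) < d a * i"
        then have "((bond b a * i + s) div bond a b - 1) * d b \<le> T" using ai(3) by (simp add: mult.commute)
        then have "(bond b a * i + s) div bond a b - 1 \<le> T div d b"
          using d_pos[of b] by (simp add: less_eq_div_iff_mult_less_eq)
        then show ?thesis by simp
      qed simp
    qed
    finally show "f b = (\<Prod>s<bond a b. G b ((bond b a * i + s) div bond a b))" .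
  qed
  finally have "yy a ^ i * (\<Prod>z\<in>upto_time T. F z powi (- dep z (a, i))) =
      ((G a i)\<^sup>2 - G a (Suc i) * G a (i - 1)) / (G a i)\<^sup>2"
    using G_relation[OF ai(1,2)] by (simp add: field_simps)
  then show ?thesis using G_nonzero[OF ai(1), of i]
    by (simp add: F_def second_ratio_def diff_divide_distrib)
qed

end

section \<open>Vanishing of the class sums\<close>

text \<open>Each function \<open>i - j\<close> of \<open>j\<close>, truncated at 0, telescopes to a
  single \<open>g i\<close>. Non-negative combinations of such functions therefore yield no
  denominators.\<close>

lemma second_ratio_weighted:
  assumes g: "g 0 = 1" "g 1 = 1" "\<And>j. g j \<noteq> 0"
    and e: "\<And>j. 1 \<le> j \<Longrightarrow> j \<le> p \<Longrightarrow>
      e j = int ((\<Sum>i=1..p. n i * (i - j)) + \<mu> * (p - j) + \<kappa> * (Suc p - j))"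
  shows "(\<Prod>j=1..p. second_ratio g j powi e j) = (\<Prod>i=1..p. g i ^ n i) * g p ^ \<mu> * g (Suc p) ^ \<kappa>"
proof -
  let ?r = "second_ratio g"
  have tele: "(\<Prod>j=1..p. ?r j ^ (k * (i - j))) = g i ^ k" if "i \<le> Suc p" for i k
  proof -
    have "(\<Prod>j=1..p. ?r j ^ (k * (i - j))) = (\<Prod>j=1..p. ?r j ^ (i - j)) ^ k"
      unfolding prod_power_distrib by (simp only: power_mult[symmetric] mult.commute)
    then show ?thesis unfolding second_ratio_telescope[of g, OF g that] .
  qed
  have "(\<Prod>j=1..p. ?r j powi e j) = (\<Prod>j=1..p. (\<Prod>i=1..p. ?r j ^ (n i * (i - j))) * ?r j ^ (\<mu> * (p - j)) * ?r j ^ (\<kappa> * (Suc p - j)))"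
    by (intro prod.cong refl) (simp only: e atLeastAtMost_iff power_int_of_nat power_add power_sum)
  also have "\<dots> = (\<Prod>i=1..p. \<Prod>j=1..p. ?r j ^ (n i * (i - j))) * g p ^ \<mu> * g (Suc p) ^ \<kappa>"
    unfolding prod.distrib by (subst prod.swap) (simp only: tele le_SucI order_refl)
  also have "(\<Prod>i=1..p. \<Prod>j=1..p. ?r j ^ (n i * (i - j))) = (\<Prod>i=1..p. g i ^ n i)"
    by (intro prod.cong refl tele) auto
  finally show ?thesis .
qed

context coeff_ring begin

definition fls_over :: "'a fls set" where
  "fls_over = {f. \<forall>n. fls_nth f n \<in> S}"

lemma fls_over_mult: "f \<in> fls_over \<Longrightarrow> f' \<in> fls_over \<Longrightarrow> f * f' \<in> fls_over"
  unfolding fls_over_def by (auto simp: fls_times_nth intro!: S_sum S_mult)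

lemma fls_over_1: "1 \<in> fls_over"
  unfolding fls_over_def by (auto simp: S_0 S_1)

lemma fls_over_sum: "(\<And>i. i \<in> K \<Longrightarrow> f i \<in> fls_over) \<Longrightarrow> sum f K \<in> fls_over"
  unfolding fls_over_def by (auto simp: fls_nth_sum intro!: S_sum)

lemma fls_over_prod: "(\<And>i. i \<in> K \<Longrightarrow> f i \<in> fls_over) \<Longrightarrow> prod f K \<in> fls_over"
  by (induction K rule: infinite_finite_induct) (auto intro: fls_over_mult fls_over_1)

lemma fls_over_power: "f \<in> fls_over \<Longrightarrow> f ^ n \<in> fls_over"
  by (induction n) (auto intro: fls_over_mult fls_over_1)

lemma fls_over_monomial: "c \<in> S \<Longrightarrow> fls_const c * fls_X powi k \<in> fls_over"
  unfolding fls_over_def by (auto simp: fls_X_intpow_times_conv_shift S_0)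

lemma unit_series_fls_over: "unit_series \<subseteq> fls_over"
  unfolding unit_series_def fls_over_def by (auto simp: S_0)

lemma unit_series_const_res: "f \<in> fls_over \<Longrightarrow> const_res f 1 \<Longrightarrow> f \<in> unit_series"
  unfolding unit_series_def fls_over_def const_res_def
  by (smt (verit, best) fps_to_fls_nth mem_Collect_eq nat_int of_nat_less_0_iff)

end

lemma pos_in_mult: "f \<in> pos_in a \<Longrightarrow> f' \<in> pos_in a \<Longrightarrow> f * f' \<in> pos_in a"
proof -
  assume "f \<in> pos_in a" "f' \<in> pos_in a"
  then obtain p p' where p: "f = to_fract p" "\<forall>e\<in>Poly_Mapping.keys p. 0 \<le> Poly_Mapping.lookup e a"
    "f' = to_fract p'" "\<forall>e\<in>Poly_Mapping.keys p'. 0 \<le> Poly_Mapping.lookup e a"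
    unfolding pos_in_def by blast
  then show ?thesis
    unfolding pos_in_def using keys_mult[of p p']
    by (intro CollectI exI[of _ "p * p'"]) (auto simp: lookup_add)
qed

lemma coeff_ring_pos_in: "coeff_ring (pos_in a)"
proof
  show "1 \<in> pos_in a" unfolding pos_in_def by (intro CollectI exI[of _ 1]) simp
qed (rule pos_in_diff pos_in_mult; assumption)+

lemma gen_var_powi_pos_in: "b \<noteq> a \<or> 0 \<le> k \<Longrightarrow> gen_var b powi k \<in> pos_in a"
  unfolding pos_in_def gen_var_powi
  by (intro CollectI exI[of _ "Poly_Mapping.single (Poly_Mapping.single b k) 1"]) (auto simp: lookup_single when_def)

context positive_q_system begin

lemma xi_powi: "xi a powi k = fls_const (gen_var a powi k) * fls_X powi (- w a * k)"
  unfolding xi_def power_int_mult_distrib fls_const_power_int[symmetric] power_int_mult[symmetric] ..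

lemma Q_fls_over: "Q b j \<in> coeff_ring.fls_over (pos_in a)"
proof -
  interpret pos: coeff_ring "pos_in a" by (rule coeff_ring_pos_in)
  have "of_int (Poly_Mapping.lookup (q_poly b j) e) * mono_at xi e \<in> pos.fls_over"
    if e: "e \<in> Poly_Mapping.keys (q_poly b j)" for e
  proof (rule pos.fls_over_mult)
    have "of_int c \<in> pos_in a" for c
      using pos_in_of_int[OF pos.S_1, of c] by simp
    from pos.fls_over_monomial[OF this, of _ 0]
    show "of_int (Poly_Mapping.lookup (q_poly b j) e) \<in> pos.fls_over" by (simp add: fls_of_int)
    show "mono_at xi e \<in> pos.fls_over"
      unfolding mono_at_def xi_powi
      using q_poly_polynomial[OF e, of a]
      by (intro pos.fls_over_prod pos.fls_over_monomial gen_var_powi_pos_in) blast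
  qed
  then show ?thesis unfolding Q_def ev_def by (rule pos.fls_over_sum)
qed

text \<open>For \<open>b \<noteq> a\<close> the normalisation involves no power of
  \<open>x_a\<close>, and constant term 1 makes arbitrary integer powers harmless.\<close>

lemma G_unit_series:
  assumes "b \<noteq> a" "b \<in> I"
  shows "G b j \<in> coeff_ring.unit_series (pos_in a)"
proof -
  interpret pos: coeff_ring "pos_in a" by (rule coeff_ring_pos_in)
  have "G b j \<in> pos.fls_over"
    unfolding G_def xi_powi using assms
    by (intro pos.fls_over_mult Q_fls_over pos.fls_over_monomial gen_var_powi_pos_in) auto
  then show ?thesis by (rule pos.unit_series_const_res[OF _ const_res_G[OF assms(2)]])
qed

lemma F_powi_fls_over:
  assumes "b \<noteq> a" "b \<in> I"
  shows "F (b, j) powi k \<in> coeff_ring.fls_over (pos_in a)"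
proof -
  interpret pos: coeff_ring "pos_in a" by (rule coeff_ring_pos_in)
  have "F (b, j) \<in> pos.unit_series"
    using G_unit_series[OF assms]
    by (simp add: F_def second_ratio_def divide_inverse pos.unit_series_mult pos.unit_series_inverse pos.unit_series_power)
  then show ?thesis using pos.unit_series_powi pos.unit_series_fls_over by blast
qed

text \<open>Node \<open>a\<close> gives non-negative powers of the \<open>Q a i\<close>, so negative
  powers of \<open>x_a\<close> come only from the normalising factors. These add up to the exponent
  \<open>- \<delta>\<close>, where \<open>\<delta>\<close> is the formula for
  \<open>e (a, j)\<close> at \<open>j = 0\<close>.\<close>

lemma F_product_degree:
  assumes a: "a \<in> I" and p: "p = T div d a"
    and e: "\<And>j. 1 \<le> j \<Longrightarrow> j \<le> p \<Longrightarrow>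
      e (a, j) = int ((\<Sum>i=1..p. n i * (i - j)) + \<mu> * (p - j) + \<kappa> * (Suc p - j))"
    and \<delta>: "\<delta> = int ((\<Sum>i=1..p. n i * i) + \<mu> * p + \<kappa> * Suc p)"
  shows "\<exists>f\<in>coeff_ring.fls_over (pos_in a). (\<Prod>x\<in>upto_time T. F x powi e x) = xi a powi (- \<delta>) * f"
proof -
  interpret pos: coeff_ring "pos_in a" by (rule coeff_ring_pos_in)
  have GQ: "G a i ^ k = xi a powi (- int (k * i)) * Q a i ^ k" for i k
  proof -
    have "xi a powi (- int (k * i)) = (xi a powi (- int i)) ^ k"
      using power_int_mult[of "xi a" "- int i" "int k"] by (simp add: mult.commute)
    then show ?thesis by (simp only: G_def power_mult_distrib mult.commute)
  qed
  have prodGQ: "(\<Prod>i=1..p. G a i ^ n i) = xi a powi (- int (\<Sum>i=1..p. n i * i)) * (\<Prod>i=1..p. Q a i ^ n i)" for p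
  proof (induction p)
    case (Suc p)
    have "- int (\<Sum>i=1..Suc p. n i * i) = - int (\<Sum>i=1..p. n i * i) + - int (n (Suc p) * Suc p)"
      by simp
    then have xi: "xi a powi (- int (\<Sum>i=1..Suc p. n i * i)) =
        xi a powi (- int (\<Sum>i=1..p. n i * i)) * xi a powi (- int (n (Suc p) * Suc p))"
      using xi_nonzero by (simp only: power_int_add simp_thms)
    have step: "(\<Prod>i=1..Suc p. h i ^ n i) = (\<Prod>i=1..p. h i ^ n i) * h (Suc p) ^ n (Suc p)"
      for h :: "nat \<Rightarrow> lau fract fls" by simp
    show ?case
      unfolding step[of "G a"] step[of "Q a"] Suc.IH GQ[of "Suc p" "n (Suc p)"] xi by (simp only: mult_ac)
  qed simp
  define q where "q = (\<Prod>i=1..p. Q a i ^ n i) * Q a p ^ \<mu> * Q a (Suc p) ^ \<kappa>"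
  have "(\<Prod>j=1..p. F (a, j) powi e (a, j)) = (\<Prod>i=1..p. G a i ^ n i) * G a p ^ \<mu> * G a (Suc p) ^ \<kappa>"
    unfolding F_def prod.case
    by (rule second_ratio_weighted) (use G_0 G_1 G_nonzero[OF a] e in auto)
  also have "\<dots> = xi a powi (- \<delta>) * q"
  proof -
    have "- \<delta> = - int (\<Sum>i=1..p. n i * i) + - int (\<mu> * p) + - int (\<kappa> * Suc p)" by (simp add: \<delta>)
    then have "xi a powi (- \<delta>) = xi a powi (- int (\<Sum>i=1..p. n i * i)) * xi a powi (- int (\<mu> * p)) * xi a powi (- int (\<kappa> * Suc p))"
      using xi_nonzero by (simp only: power_int_add simp_thms)
    then show ?thesis unfolding q_def prodGQ GQ[of p \<mu>] GQ[of "Suc p" \<kappa>] by (simp only: mult_ac)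
  qed
  finally have fa: "(\<Prod>j=1..p. F (a, j) powi e (a, j)) = xi a powi (- \<delta>) * q" .
  have "(\<Prod>x\<in>upto_time T. F x powi e x) = (\<Prod>b\<in>I. \<Prod>j=1..T div d b. F (b, j) powi e (b, j))"
    unfolding upto_time_def using finite_I by (subst prod.Sigma) (auto simp: case_prod_beta)
  also have "\<dots> = (\<Prod>j=1..p. F (a, j) powi e (a, j)) * (\<Prod>b\<in>I - {a}. \<Prod>j=1..T div d b. F (b, j) powi e (b, j))"
    unfolding p using finite_I a by (rule prod.remove)
  finally have "(\<Prod>x\<in>upto_time T. F x powi e x) =
      xi a powi (- \<delta>) * (q * (\<Prod>b\<in>I - {a}. \<Prod>j=1..T div d b. F (b, j) powi e (b, j)))"
    unfolding fa by (simp only: mult.assoc)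
  moreover have "q * (\<Prod>b\<in>I - {a}. \<Prod>j=1..T div d b. F (b, j) powi e (b, j)) \<in> pos.fls_over"
    unfolding q_def
    by (intro pos.fls_over_mult pos.fls_over_prod pos.fls_over_power Q_fls_over F_powi_fls_over) auto
  ultimately show ?thesis by blast
qed

section \<open>A class sum as a coefficient of an X-adic product\<close>

definition expo :: "nat \<Rightarrow> (nat \<times> nat \<Rightarrow> nat) \<Rightarrow> nat \<Rightarrow>\<^sub>0 int" where
  "expo T m = (\<Sum>b\<in>I. Poly_Mapping.single b (- (\<Sum>(c, j)\<in>upto_time T. int j * cart b c * int (m (c, j)))))"

lemma lookup_expo: "Poly_Mapping.lookup (expo T m) b =
    (if b \<in> I then - (\<Sum>(c, j)\<in>upto_time T. int j * cart b c * int (m (c, j))) else 0)"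
  using finite_I by (simp add: expo_def lookup_sum lookup_single when_def if_distrib cong: if_cong)

definition z_degree :: "nat \<Rightarrow> (nat \<times> nat \<Rightarrow> nat) \<Rightarrow> int" where
  "z_degree T m = (\<Sum>(c, j)\<in>upto_time T. int j * height c * int (m (c, j)))"

text \<open>The degree in \<open>X\<close> is linear in the exponent vector. Fixing the latter fixes
  the former, which bounds all multiplicities because the heights are positive.\<close>

lemma z_degree_expo: "z_degree T m = - (\<Sum>b\<in>I. w b * Poly_Mapping.lookup (expo T m) b)"
proof -
  have "- (\<Sum>b\<in>I. w b * Poly_Mapping.lookup (expo T m) b) =
      (\<Sum>b\<in>I. \<Sum>x\<in>upto_time T. w b * (int (snd x) * cart b (fst x) * int (m x)))"
    by (simp add: lookup_expo sum_distrib_left case_prod_beta flip: sum_negf)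
  also have "\<dots> = (\<Sum>x\<in>upto_time T. \<Sum>b\<in>I. w b * (int (snd x) * cart b (fst x) * int (m x)))"
    by (rule sum.swap)
  also have "\<dots> = z_degree T m"
    unfolding z_degree_def height_def
    by (intro sum.cong refl) (simp add: sum_distrib_left sum_distrib_right case_prod_beta mult_ac)
  finally show ?thesis ..
qed

lemma le_z_degree:
  assumes "x \<in> upto_time T"
  shows "int (m x) \<le> z_degree T m"
proof -
  have "int (m x) \<le> (\<Sum>x\<in>upto_time T. int (m x))"
    using assms finite_upto_time by (intro member_le_sum) auto
  also have "\<dots> \<le> z_degree T m"
    unfolding z_degree_def
  proof (intro sum_mono, clarify)
    fix c j assume "(c, j) \<in> upto_time T"
    then have "1 \<le> int j" "1 \<le> height c" using height_pos by (auto simp: upto_time_iff)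
    then have "1 * 1 * int (m (c, j)) \<le> int j * height c * int (m (c, j))"
      by (intro mult_mono) auto
    then show "int (m (c, j)) \<le> int j * height c * int (m (c, j))" by simp
  qed
  finally show ?thesis .
qed

lemma yy_monomial:
  "(\<Prod>(c, j)\<in>upto_time T. (yy c ^ j) ^ m (c, j)) =
    fls_const (to_fract (Poly_Mapping.single (expo T m) 1)) * fls_X powi z_degree T m"
proof -
  have yp: "(yy c ^ j) ^ k = fls_const (\<Prod>b\<in>I. gen_var b powi (- (int j * cart b c * int k))) * fls_X powi (int j * height c * int k)" for c j k
  proof -
    have "(yy c ^ j) ^ k = yy c ^ (j * k)" by (simp only: power_mult)
    also have "\<dots> = fls_const ((\<Prod>b\<in>I. gen_var b powi (- cart b c)) ^ (j * k)) * (fls_X powi height c) ^ (j * k)"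
      unfolding yy_eq power_mult_distrib fls_const_power ..
    also have "(fls_X powi height c) ^ (j * k) = (fls_X powi (height c * int (j * k)) :: lau fract fls)"
      by (simp only: power_int_mult power_int_of_nat)
    also have "(\<Prod>b\<in>I. gen_var b powi (- cart b c)) ^ (j * k) = (\<Prod>b\<in>I. gen_var b powi (- cart b c * int (j * k)))"
      by (simp only: prod_power_distrib power_int_mult power_int_of_nat)
    finally show ?thesis by (simp only: mult_ac of_nat_mult mult_minus_left mult_minus_right)
  qed
  have sum_powi: "(\<Prod>x\<in>S. z powi (f x)) = z powi (sum f S)" if "z \<noteq> 0" for z :: "'z::field" and f and S :: "(nat \<times> nat) set"
    by (induction S rule: infinite_finite_induct) (simp_all add: power_int_add that)
  have const: "(\<Prod>x\<in>S. fls_const (f x)) = fls_const (\<Prod>x\<in>S. f x)" for f :: "nat \<times> nat \<Rightarrow> lau fract" and S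
    by (induction S rule: infinite_finite_induct) simp_all
  have X: "fls_X \<noteq> (0 :: lau fract fls)" by simp
  have "(\<Prod>(c, j)\<in>upto_time T. (yy c ^ j) ^ m (c, j)) =
      fls_const (\<Prod>x\<in>upto_time T. \<Prod>b\<in>I. gen_var b powi (- (int (snd x) * cart b (fst x) * int (m x))))
      * fls_X powi (\<Sum>x\<in>upto_time T. int (snd x) * height (fst x) * int (m x))"
    unfolding case_prod_beta yp prod.distrib const prod.collapse sum_powi[OF X] ..
  also have "(\<Prod>x\<in>upto_time T. \<Prod>b\<in>I. gen_var b powi (- (int (snd x) * cart b (fst x) * int (m x)))) =
      (\<Prod>b\<in>I. gen_var b powi (Poly_Mapping.lookup (expo T m) b))"
    by (subst prod.swap) (intro prod.cong refl, simp add: sum_powi lookup_expo sum_negf case_prod_beta)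
  also have "\<dots> = mono_at gen_var (expo T m)"
    by (rule mono_at_superset[symmetric]) (use finite_I in \<open>auto simp: in_keys_iff lookup_expo split: if_splits\<close>)
  finally show ?thesis
    unfolding mono_at_gen_var z_degree_def by (simp only: case_prod_unfold prod.collapse)
qed

text \<open>The sum is the coefficient of the monomial \<open>\<nu>\<close> in the product given by
  \<open>triangular_sum\<close>, which contains no power of \<open>x_a\<close> below
  \<open>- \<delta>\<close>.\<close>

theorem class_sum_zero:
  assumes a: "a \<in> I" and p: "p = T div d a"
    and b: "\<And>j. 1 \<le> j \<Longrightarrow> j \<le> p \<Longrightarrow>
      - b (a, j) - 1 = int ((\<Sum>i=1..p. n i * (i - j)) + \<mu> * (p - j) + \<kappa> * (Suc p - j))"
    and \<nu>: "Poly_Mapping.lookup \<nu> a < - int ((\<Sum>i=1..p. n i * i) + \<mu> * p + \<kappa> * Suc p)"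
  shows "(\<Sum>m | (\<forall>x. x \<notin> upto_time T \<longrightarrow> m x = 0) \<and> expo T m = \<nu>.
    \<Prod>x\<in>upto_time T. int_binom (m x) (b x + (\<Sum>y\<in>upto_time T. dep x y * int (m y)))) = 0"
proof -
  interpret pos: coeff_ring "pos_in a" by (rule coeff_ring_pos_in)
  let ?L = "upto_time T"
  define \<delta> where "\<delta> = int ((\<Sum>i=1..p. n i * i) + \<mu> * p + \<kappa> * Suc p)"
  \<comment> \<open>The only degree in \<open>X\<close> at which \<open>\<nu>\<close> can occur, and
    therefore a sufficient bound for the truncation.\<close>
  define D where "D = - (\<Sum>b\<in>I. w b * Poly_Mapping.lookup \<nu> b)"
  define N where "N = nat D"
  define B where "B m = (\<Prod>x\<in>?L. int_binom (m x) (b x + (\<Sum>y\<in>?L. dep x y * int (m y))))" for m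
  define R where "R = (\<Prod>x\<in>?L. F x powi (- b x - 1))"
  have cong: "cong_X N (\<Sum>m\<in>box ?L N. \<Prod>x\<in>?L. of_int (int_binom (m x) (b x + (\<Sum>y\<in>?L. dep x y * int (m y))))
       * (case x of (c, j) \<Rightarrow> yy c ^ j) ^ m x) R"
    unfolding R_def
  proof (rule triangular_sum[where time = "\<lambda>(c, j). d c * j"])
    show "finite ?L" by (rule finite_upto_time)
    show "(case x of (c, j) \<Rightarrow> d c * j) < (case y of (c, j) \<Rightarrow> d c * j)" if "dep x y \<noteq> 0" for x y
      using dep_time[of "fst x" "snd x" "fst y" "snd y"] that by (simp add: case_prod_beta)
    show "const_res (case x of (c, j) \<Rightarrow> yy c ^ j) 0" if "x \<in> ?L" for x
      using that const_res_yy_pow by (cases x) (auto simp: upto_time_iff)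
    show "F x = 1 - (case x of (c, j) \<Rightarrow> yy c ^ j) * (\<Prod>z\<in>?L. F z powi - dep z x)" if "x \<in> ?L" for x
      using that F_fixpoint by (cases x) auto
    show "const_res (F x) 1" if "x \<in> ?L" for x
      using that const_res_F by (cases x) (auto simp: upto_time_iff)
  qed
  have lhs: "(\<Sum>m\<in>box ?L N. \<Prod>x\<in>?L. of_int (int_binom (m x) (b x + (\<Sum>y\<in>?L. dep x y * int (m y))))
       * (case x of (c, j) \<Rightarrow> yy c ^ j) ^ m x) =
      (\<Sum>m\<in>box ?L N. of_int (B m) * (fls_const (to_fract (Poly_Mapping.single (expo T m) 1)) * fls_X powi z_degree T m))"
  proof (intro sum.cong refl)
    fix m
    have "(\<Prod>x\<in>?L. (case x of (c, j) \<Rightarrow> yy c ^ j) ^ m x) = (\<Prod>(c, j)\<in>?L. (yy c ^ j) ^ m (c, j))"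
      by (intro prod.cong) auto
    then show "(\<Prod>x\<in>?L. of_int (int_binom (m x) (b x + (\<Sum>y\<in>?L. dep x y * int (m y)))) * (case x of (c, j) \<Rightarrow> yy c ^ j) ^ m x) =
      of_int (B m) * (fls_const (to_fract (Poly_Mapping.single (expo T m) 1)) * fls_X powi z_degree T m)"
      unfolding prod.distrib B_def yy_monomial by simp
  qed
  define P where "P = (\<Sum>m\<in>box ?L N. if z_degree T m = D then Poly_Mapping.single (expo T m) (B m) else 0)"
  have "fls_nth (of_int (B m) * (fls_const (to_fract (Poly_Mapping.single (expo T m) 1)) * fls_X powi z_degree T m)) D
      = to_fract (if z_degree T m = D then Poly_Mapping.single (expo T m) (B m) else 0)" for m
  proof -
    have "of_int c * to_fract (Poly_Mapping.single (expo T m) 1) = (to_fract (Poly_Mapping.single (expo T m) c) :: lau fract)" for c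
      using ev_single[of gen_var "expo T m" c] by (simp add: mono_at_gen_var)
    then show ?thesis
      by (simp add: fls_of_int fls_X_intpow_times_conv_shift)
  qed
  moreover have "to_fract P = (\<Sum>m\<in>box ?L N. to_fract (if z_degree T m = D then Poly_Mapping.single (expo T m) (B m) else 0))"
    unfolding P_def by (induction "box ?L N" rule: infinite_finite_induct) simp_all
  moreover have "D \<le> int N" by (simp add: N_def)
  ultimately have "to_fract P = fls_nth R D"
    using cong_X_nth[OF cong, of D] unfolding lhs fls_nth_sum by simp
  obtain f where f: "f \<in> pos.fls_over" "R = xi a powi (- \<delta>) * f"
    using F_product_degree[OF a p, of "\<lambda>x. - b x - 1" n \<mu> \<kappa> \<delta>] b unfolding R_def \<delta>_def by blast
  have "fls_nth R D = gen_var a powi (- \<delta>) * fls_nth f (D - w a * \<delta>)"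
    unfolding f(2) xi_powi mult.assoc fls_X_power_int fls_X_intpow_times_conv_shift(1) by simp
  moreover have "fls_nth f (D - w a * \<delta>) \<in> pos_in a" using f(1) unfolding pos.fls_over_def by auto
  then obtain f' where f': "fls_nth f (D - w a * \<delta>) = to_fract f'" "\<And>e. e \<in> Poly_Mapping.keys f' \<Longrightarrow> 0 \<le> Poly_Mapping.lookup e a"
    unfolding pos_in_def by blast
  ultimately have "to_fract P = to_fract (Poly_Mapping.single (Poly_Mapping.single a (- \<delta>)) 1 * f')"
    using \<open>to_fract P = fls_nth R D\<close> by (simp add: gen_var_powi)
  then have P: "P = Poly_Mapping.single (Poly_Mapping.single a (- \<delta>)) 1 * f'" by (simp only: to_fract_eq_iff)
  have "\<nu> \<notin> Poly_Mapping.keys P"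
  proof
    assume "\<nu> \<in> Poly_Mapping.keys P"
    then obtain e where e: "e \<in> Poly_Mapping.keys f'" "\<nu> = Poly_Mapping.single a (- \<delta>) + e"
      using keys_mult[of "Poly_Mapping.single (Poly_Mapping.single a (- \<delta>)) 1" f'] unfolding P by auto
    have "Poly_Mapping.lookup \<nu> a < - \<delta>" using \<nu> unfolding \<delta>_def .
    then show False using f'(2)[OF e(1)] by (simp add: e(2) lookup_add)
  qed
  then have "0 = Poly_Mapping.lookup P \<nu>" by (simp add: in_keys_iff)
  also have "\<dots> = (\<Sum>m\<in>box ?L N. if z_degree T m = D \<and> expo T m = \<nu> then B m else 0)"
    unfolding P_def lookup_sum by (intro sum.cong) (auto simp: lookup_single when_def)
  also have "\<dots> = (\<Sum>m\<in>{m\<in>box ?L N. z_degree T m = D \<and> expo T m = \<nu>}. B m)"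
    using finite_box[OF finite_upto_time] by (simp add: sum.inter_filter)
  also have "{m\<in>box ?L N. z_degree T m = D \<and> expo T m = \<nu>} = {m. (\<forall>x. x \<notin> ?L \<longrightarrow> m x = 0) \<and> expo T m = \<nu>}"
  proof -
    have "z_degree T m = D" if "expo T m = \<nu>" for m
      using z_degree_expo[of T m] that by (simp add: D_def)
    moreover have "m x \<le> N" if "z_degree T m = D" "x \<in> ?L" for m x
      using le_z_degree[OF that(2), of m] that(1) unfolding N_def by linarith
    ultimately show ?thesis by (auto simp: box_def)
  qed
  finally show ?thesis unfolding B_def by simp
qed

end

section \<open>Application to the Lie types\<close>

definition chain_nb :: "lie_type \<Rightarrow> nat \<Rightarrow> nat set" where
  "chain_nb g a = {b. a \<in> {1..rank g} \<and> b \<in> {1..rank g} \<and> (a = Suc b \<or> b = Suc a)}"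

text \<open>The quotient of \<open>t g (gamma' g)\<close> by \<open>t g a\<close>; with it the last
  indices \<open>t g a * k\<close> of all nodes fall on the same time.\<close>

definition root_period :: "lie_type \<Rightarrow> nat \<Rightarrow> nat" where
  "root_period g a = (if short_root g a then 1 else t g (gamma' g))"

definition nodes :: "lie_type \<Rightarrow> nat set" where
  "nodes g = {1..rank g}"

lemma (in positive_q_system) cart_time_le:
  assumes "cart a b \<noteq> 0" "d a * j \<le> d b * i"
  shows "\<bar>cart b a\<bar> * int j \<le> \<bar>cart a b\<bar> * int i"
proof (cases "a = b")
  case True
  then show ?thesis using assms(2) d_pos[of b] by (simp add: cart_def)
next
  case False
  then have b1: "b \<in> nb a" using assms(1) by (simp add: cart_def split: if_splits)
  note b = b1 nb_sym[OF b1]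
  have "d b * (bond b a * j) = bond a b * (d a * j)"
    by (simp only: mult.assoc[symmetric] d_bond[OF b1, symmetric]) (simp only: mult_ac)
  also have "\<dots> \<le> bond a b * (d b * i)" using assms(2) by (rule mult_le_mono2)
  also have "\<dots> = d b * (bond a b * i)" by (simp only: mult_ac)
  finally have "bond b a * j \<le> bond a b * i" using d_pos[of b] by simp
  then have "int (bond b a * j) \<le> int (bond a b * i)" by (simp only: of_nat_le_iff)
  then show ?thesis using b False by (simp add: cart_def)
qed

locale lie_data =
  fixes g :: lie_type
  assumes adm: "admissible g"
begin

lemma t_pos: "0 < t g a"
  by (simp add: t_def)

lemma short_gamma': "short_root g (gamma' g)"
  using adm by (cases g) auto

lemma t_root_period: "root_period g a * t g a = t g (gamma' g)"
  using short_gamma' by (simp add: root_period_def t_def)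

sublocale graded_q_system "chain_nb g" "root_period g" "nodes g" "weight g"
proof
  show "finite (chain_nb g a)" for a
    by (rule finite_subset[of _ "{1..rank g}"]) (auto simp: chain_nb_def)
  show "0 < root_period g a" for a by (simp add: root_period_def t_pos)
qed (auto simp: chain_nb_def root_period_def nodes_def)

lemma cartan_eq_cart:
  assumes "a \<in> nodes g" "b \<in> nodes g"
  shows "cartan g a b = cart a b"
proof -
  define s where "s = int (t g (gamma' g))"
  have s: "1 \<le> s" using t_pos[of "gamma' g"] unfolding s_def by linarith
  consider "a = b" | "a = Suc b \<or> b = Suc a" | "a \<noteq> b" "\<not> (a = Suc b \<or> b = Suc a)" by blast
  then show ?thesis
  proof cases
    case 1
    then show ?thesis using s by (simp add: cartan_def root_ip_def sq_length_def cart_def flip: s_def)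
  next
    case 2
    then have b: "b \<in> chain_nb g a" "a \<noteq> b" using assms by (auto simp: chain_nb_def nodes_def)
    have div: "- (2 * s) div (2 * s) = - 1"
      using nonzero_mult_div_cancel_right[of "2 * s" "- 1"] s by simp
    show ?thesis
      using 2 b s div
      by (auto simp: cartan_def root_ip_def sq_length_def cart_def bond_def root_period_def max_def s_def[symmetric])
  next
    case 3
    then show ?thesis by (simp add: cartan_def root_ip_def cart_def chain_nb_def)
  qed
qed

sublocale positive_q_system "chain_nb g" "root_period g" "nodes g" "weight g"
proof
  fix a assume a: "a \<in> nodes g"
  have "height a = (\<Sum>b = 1..rank g. weight g b * cartan g b a)"
    unfolding height_def using a by (intro sum.cong) (simp_all add: cartan_eq_cart nodes_def)
  then show "1 \<le> height a" using weight_cartan[OF adm] a by (simp add: nodes_def)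
qed

lemma J_eq: "J g k = upto_time (t g (gamma' g) * k)"
proof -
  have "a \<in> nodes g \<and> 1 \<le> j \<and> j \<le> t g a * k \<longleftrightarrow> (a, j) \<in> upto_time (t g (gamma' g) * k)" for a j
    using d_pos[of a] by (auto simp: upto_time_iff mult.assoc simp flip: t_root_period[of a])
  then show ?thesis unfolding J_def nodes_def by auto
qed

text \<open>Index 0 gives \<open>q0\<close> and positive indices give \<open>q\<close>; truncation
  extends both sums to their full ranges.\<close>

definition qv :: "nat \<Rightarrow> (nat \<Rightarrow> nat) \<Rightarrow> (nat \<Rightarrow> nat \<Rightarrow> nat) \<Rightarrow> (nat \<times> nat \<Rightarrow> nat) \<Rightarrow> nat \<times> nat \<Rightarrow> int" where
  "qv k l n m x = int (l (fst x)) + (\<Sum>y\<in>J g k. dep x y * int (m y))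
     - (\<Sum>j=1..t g (fst x) * k. int (j - snd x) * int (n (fst x) j))"

lemma J_fst: "y \<in> J g k \<Longrightarrow> fst y \<in> nodes g"
  by (auto simp: J_def nodes_def)

lemma q_eq_qv:
  assumes a: "a \<in> nodes g"
  shows "q g k l n m a i = qv k l n m (a, i)"
proof -
  have "(\<Sum>(b, j)\<in>{(b, j)\<in>J g k. \<bar>cartan g a b\<bar> * int j > \<bar>cartan g b a\<bar> * int i}.
          sgn (cartan g a b) * (\<bar>cartan g a b\<bar> * int j - \<bar>cartan g b a\<bar> * int i) * int (m (b, j)))
      = (\<Sum>y\<in>{y\<in>J g k. \<bar>cartan g a (fst y)\<bar> * int (snd y) > \<bar>cartan g (fst y) a\<bar> * int i}. dep (a, i) y * int (m y))"
  proof (rule sum.cong)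
    fix y assume "y \<in> {y\<in>J g k. \<bar>cartan g a (fst y)\<bar> * int (snd y) > \<bar>cartan g (fst y) a\<bar> * int i}"
    then show "(case y of (b, j) \<Rightarrow> sgn (cartan g a b) * (\<bar>cartan g a b\<bar> * int j - \<bar>cartan g b a\<bar> * int i) * int (m (b, j)))
        = dep (a, i) y * int (m y)"
      using cartan_eq_cart[OF a, of "fst y"] cartan_eq_cart[OF _ a, of "fst y"] J_fst[of y k]
      by (cases y) (simp add: dep_def max_def)
  qed auto
  also have "\<dots> = (\<Sum>y\<in>J g k. dep (a, i) y * int (m y))"
  proof (rule sum.mono_neutral_left[OF finite_J])
    show "\<forall>y\<in>J g k - {y\<in>J g k. \<bar>cartan g a (fst y)\<bar> * int (snd y) > \<bar>cartan g (fst y) a\<bar> * int i}. dep (a, i) y * int (m y) = 0"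
    proof
      fix y assume y: "y \<in> J g k - {y\<in>J g k. \<bar>cartan g a (fst y)\<bar> * int (snd y) > \<bar>cartan g (fst y) a\<bar> * int i}"
      then show "dep (a, i) y * int (m y) = 0"
        using cartan_eq_cart[OF a, of "fst y"] cartan_eq_cart[OF _ a, of "fst y"] J_fst[of y k]
        by (auto simp: dep_def max_def)
    qed
  qed auto
  finally have 1: "(\<Sum>(b, j)\<in>{(b, j)\<in>J g k. \<bar>cartan g a b\<bar> * int j > \<bar>cartan g b a\<bar> * int i}.
          sgn (cartan g a b) * (\<bar>cartan g a b\<bar> * int j - \<bar>cartan g b a\<bar> * int i) * int (m (b, j)))
      = (\<Sum>y\<in>J g k. dep (a, i) y * int (m y))" .
  have "(\<Sum>j = i + 1..t g a * k. (int j - int i) * int (n a j)) = (\<Sum>j = i + 1..t g a * k. int (j - i) * int (n a j))"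
    by (intro sum.cong) (auto simp: of_nat_diff)
  also have "\<dots> = (\<Sum>j = 1..t g a * k. int (j - i) * int (n a j))"
    by (rule sum.mono_neutral_left) auto
  finally show ?thesis unfolding q_def qv_def 1 by simp
qed

lemma q0_eq_qv:
  assumes a: "a \<in> nodes g"
  shows "q0 g k l n m a = qv k l n m (a, 0)"
proof -
  have "(\<Sum>(b, j)\<in>J g k. int j * cartan g a b * int (m (b, j))) = (\<Sum>y\<in>J g k. dep (a, 0) y * int (m y))"
  proof (rule sum.cong)
    fix y assume y: "y \<in> J g k"
    show "(case y of (b, j) \<Rightarrow> int j * cartan g a b * int (m (b, j))) = dep (a, 0) y * int (m y)"
      using cartan_eq_cart[OF a J_fst[OF y]]
      by (cases y) (simp add: dep_def sgn_mult_abs mult.assoc[symmetric] max_def)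
  qed simp
  then show ?thesis unfolding q0_def qv_def by simp
qed

end

section \<open>Evaluation of the remaining variables at 1\<close>

lemma eval_one_sum: "eval_laurent (\<lambda>_. 1) (sum f M) = (\<Sum>m\<in>M. eval_laurent (\<lambda>_. 1) (f m))"
proof -
  have add: "eval_laurent (\<lambda>_. 1) (p + r) = eval_laurent (\<lambda>_. 1) p + eval_laurent (\<lambda>_. 1) r" for p r
  proof -
    have sup: "eval_laurent (\<lambda>_. 1) p = (\<Sum>e\<in>S. Poly_Mapping.lookup p e)"
      if "finite S" "Poly_Mapping.keys p \<subseteq> S" for p S
      unfolding eval_laurent_def power_int_1_left prod.neutral_const mult_1_right
      by (rule sum.mono_neutral_left) (use that in \<open>auto simp: in_keys_iff\<close>)
    let ?S = "Poly_Mapping.keys p \<union> Poly_Mapping.keys r"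
    show ?thesis
      using Poly_Mapping.keys_add[of p r]
      by (simp add: sup[of ?S] lookup_add sum.distrib)
  qed
  show ?thesis
    by (induction M rule: infinite_finite_induct) (simp_all add: add, simp_all add: eval_laurent_def)
qed

lemma eval_one_single: "eval_laurent (\<lambda>_. 1) (Poly_Mapping.single e c) = c"
  by (cases "c = 0") (simp_all add: eval_laurent_def)

text \<open>Each summand is a scalar times a single Laurent monomial, whose value at 1 is 1.\<close>

lemma eval_one_summand:
  "eval_laurent (\<lambda>_. 1) (summand g k l n m) =
    (\<Prod>a=1..rank g. \<Prod>i=1..t g a * k. binom (m (a, i)) (q g k l n m a i))"
proof -
  define one_mono where "one_mono c p \<longleftrightarrow> (\<exists>e. p = Poly_Mapping.single e c)" for c :: rat and p :: laurent_poly
  have mult: "one_mono (c * c') (p * p')" if "one_mono c p" "one_mono c' p'" for c c' p p'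
    using that unfolding one_mono_def by (auto simp: mult_single)
  have prod: "one_mono (prod c S) (prod p S)" if "\<And>i. i \<in> S \<Longrightarrow> one_mono (c i) (p i)" for c p and S :: "nat set"
    using that
  proof (induction S rule: infinite_finite_induct)
    case (insert x S)
    then show ?case by (simp add: mult)
  qed (auto simp: one_mono_def intro: exI[of _ 0])
  have factor: "one_mono c (var_power v e * var_power v' e' * const c)" for v e v' e' c
    using mult[OF mult[of 1 "var_power v e" 1 "var_power v' e'"], of c "const c"]
    unfolding one_mono_def var_power_def const_def by (auto simp: mult_single)
  have "one_mono (\<Prod>a=1..rank g. \<Prod>i=1..t g a * k. binom (m (a, i)) (q g k l n m a i)) (summand g k l n m)"
    unfolding summand_def by (intro prod factor)
  then show ?thesis unfolding one_mono_def using eval_one_single by auto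
qed

context lie_data begin

definition term_at :: "nat \<Rightarrow> (nat \<Rightarrow> nat) \<Rightarrow> (nat \<Rightarrow> nat \<Rightarrow> nat) \<Rightarrow> (nat \<times> nat \<Rightarrow> nat) \<Rightarrow> rat" where
  "term_at k l n m = (\<Prod>x\<in>J g k. binom (m x) (qv k l n m x))"

lemma eval_summand: "eval_laurent (\<lambda>_. 1) (summand g k l n m) = term_at k l n m"
proof -
  have "J g k = Sigma {1..rank g} (\<lambda>a. {1..t g a * k})" by (auto simp: J_def)
  then have "term_at k l n m = (\<Prod>a=1..rank g. \<Prod>i=1..t g a * k. binom (m (a, i)) (qv k l n m (a, i)))"
    unfolding term_at_def by (simp add: prod.Sigma case_prod_beta)
  also have "\<dots> = (\<Prod>a=1..rank g. \<Prod>i=1..t g a * k. binom (m (a, i)) (q g k l n m a i))"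
    by (intro prod.cong refl) (simp add: q_eq_qv nodes_def)
  finally show ?thesis unfolding eval_one_summand ..
qed

section \<open>Families with a negative q\<close>

abbreviation "time x \<equiv> root_period g (fst x) * snd x"

lemma dep_eq_0: "time y \<le> time x \<Longrightarrow> dep x y = 0"
  using dep_time[of "fst x" "snd x" "fst y" "snd y"] by fastforce

lemma qv_cong:
  assumes "\<And>y. y \<in> J g k \<Longrightarrow> time x < time y \<Longrightarrow> m y = m' y"
  shows "qv k l n m x = qv k l n m' x"
proof -
  have "(\<Sum>y\<in>J g k. dep x y * int (m y)) = (\<Sum>y\<in>J g k. dep x y * int (m' y))"
  proof (intro sum.cong refl)
    fix y assume "y \<in> J g k"
    then show "dep x y * int (m y) = dep x y * int (m' y)"
      using assms[of y] dep_eq_0[of y x] by (cases "time x < time y") auto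
  qed
  then show ?thesis by (simp add: qv_def)
qed

lemma qv_add: "qv k l n (\<lambda>x. m x + m0 x) x = qv k l n m x + (\<Sum>y\<in>J g k. dep x y * int (m0 y))"
  by (simp add: qv_def algebra_simps sum.distrib)

text \<open>With only the later variables \<open>m\<close> present, \<open>j \<mapsto> q\<^sub>a\<^sub>,\<^sub>j\<close> is affine on \<open>[0, p]\<close> up to the contribution
  of the \<open>n\<^sub>a\<^sub>,\<^sub>i\<close> with \<open>i \<le> p\<close>, and it bends the right way at \<open>p + 1\<close>.\<close>

lemma qv_profile:
  assumes a: "a \<in> nodes g" and p: "p \<le> t g a * k"
    and later: "\<And>y. y \<in> J g k \<Longrightarrow> m y \<noteq> 0 \<Longrightarrow> root_period g a * p < time y"
    and neg: "qv k l n m (a, p) < 0" and next_nonneg: "0 \<le> qv k l n m (a, Suc p)"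
  obtains \<mu> \<kappa> where "\<And>j. j \<le> p \<Longrightarrow> - qv k l n m (a, j) - 1 =
      int ((\<Sum>i=1..p. n a i * (i - j)) + \<mu> * (p - j) + \<kappa> * (Suc p - j))"
proof -
  define lin where "lin j y = sgn (cart a (fst y)) * (\<bar>cart a (fst y)\<bar> * int (snd y) - \<bar>cart (fst y) a\<bar> * int j)" for j and y :: "nat \<times> nat"
  define SA SB NA NB where "SA = (\<Sum>y\<in>J g k. lin 0 y * int (m y))"
    and "SB = (\<Sum>y\<in>J g k. sgn (cart a (fst y)) * \<bar>cart (fst y) a\<bar> * int (m y))"
    and "NA = (\<Sum>i=Suc p..t g a * k. int i * int (n a i))" and "NB = (\<Sum>i=Suc p..t g a * k. int (n a i))"
  define c0 c1 where "c0 = - 1 - int (l a) - SA + NA" and "c1 = SB - NB"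
  have lin: "(\<Sum>y\<in>J g k. lin j y * int (m y)) = SA - int j * SB" for j
    by (simp add: SA_def SB_def lin_def sum_distrib_left algebra_simps flip: sum_subtractf)
  have dep_lin: "dep (a, j) y * int (m y) = lin j y * int (m y)" if "y \<in> J g k" "j \<le> p" for y j
  proof (cases "m y = 0")
    case False
    then have lt: "root_period g a * p < time y" using later that by blast
    have "dep (a, j) y = lin j y"
    proof (cases "cart a (fst y) = 0")
      case True
      then show ?thesis by (simp add: dep_def lin_def)
    next
      case False
      have "root_period g a * j \<le> root_period g (fst y) * snd y"
        using lt that(2) d_pos[of a] by (meson le_trans less_imp_le mult_le_mono2)
      from cart_time_le[OF False this]
      show ?thesis by (simp add: dep_def lin_def)
    qed
    then show ?thesis by simp
  qed simp
  \<comment> \<open>Up to \<open>p\<close> no truncation occurs, since all present variables are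
    later than \<open>(a, p)\<close>. At \<open>Suc p\<close> it can only affect neighbours, whose
    Cartan entries are negative, so the affine continuation bounds \<open>q\<close> from
    above.\<close>
  have ub: "dep (a, Suc p) y * int (m y) \<le> lin (Suc p) y * int (m y)" if "y \<in> J g k" for y
  proof (cases "m y = 0")
    case False
    then have lt: "root_period g a * p < time y" using later that by blast
    have "dep (a, Suc p) y \<le> lin (Suc p) y"
    proof (cases "fst y = a")
      case True
      then have "Suc p \<le> snd y" using lt by simp
      then show ?thesis using True by (simp add: dep_def lin_def cart_def)
    next
      case False
      then have "sgn (cart a (fst y)) = 0 \<or> sgn (cart a (fst y)) = - 1" by (auto simp: cart_def sgn_if)
      then show ?thesis by (auto simp: dep_def lin_def)
    qed
    then show ?thesis by (intro mult_right_mono) auto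
  qed simp
  have split: "(\<Sum>i=1..t g a * k. h i) = (\<Sum>i=1..p. h i) + (\<Sum>i=Suc p..t g a * k. h i)" for h :: "nat \<Rightarrow> int"
  proof -
    have "{1..t g a * k} = {1..p} \<union> {Suc p..t g a * k}" using p by auto
    then show ?thesis by (simp add: sum.union_disjoint)
  qed
  have tail: "(\<Sum>i=Suc p..t g a * k. int (i - j) * int (n a i)) =
      NA - int j * NB" if "j \<le> Suc p" for j
  proof -
    have "(\<Sum>i=Suc p..t g a * k. int (i - j) * int (n a i)) = (\<Sum>i=Suc p..t g a * k. int i * int (n a i) - int j * int (n a i))"
      using that by (intro sum.cong refl) (auto simp: of_nat_diff left_diff_distrib)
    then show ?thesis by (simp add: NA_def NB_def sum_subtractf sum_distrib_left)
  qed
  have profile: "- qv k l n m (a, j) - 1 = c0 + int j * c1 + (\<Sum>i=1..p. int (i - j) * int (n a i))" if "j \<le> p" for j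
  proof -
    have "(\<Sum>y\<in>J g k. dep (a, j) y * int (m y)) = (\<Sum>y\<in>J g k. lin j y * int (m y))"
      using dep_lin that by (intro sum.cong refl) auto
    then have "qv k l n m (a, j) = int (l a) + (SA - int j * SB)
        - ((\<Sum>i=1..p. int (i - j) * int (n a i)) + (NA - int j * NB))"
      unfolding qv_def fst_conv snd_conv split lin using tail[of j] that by simp
    then show ?thesis by (simp add: c0_def c1_def algebra_simps)
  qed
  have "c0 + int (Suc p) * c1 \<le> - qv k l n m (a, Suc p) - 1"
  proof -
    have "(\<Sum>y\<in>J g k. dep (a, Suc p) y * int (m y)) \<le> (\<Sum>y\<in>J g k. lin (Suc p) y * int (m y))"
      by (rule sum_mono) (rule ub)
    moreover have "(\<Sum>i=1..p. int (i - Suc p) * int (n a i)) = 0" by (intro sum.neutral) auto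
    ultimately have "qv k l n m (a, Suc p) \<le> int (l a) + (SA - int (Suc p) * SB) - (NA - int (Suc p) * NB)"
      unfolding qv_def fst_conv snd_conv split lin using tail[of "Suc p"] by simp
    then show ?thesis by (simp add: c0_def c1_def algebra_simps)
  qed
  then have \<mu>: "0 \<le> - (c0 + int (Suc p) * c1)" using next_nonneg by linarith
  have "(\<Sum>i=1..p. int (i - p) * int (n a i)) = 0" by (intro sum.neutral) auto
  then have \<kappa>: "0 \<le> c0 + int p * c1" using profile[of p] neg by simp
  \<comment> \<open>The affine part \<open>c0 + int j * c1\<close> is written through its values at
    \<open>p\<close> and \<open>Suc p\<close>; these are \<open>\<ge> 0\<close> and
    \<open>\<le> 0\<close> and give \<open>\<kappa>\<close> and, with opposite sign,
    \<open>\<mu>\<close>.\<close>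
  have "- qv k l n m (a, j) - 1 =
      int ((\<Sum>i=1..p. n a i * (i - j)) + nat (- (c0 + int (Suc p) * c1)) * (p - j) + nat (c0 + int p * c1) * (Suc p - j))"
    if j: "j \<le> p" for j
  proof -
    have "int (nat (- (c0 + int (Suc p) * c1)) * (p - j) + nat (c0 + int p * c1) * (Suc p - j)) =
        - (c0 + int (Suc p) * c1) * (int p - int j) + (c0 + int p * c1) * (int (Suc p) - int j)"
      unfolding of_nat_add of_nat_mult nat_0_le[OF \<mu>] nat_0_le[OF \<kappa>] using j by (simp add: of_nat_diff)
    also have "\<dots> = c0 + int j * c1" by (simp add: algebra_simps)
    finally show ?thesis using profile[OF j] by (simp add: mult.commute)
  qed
  then show thesis by (rule that)
qed

lemma upto_time_J:
  assumes "T \<le> t g (gamma' g) * k"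
  shows "upto_time T = {x \<in> J g k. time x \<le> T}"
  using assms unfolding J_eq by (auto simp: upto_time_iff)

lemma lookup_u_exponent_nodes:
  "Poly_Mapping.lookup (u_exponent g k l n m) b = (if b \<in> nodes g then qv k l n m (b, 0) else 0)"
proof (cases "b \<in> nodes g")
  case True
  then show ?thesis using lookup_u_exponent[of b g k l n m] q0_eq_qv[OF True] by (simp add: nodes_def)
next
  case False
  then show ?thesis
    by (auto simp: u_exponent_def lookup_sum lookup_single when_def nodes_def intro!: sum.neutral)
qed

lemma u_exponent_eq_iff:
  assumes "\<And>b. b \<notin> nodes g \<Longrightarrow> Poly_Mapping.lookup e b = 0"
  shows "u_exponent g k l n m = e \<longleftrightarrow> (\<forall>b\<in>nodes g. qv k l n m (b, 0) = Poly_Mapping.lookup e b)"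
  using assms by (auto simp: poly_mapping_eq_iff fun_eq_iff lookup_u_exponent_nodes)

text \<open>The later variables act as constants: they shift every \<open>q\<close> and contribute a
  common factor, while the others run freely, as in \<open>class_sum_zero\<close>.\<close>

lemma class_term_sum_zero:
  assumes ap: "(a, p) \<in> J g k" and neg: "qv k l n m1 (a, p) < 0"
    and T: "T = root_period g a * p"
    and later: "\<And>x. x \<in> J g k \<Longrightarrow> T < time x \<Longrightarrow> 0 \<le> qv k l n m1 x"
    and e: "\<And>b. b \<notin> nodes g \<Longrightarrow> Poly_Mapping.lookup e b = 0" "0 \<le> Poly_Mapping.lookup e a"
  shows "(\<Sum>m | m \<in> families g k \<and> u_exponent g k l n m = e \<and> (\<forall>x\<in>J g k. T < time x \<longrightarrow> m x = m1 x).
    term_at k l n m) = 0"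
proof -
  have a: "a \<in> nodes g" "1 \<le> p" "p \<le> t g a * k" using ap by (auto simp: J_def nodes_def)
  have TJ: "T \<le> t g (gamma' g) * k"
    using a(3) unfolding T t_root_period[of a, symmetric] by (simp add: mult.assoc)
  define L where "L = upto_time T"
  have L: "L = {x \<in> J g k. time x \<le> T}" unfolding L_def by (rule upto_time_J[OF TJ])
  define m' where "m' x = (if x \<in> J g k \<and> T < time x then m1 x else 0)" for x
  have qv': "qv k l n m' x = qv k l n m1 x" if "T \<le> time x" for x
    using that by (intro qv_cong) (auto simp: m'_def)
  have neg': "qv k l n m' (a, p) < 0" using qv'[of "(a, p)"] neg T by simp
  have next': "0 \<le> qv k l n m' (a, Suc p)"
  proof (cases "Suc p \<le> t g a * k")
    case True
    then have "(a, Suc p) \<in> J g k" using a by (auto simp: J_def nodes_def)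
    moreover have "T < time (a, Suc p)" using T d_pos[of a] by simp
    ultimately show ?thesis using later[of "(a, Suc p)"] qv'[of "(a, Suc p)"] by simp
  next
    case False
    \<comment> \<open>If \<open>p\<close> is the last index at \<open>a\<close>, no variable is
      later, and \<open>q\<close> at \<open>Suc p\<close> is \<open>l a\<close>, non-negative
      because the weight is dominant.\<close>
    then have "p = t g a * k" using a(3) by simp
    then have "T = t g (gamma' g) * k" unfolding T t_root_period[of a, symmetric] by (simp add: mult.assoc)
    then have "J g k = L" unfolding L_def J_eq by simp
    then have "\<forall>x\<in>J g k. time x \<le> T" using L by blast
    then have "m' x = 0" for x by (auto simp: m'_def not_less)
    moreover have "(\<Sum>j=1..t g a * k. int (j - Suc p) * int (n a j)) = 0"
      using False by (intro sum.neutral) auto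
    ultimately show ?thesis by (simp add: qv_def)
  qed
  have supp: "root_period g a * p < time y" if "y \<in> J g k" "m' y \<noteq> 0" for y
    using that T by (auto simp: m'_def split: if_splits)
  obtain \<mu> \<kappa> where profile: "\<And>j. j \<le> p \<Longrightarrow> - qv k l n m' (a, j) - 1 =
      int ((\<Sum>i=1..p. n a i * (i - j)) + \<mu> * (p - j) + \<kappa> * (Suc p - j))"
    using qv_profile[OF a(1,3) supp neg' next'] by blast
  define \<nu> where "\<nu> = (\<Sum>b\<in>nodes g. Poly_Mapping.single b (qv k l n m' (b, 0) - Poly_Mapping.lookup e b))"
  have finite_nodes: "finite (nodes g)" by (simp add: nodes_def)
  have lookup_\<nu>: "Poly_Mapping.lookup \<nu> b = (if b \<in> nodes g then qv k l n m' (b, 0) - Poly_Mapping.lookup e b else 0)" for b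
    using finite_nodes by (simp add: \<nu>_def lookup_sum lookup_single when_def if_distrib cong: if_cong)
  define M0 where "M0 = {m0. (\<forall>x. x \<notin> L \<longrightarrow> m0 x = 0) \<and> expo T m0 = \<nu>}"
  have sumL: "(\<Sum>y\<in>J g k. dep x y * int (m0 y)) = (\<Sum>y\<in>L. dep x y * int (m0 y))" if "\<forall>x. x \<notin> L \<longrightarrow> m0 x = 0" for m0 x
    by (rule sum.mono_neutral_right[OF finite_J]) (use that L in auto)
  have expo0: "qv k l n (\<lambda>x. m' x + m0 x) (b, 0) = qv k l n m' (b, 0) - Poly_Mapping.lookup (expo T m0) b"
    if m0: "\<forall>x. x \<notin> L \<longrightarrow> m0 x = 0" and b: "b \<in> nodes g" for m0 b
  proof -
    have "(\<Sum>y\<in>L. dep (b, 0) y * int (m0 y)) = (\<Sum>(c, j)\<in>L. int j * cart b c * int (m0 (c, j)))"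
      by (intro sum.cong refl) (auto simp: dep_def sgn_mult_abs mult.assoc[symmetric] max_def)
    then show ?thesis using b unfolding qv_add sumL[OF m0] by (simp add: lookup_expo L_def)
  qed
  have exp_iff: "u_exponent g k l n (\<lambda>x. m' x + m0 x) = e \<longleftrightarrow> expo T m0 = \<nu>" if m0: "\<forall>x. x \<notin> L \<longrightarrow> m0 x = 0" for m0
  proof -
    have "u_exponent g k l n (\<lambda>x. m' x + m0 x) = e \<longleftrightarrow>
        (\<forall>b\<in>nodes g. qv k l n m' (b, 0) - Poly_Mapping.lookup (expo T m0) b = Poly_Mapping.lookup e b)"
      using u_exponent_eq_iff[of e k l n "\<lambda>x. m' x + m0 x"] e(1) expo0[OF m0] by simp
    also have "\<dots> \<longleftrightarrow> expo T m0 = \<nu>"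
      by (auto simp: poly_mapping_eq_iff fun_eq_iff lookup_\<nu> lookup_expo)
    finally show ?thesis .
  qed
  define c where "c = (\<Prod>x\<in>J g k - L. binom (m' x) (qv k l n m' x))"
  have term_eq: "term_at k l n (\<lambda>x. m' x + m0 x) =
      c * of_int (\<Prod>x\<in>L. int_binom (m0 x) (qv k l n m' x + (\<Sum>y\<in>L. dep x y * int (m0 y))))"
    if m0: "\<forall>x. x \<notin> L \<longrightarrow> m0 x = 0" for m0
  proof -
    have "term_at k l n (\<lambda>x. m' x + m0 x) =
        (\<Prod>x\<in>J g k - L. binom (m' x + m0 x) (qv k l n (\<lambda>x. m' x + m0 x) x)) *
        (\<Prod>x\<in>L. binom (m' x + m0 x) (qv k l n (\<lambda>x. m' x + m0 x) x))"
      unfolding term_at_def by (rule prod.subset_diff) (use L finite_J in auto)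
    also have "(\<Prod>x\<in>J g k - L. binom (m' x + m0 x) (qv k l n (\<lambda>x. m' x + m0 x) x)) = c"
      unfolding c_def
    proof (intro prod.cong refl)
      fix x assume x: "x \<in> J g k - L"
      have "qv k l n (\<lambda>x. m' x + m0 x) x = qv k l n m' x"
        using x L m0 by (intro qv_cong) auto
      moreover have "m0 x = 0" using x m0 by blast
      ultimately show "binom (m' x + m0 x) (qv k l n (\<lambda>x. m' x + m0 x) x) = binom (m' x) (qv k l n m' x)"
        by simp
    qed
    also have "(\<Prod>x\<in>L. binom (m' x + m0 x) (qv k l n (\<lambda>x. m' x + m0 x) x)) =
        of_int (\<Prod>x\<in>L. int_binom (m0 x) (qv k l n m' x + (\<Sum>y\<in>L. dep x y * int (m0 y))))"
      unfolding of_int_prod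
    proof (intro prod.cong refl)
      fix x assume "x \<in> L"
      then have "m' x = 0" using L by (auto simp: m'_def)
      then show "binom (m' x + m0 x) (qv k l n (\<lambda>x. m' x + m0 x) x) =
          of_int (int_binom (m0 x) (qv k l n m' x + (\<Sum>y\<in>L. dep x y * int (m0 y))))"
        unfolding qv_add sumL[OF m0] by (simp add: binom_eq_int_binom)
    qed
    finally show ?thesis .
  qed
  have "(\<Sum>m | m \<in> families g k \<and> u_exponent g k l n m = e \<and> (\<forall>x\<in>J g k. T < time x \<longrightarrow> m x = m1 x). term_at k l n m)
      = (\<Sum>m0\<in>M0. term_at k l n (\<lambda>x. m' x + m0 x))"
  proof (rule sum.reindex_bij_witness[where i = "\<lambda>m0 x. m' x + m0 x" and j = "\<lambda>m x. if x \<in> L then m x else 0"])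
    fix m assume "m \<in> {m. m \<in> families g k \<and> u_exponent g k l n m = e \<and> (\<forall>x\<in>J g k. T < time x \<longrightarrow> m x = m1 x)}"
    then have m: "m \<in> families g k" "u_exponent g k l n m = e" "\<And>x. x \<in> J g k \<Longrightarrow> T < time x \<Longrightarrow> m x = m1 x"
      by auto
    show eq: "(\<lambda>x. m' x + (if x \<in> L then m x else 0)) = m"
    proof
      fix x
      have "m x = 0" if "x \<notin> J g k" using m(1) that unfolding families_def by blast
      moreover have "m x = m1 x" if "x \<in> J g k" "T < time x" using m(3) that by blast
      ultimately show "m' x + (if x \<in> L then m x else 0) = m x"
        unfolding L m'_def by (cases "x \<in> J g k"; cases "T < time x") simp_all
    qed
    show "(\<lambda>x. if x \<in> L then m x else 0) \<in> M0"
      using exp_iff[of "\<lambda>x. if x \<in> L then m x else 0"] m(2) unfolding M0_def eq by simp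
    show "term_at k l n (\<lambda>x. m' x + (if x \<in> L then m x else 0)) = term_at k l n m" unfolding eq ..
  next
    fix m0 assume "m0 \<in> M0"
    then have m0: "\<forall>x. x \<notin> L \<longrightarrow> m0 x = 0" "expo T m0 = \<nu>" by (auto simp: M0_def)
    show "(\<lambda>x. if x \<in> L then m' x + m0 x else 0) = m0"
      using m0 L by (auto simp: m'_def fun_eq_iff)
    have "(\<lambda>x. m' x + m0 x) \<in> families g k"
      using m0 L by (auto simp: families_def m'_def)
    moreover have "u_exponent g k l n (\<lambda>x. m' x + m0 x) = e" using exp_iff[OF m0(1)] m0(2) by simp
    moreover have "m' x + m0 x = m1 x" if "x \<in> J g k" "T < time x" for x
    proof -
      have "x \<notin> L" using that unfolding L by simp
      then have "m0 x = 0" using m0(1) by blast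
      then show ?thesis using that by (simp add: m'_def)
    qed
    ultimately show "(\<lambda>x. m' x + m0 x) \<in> {m. m \<in> families g k \<and> u_exponent g k l n m = e \<and> (\<forall>x\<in>J g k. T < time x \<longrightarrow> m x = m1 x)}"
      by blast
  qed
  also have "\<dots> = c * of_int (\<Sum>m0\<in>M0. \<Prod>x\<in>L. int_binom (m0 x) (qv k l n m' x + (\<Sum>y\<in>L. dep x y * int (m0 y))))"
    unfolding of_int_sum sum_distrib_left by (intro sum.cong refl term_eq) (auto simp: M0_def)
  also have "(\<Sum>m0\<in>M0. \<Prod>x\<in>L. int_binom (m0 x) (qv k l n m' x + (\<Sum>y\<in>L. dep x y * int (m0 y)))) = 0"
    unfolding M0_def L_def
  proof (rule class_sum_zero[OF a(1)])
    show "p = T div root_period g a" using T d_pos[of a] by simp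
    show "- qv k l n m' (a, j) - 1 = int ((\<Sum>i=1..p. n a i * (i - j)) + \<mu> * (p - j) + \<kappa> * (Suc p - j))"
      if "1 \<le> j" "j \<le> p" for j using profile that by blast
    \<comment> \<open>At \<open>j = 0\<close> the profile gives
      \<open>\<delta> = - qv k l n m' (a, 0) - 1\<close>. A non-negative exponent of
      \<open>u_a\<close> then needs a power of \<open>x_a\<close> strictly below
      \<open>- \<delta>\<close>.\<close>
    show "Poly_Mapping.lookup \<nu> a < - int ((\<Sum>i=1..p. n a i * i) + \<mu> * p + \<kappa> * Suc p)"
      using profile[of 0] e(2) a(1) by (simp add: lookup_\<nu>)
  qed
  finally show ?thesis by simp
qed

text \<open>The \<open>q\<close> at times from \<open>last m\<close> on depend only on variables
  after \<open>last m\<close>. So whether this is the last time with a negative \<open>q\<close> can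
  be read off those variables, the earlier ones are unrestricted, and each fibre of
  \<open>key\<close> is one of the classes that sum to 0.\<close>

lemma bad_term_sum_zero:
  assumes e: "\<And>b. b \<in> nodes g \<Longrightarrow> 0 \<le> Poly_Mapping.lookup e b"
  shows "(\<Sum>m | m \<in> families g k \<and> u_exponent g k l n m = e \<and> (\<exists>x\<in>J g k. qv k l n m x < 0). term_at k l n m) = 0"
proof -
  define Bad where "Bad = {m. m \<in> families g k \<and> u_exponent g k l n m = e \<and> (\<exists>x\<in>J g k. qv k l n m x < 0)}"
  define last where "last m = Max (time ` {x\<in>J g k. qv k l n m x < 0})" for m
  define key where "key m = (last m, \<lambda>x. if x \<in> J g k \<and> last m < time x then m x else 0)" for m
  have finite_Bad: "finite Bad"
    by (rule finite_subset[OF _ finite_u_exponent[OF adm, of k l n e]]) (auto simp: Bad_def)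
  have last_in: "\<exists>x\<in>J g k. qv k l n m x < 0 \<and> time x = last m" if "\<exists>x\<in>J g k. qv k l n m x < 0" for m
  proof -
    have "last m \<in> time ` {x\<in>J g k. qv k l n m x < 0}"
      unfolding last_def using that finite_J by (intro Max_in) auto
    then show ?thesis by auto
  qed
  have last_ge: "time x \<le> last m" if "x \<in> J g k" "qv k l n m x < 0" for m x
    unfolding last_def using that finite_J by (intro Max_ge) auto
  have "(\<Sum>m\<in>{m\<in>Bad. key m = key m1}. term_at k l n m) = 0" if m1: "m1 \<in> Bad" for m1
  proof -
    obtain a p where ap: "(a, p) \<in> J g k" "qv k l n m1 (a, p) < 0" "root_period g a * p = last m1"
      using last_in[of m1] m1 unfolding Bad_def by fastforce
    have e0: "Poly_Mapping.lookup e b = 0" if "b \<notin> nodes g" for b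
      using m1 that lookup_u_exponent_nodes[of k l n m1 b] by (auto simp: Bad_def)
    have "{m\<in>Bad. key m = key m1} =
        {m. m \<in> families g k \<and> u_exponent g k l n m = e \<and> (\<forall>x\<in>J g k. last m1 < time x \<longrightarrow> m x = m1 x)}"
    proof (intro equalityI subsetI)
      fix m assume "m \<in> {m\<in>Bad. key m = key m1}"
      then have m: "m \<in> Bad" "last m = last m1"
        "(\<lambda>x. if x \<in> J g k \<and> last m < time x then m x else 0) = (\<lambda>x. if x \<in> J g k \<and> last m1 < time x then m1 x else 0)"
        by (auto simp: key_def)
      have "m x = m1 x" if "x \<in> J g k" "last m1 < time x" for x
        using fun_cong[OF m(3), of x] m(2) that by simp
      then show "m \<in> {m. m \<in> families g k \<and> u_exponent g k l n m = e \<and> (\<forall>x\<in>J g k. last m1 < time x \<longrightarrow> m x = m1 x)}"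
        using m(1) by (auto simp: Bad_def)
    next
      fix m assume "m \<in> {m. m \<in> families g k \<and> u_exponent g k l n m = e \<and> (\<forall>x\<in>J g k. last m1 < time x \<longrightarrow> m x = m1 x)}"
      then have m: "m \<in> families g k" "u_exponent g k l n m = e" "\<And>x. x \<in> J g k \<Longrightarrow> last m1 < time x \<Longrightarrow> m x = m1 x"
        by auto
      have qv: "qv k l n m x = qv k l n m1 x" if "last m1 \<le> time x" for x
        using that m(3) by (intro qv_cong) auto
      have neg: "qv k l n m (a, p) < 0" using qv[of "(a, p)"] ap by simp
      have bad: "m \<in> Bad" using m ap(1) neg unfolding Bad_def by blast
      obtain y where y: "y \<in> J g k" "qv k l n m y < 0" "time y = last m"
        using last_in[of m] bad unfolding Bad_def by blast
      have "last m1 \<le> last m" using last_ge[OF ap(1) neg] ap(3) by simp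
      moreover have "last m \<le> last m1"
      proof (rule ccontr)
        assume "\<not> last m \<le> last m1"
        then have "qv k l n m1 y < 0" using qv[of y] y by simp
        then show False using last_ge[OF y(1)] y(3) \<open>\<not> last m \<le> last m1\<close> by simp
      qed
      ultimately have "last m = last m1" by simp
      then have "key m = key m1" using m(3) by (auto simp: key_def fun_eq_iff)
      then show "m \<in> {m\<in>Bad. key m = key m1}" using bad by simp
    qed
    moreover have later: "0 \<le> qv k l n m1 x" if "x \<in> J g k" "last m1 < time x" for x
      using last_ge[OF that(1), of m1] that(2) by linarith
    moreover have "0 \<le> Poly_Mapping.lookup e a"
      using e ap(1) by (simp add: J_def nodes_def)
    ultimately show ?thesis
      using class_term_sum_zero[OF ap(1,2) ap(3)[symmetric] later e0] by simp
  qed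
  moreover have "(\<Sum>m\<in>Bad. term_at k l n m) = (\<Sum>y\<in>key ` Bad. \<Sum>m\<in>{m\<in>Bad. key m = y}. term_at k l n m)"
    by (rule sum.image_gen[OF finite_Bad])
  ultimately show ?thesis unfolding Bad_def[symmetric] by (simp add: sum.neutral)
qed

end

theorem theorem5p18:
  fixes g :: lie_type and k :: nat and l :: "nat \<Rightarrow> nat" and n :: "nat \<Rightarrow> nat \<Rightarrow> nat"
  assumes "admissible g" and "1 \<le> k"
  shows "PS g (phi (Z g k l n)) = PS g (phi (Z_restricted g k l n (\<lambda>_. 1)))"
proof
  fix e
  interpret lie_data g by unfold_locales (rule assms(1))
  show "PS g (phi (Z g k l n)) e = PS g (phi (Z_restricted g k l n (\<lambda>_. 1))) e"
  proof (cases "\<forall>b\<in>{1..rank g}. 0 \<le> Poly_Mapping.lookup e b")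
    case True
    define M where "M = {m\<in>families g k. u_exponent g k l n m = e}"
    define M1 where "M1 = {m\<in>families g k. u_exponent g k l n m = e \<and>
      (\<forall>a\<in>{1..rank g}. \<forall>j\<in>{1..t g a * k}. 0 \<le> q g k l n m a j)}"
    have M1: "M1 = M - {m. m \<in> families g k \<and> u_exponent g k l n m = e \<and> (\<exists>x\<in>J g k. qv k l n m x < 0)}"
    proof -
      have "(\<forall>a\<in>{1..rank g}. \<forall>j\<in>{1..t g a * k}. 0 \<le> q g k l n m a j) \<longleftrightarrow> \<not> (\<exists>x\<in>J g k. qv k l n m x < 0)" for m
      proof -
        have "(\<forall>a\<in>{1..rank g}. \<forall>j\<in>{1..t g a * k}. 0 \<le> q g k l n m a j) \<longleftrightarrow>
            (\<forall>a\<in>nodes g. \<forall>j\<in>{1..t g a * k}. 0 \<le> qv k l n m (a, j))"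
          unfolding nodes_def[symmetric] using q_eq_qv by simp
        also have "\<dots> \<longleftrightarrow> (\<forall>x\<in>J g k. 0 \<le> qv k l n m x)" by (fastforce simp: J_def nodes_def)
        finally show ?thesis by (simp add: not_less)
      qed
      then show ?thesis unfolding M_def M1_def by blast
    qed
    have finM: "finite M" unfolding M_def by (rule finite_u_exponent[OF assms(1)])
    have "phi (Z g k l n) e = (\<Sum>m\<in>M. term_at k l n m)"
      unfolding phi_def Z_def M_def by (simp add: eval_one_sum eval_summand)
    also have "\<dots> = (\<Sum>m\<in>M1. term_at k l n m) + (\<Sum>m | m \<in> families g k \<and> u_exponent g k l n m = e \<and> (\<exists>x\<in>J g k. qv k l n m x < 0). term_at k l n m)"
      unfolding M1 by (rule sum.subset_diff[OF _ finM]) (auto simp: M_def)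
    also have "\<dots> = (\<Sum>m\<in>M1. term_at k l n m)"
      using bad_term_sum_zero[where e = e and k = k and l = l and n = n] True by (simp add: nodes_def)
    also have "\<dots> = phi (Z_restricted g k l n (\<lambda>_. 1)) e"
      unfolding phi_def Z_restricted_def M1_def by (simp add: eval_one_sum eval_summand)
    finally show ?thesis by (simp add: PS_def)
  next
    case False
    then show ?thesis unfolding PS_def by (simp only: if_False)
  qed
qed

end
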